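(* Let $G$ be a structured bilinear (MIMO) system given by $\mathcal{C},\mathcal{K},\mathcal{N},\mathcal{B}$, with subsystem transfer functions $G_k$, and let $\widehat G$, with subsystem transfer functions $\widehat G_k$, be the reduced-order bilinear system constructed by projection with $W,V\in\mathbb{C}^{n\times r}$. Let $\sigma_1,\ldots,\sigma_k\in\mathbb{C}$ and $\varsigma_1,\ldots,\varsigma_\theta\in\mathbb{C}$ be sets of interpolation points at which the matrix functions $\mathcal{C}(s)$, $\mathcal{K}(s)^{-1}$, $\mathcal{N}(s)$, $\mathcal{B}(s)$ are analytic and $\widehat{\mathcal{K}}(s)$ is full-rank, and let $\ell_1,\ldots,\ell_k\ge0$ and $\nu_1,\ldots,\nu_\theta\ge0$ be integers. Then the following statements hold. (a) Let \[ V_{1,j_1}=\partial_{s^{j_1}}(\mathcal{K}^{-1}\mathcal{B})(\sigma_1),\qquad j_1=0,\ldots,\ell_1, \] and, for $2\le q\le k$ and $j_q=0,\ldots,\ell_q$, \[ \begin{aligned} V_{q,j_q}&=\partial_{s^{j_q}}\mathcal{K}^{-1}(\sigma_q)\Big(\prod_{j=1}^{q-2}\partial_{s^{\ell_{q-j}}}\big((I_{m^{j-1}}\otimes\mathcal{N})(I_{m^j}\otimes\mathcal{K}^{-1})\big)(\sigma_{q-j})\Big)\\ &\quad\times\partial_{s^{\ell_1}}\big((I_{m^{q-2}}\otimes\mathcal{N})(I_{m^{q-1}}\otimes\mathcal{K}^{-1})(I_{m^{q-1}}\otimes\mathcal{B})\big)(\sigma_1). \end{aligned} \] If $\operatorname{span}(V)\supseteq\operatorname{span}([V_{1,0},\ldots,V_{k,\ell_k}])$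 (the span of the columns of all $V_{q,j_q}$, $1\le q\le k$, $0\le j_q\le\ell_q$), then for each $1\le q\le k$ \[ \partial_{s_1^{\ell_1}\cdots s_{q-1}^{\ell_{q-1}}s_q^{j_q}}G_q(\sigma_1,\ldots,\sigma_q)=\partial_{s_1^{\ell_1}\cdots s_{q-1}^{\ell_{q-1}}s_q^{j_q}}\widehat G_q(\sigma_1,\ldots,\sigma_q),\qquad j_q=0,\ldots,\ell_q . \] (b) Let \[ W_{1,i_\theta}=\partial_{s^{i_\theta}}(\mathcal{K}^{-\mathsf H}\mathcal{C}^{\mathsf H})(\varsigma_\theta),\qquad i_\theta=0,\ldots,\nu_\theta, \] and, for $2\le\eta\le\theta$ and $i_{\theta-\eta+1}=0,\ldots,\nu_{\theta-\eta+1}$, \[ \begin{aligned} W_{\eta,i_{\theta-\eta+1}}&=\partial_{s^{i_{\theta-\eta+1}}}(\mathcal{K}^{-\mathsf H}\widetilde{\mathcal{N}}^{\mathsf H})(\varsigma_{\theta-\eta+1})\Big(\prod_{i=2}^{\eta-1}\partial_{s^{\nu_{\theta-\eta+i}}}\big(I_{m^{i-1}}\otimes\mathcal{K}^{-\mathsf H}\widetilde{\mathcal{N}}^{\mathsf H}\big)(\varsigma_{\theta-\eta+i})\Big)\\ &\quad\times\Big(I_{m^{\eta-1}}\otimes\partial_{s^{\nu_\theta}}(\mathcal{K}^{-\mathsf H}\mathcal{C}^{\mathsf H})(\varsigma_\theta)\Big). \end{aligned} \] If $\operatorname{span}(W)\supseteq\operatorname{span}([W_{1,0},\ldots,W_{\theta,\nu_1}])$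 (the span of the columns of all $W_{\eta,i_{\theta-\eta+1}}$, $1\le\eta\le\theta$, $0\le i_{\theta-\eta+1}\le\nu_{\theta-\eta+1}$), then for each $1\le\eta\le\theta$ \[ \partial_{s_1^{i_{\theta-\eta+1}}s_2^{\nu_{\theta-\eta+2}}\cdots s_\eta^{\nu_\theta}}G_\eta(\varsigma_{\theta-\eta+1},\ldots,\varsigma_\theta)=\partial_{s_1^{i_{\theta-\eta+1}}s_2^{\nu_{\theta-\eta+2}}\cdots s_\eta^{\nu_\theta}}\widehat G_\eta(\varsigma_{\theta-\eta+1},\ldots,\varsigma_\theta),\qquad i_{\theta-\eta+1}=0,\ldots,\nu_{\theta-\eta+1}. \] (c) If $V$ is constructed as in part (a) and $W$ as in part (b), then, additionally to the results in (a) and (b), the conditions \[ \begin{aligned} &\partial_{s_1^{\ell_1}\cdots s_{q-1}^{\ell_{q-1}}s_q^{j_q}s_{q+1}^{i_{\theta-\eta+1}}s_{q+2}^{\nu_{\theta-\eta+2}}\cdots s_{q+\eta}^{\nu_\theta}}G_{q+\eta}(\sigma_1,\ldots,\sigma_q,\varsigma_{\theta-\eta+1},\ldots,\varsigma_\theta)\\ &=\partial_{s_1^{\ell_1}\cdots s_{q-1}^{\ell_{q-1}}s_q^{j_q}s_{q+1}^{i_{\theta-\eta+1}}s_{q+2}^{\nu_{\theta-\eta+2}}\cdots s_{q+\eta}^{\nu_\theta}}\widehat G_{q+\eta}(\sigma_1,\ldots,\sigma_q,\varsigma_{\theta-\eta+1},\ldots,\varsigma_\theta) \end{aligned} \] hold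 for $j_q=0,\ldots,\ell_q$; $i_{\theta-\eta+1}=0,\ldots,\nu_{\theta-\eta+1}$; $1\le q\le k$ and $1\le\eta\le\theta$.
   Context: A structured bilinear MIMO (multi-input multi-output) system $G$ is described by matrix-valued functions of a complex variable $\mathcal{C}\colon\mathbb{C}\to\mathbb{C}^{p\times n}$, $\mathcal{K}\colon\mathbb{C}\to\mathbb{C}^{n\times n}$, $\mathcal{B}\colon\mathbb{C}\to\mathbb{C}^{n\times m}$, $\mathcal{N}_j\colon\mathbb{C}\to\mathbb{C}^{n\times n}$, $j=1,\ldots,m$ (which may fail to be defined, or $\mathcal{K}$ may fail to be invertible, at some points). Write \[ \mathcal{N}(s)=\begin{bmatrix}\mathcal{N}_1(s)&\ldots&\mathcal{N}_m(s)\end{bmatrix}\in\mathbb{C}^{n\times nm},\qquad \widetilde{\mathcal{N}}(s)=\begin{bmatrix}\mathcal{N}_1(s)\\ \vdots\\ \mathcal{N}_m(s)\end{bmatrix}\in\mathbb{C}^{nm\times n}. \] The regular subsystem transfer functions of $G$ are \[ G_k(s_1,\ldots,s_k)=\mathcal{C}(s_k)\mathcal{K}(s_k)^{-1}\Big(\prod_{j=1}^{k-1}\big(I_{m^{j-1}}\otimes\mathcal{N}(s_{k-j})\big)\big(I_{m^j}\otimes\mathcal{K}(s_{k-j})^{-1}\big)\Big)\big(I_{m^{k-1}}\otimes\mathcal{B}(s_1)\big),\qquad k\ge1, \] with $I_d$ the $d\times d$ identity and $\otimes$ the Kronecker product. Products $\prod_{j=a}^{b}A_j$ of matrices are ordered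 $A_aA_{a+1}\cdots A_b$; empty products are identities. Given model reduction bases (truncation matrices) $W,V\in\mathbb{C}^{n\times r}$, the reduced-order system $\widehat G$ is given by \[ \widehat{\mathcal{C}}(s)=\mathcal{C}(s)V,\quad \widehat{\mathcal{K}}(s)=W^{\mathsf H}\mathcal{K}(s)V,\quad \widehat{\mathcal{B}}(s)=W^{\mathsf H}\mathcal{B}(s),\quad \widehat{\mathcal{N}}_j(s)=W^{\mathsf H}\mathcal{N}_j(s)V,\ j=1,\ldots,m, \] $\widehat{\mathcal{N}}=[\widehat{\mathcal{N}}_1\ \ldots\ \widehat{\mathcal{N}}_m]$, and its transfer functions $\widehat G_k$ are defined by the same formula with hatted quantities. Here $^{\mathsf H}$ is the conjugate transpose and $\operatorname{span}$ of a matrix is its column space. Partial (complex) derivatives are denoted by \[ \partial_{s_1^{j_1}\cdots s_k^{j_k}}f(z_1,\ldots,z_k):=\frac{\partial^{j_1+\cdots+j_k}f}{\partial s_1^{j_1}\cdots\partial s_k^{j_k}}(z_1,\ldots,z_k); \] for a function $F$ of a single variable $s$, $\partial_{s^j}F(\sigma)$ is its $j$-th derivative at $\sigma$. Products and Kronecker products of matrix functions are pointwise. Derivatives of Hermitian conjugated functions are understood as Hermitian conjugates of derivatives: $\partial_{s^j}(\mathcal{K}^{-\mathsf H}\mathcal{C}^{\mathsf H})(\sigma):=\big(\partial_{s^j}(\mathcal{C}\mathcal{K}^{-1})(\sigma)\big)^{\mathsf H}$, $\partial_{s^j}(\mathcal{K}^{-\mathsf H}\widetilde{\mathcal{N}}^{\mathsf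 H})(\sigma):=\big(\partial_{s^j}(\widetilde{\mathcal{N}}\mathcal{K}^{-1})(\sigma)\big)^{\mathsf H}$, and $\partial_{s^j}(I_d\otimes\mathcal{K}^{-\mathsf H}\widetilde{\mathcal{N}}^{\mathsf H})(\sigma):=I_d\otimes\partial_{s^j}(\mathcal{K}^{-\mathsf H}\widetilde{\mathcal{N}}^{\mathsf H})(\sigma)$. *)

theory Defs
  imports
    "HOL-Complex_Analysis.Complex_Analysis"
    "Jordan_Normal_Form.Schur_Decomposition"
    "Jordan_Normal_Form.DL_Rank"
begin

text \<open>Only meaningful for invertible matrices; in the theorem it is applied to matrix functions
  that are invertible in a neighbourhood of the points in question.\<close>

definition mat_inv :: "complex mat \<Rightarrow> complex mat" where
  "mat_inv A = the (mat_inverse A)"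

definition kron :: "complex mat \<Rightarrow> complex mat \<Rightarrow> complex mat" where
  "kron A B = Matrix.mat (dim_row A * dim_row B) (dim_col A * dim_col B)
     (\<lambda>(i, j). A $$ (i div dim_row B, j div dim_col B) * B $$ (i mod dim_row B, j mod dim_col B))"

text \<open>The ordered product \<open>A a * A (a + 1) * \<dots> * A b\<close>; the parameter \<open>d\<close> is the number of rows
  of the product, so that an empty product is the identity of size \<open>d\<close>.\<close>

definition ordered_prod :: "nat \<Rightarrow> (nat \<Rightarrow> complex mat) \<Rightarrow> nat \<Rightarrow> nat \<Rightarrow> complex mat" where
  "ordered_prod d A a b = foldl (\<lambda>P j. P * A j) (1\<^sub>m d) [a..<Suc b]"

definition hconcat :: "nat \<Rightarrow> complex mat list \<Rightarrow> complex mat" where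
  "hconcat n Ms = mat_of_cols n (concat (map cols Ms))"

definition mat_analytic_at :: "(complex \<Rightarrow> complex mat) \<Rightarrow> complex \<Rightarrow> bool" where
  "mat_analytic_at F z \<longleftrightarrow>
     (\<forall>a < dim_row (F z). \<forall>b < dim_col (F z). (\<lambda>s. F s $$ (a, b)) analytic_on {z})"

definition mat_deriv :: "nat \<Rightarrow> (complex \<Rightarrow> complex mat) \<Rightarrow> complex \<Rightarrow> complex mat" where
  "mat_deriv j F z = Matrix.mat (dim_row (F z)) (dim_col (F z))
     (\<lambda>(a, b). (deriv ^^ j) (\<lambda>s. F s $$ (a, b)) z)"

text \<open>A function of the variables \<open>s\<^sub>1, \<dots>, s\<^sub>k\<close> is a function of \<open>s :: nat \<Rightarrow> complex\<close> that
  depends on \<open>s 1, \<dots>, s k\<close> only; likewise, a multi-index is a function \<open>j :: nat \<Rightarrow> nat\<close>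
  of which only the values at \<open>1, \<dots>, k\<close> matter.\<close>

definition partial_deriv ::
    "nat \<Rightarrow> ((nat \<Rightarrow> complex) \<Rightarrow> complex) \<Rightarrow> (nat \<Rightarrow> complex) \<Rightarrow> complex" where
  "partial_deriv i f = (\<lambda>z. deriv (\<lambda>t. f (z(i := t))) (z i))"

primrec mixed_deriv ::
    "nat \<Rightarrow> (nat \<Rightarrow> nat) \<Rightarrow> ((nat \<Rightarrow> complex) \<Rightarrow> complex) \<Rightarrow> (nat \<Rightarrow> complex) \<Rightarrow> complex" where
  "mixed_deriv 0 j f = f"
| "mixed_deriv (Suc k) j f = mixed_deriv k j ((partial_deriv (Suc k) ^^ j (Suc k)) f)"

definition mat_mixed_deriv ::
    "nat \<Rightarrow> (nat \<Rightarrow> nat) \<Rightarrow> ((nat \<Rightarrow> complex) \<Rightarrow> complex mat) \<Rightarrow> (nat \<Rightarrow> complex) \<Rightarrow> complex mat" where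
  "mat_mixed_deriv k j F z = Matrix.mat (dim_row (F z)) (dim_col (F z))
     (\<lambda>(a, b). mixed_deriv k j (\<lambda>s. F s $$ (a, b)) z)"

text \<open>The bilinear terms are \<open>Nmat S 1, \<dots>, Nmat S m\<close> with \<open>m = indim S\<close>. As functions are total,
  points where a matrix function is undefined are modelled by arbitrary values of the right size.\<close>

record bilinear_system =
  outdim :: nat
  statedim :: nat
  indim :: nat
  Cmat :: "complex \<Rightarrow> complex mat"
  Kmat :: "complex \<Rightarrow> complex mat"
  Bmat :: "complex \<Rightarrow> complex mat"
  Nmat :: "nat \<Rightarrow> complex \<Rightarrow> complex mat"

definition is_bilinear_system :: "bilinear_system \<Rightarrow> bool" where
  "is_bilinear_system S \<longleftrightarrow>
     (\<forall>s. Cmat S s \<in> carrier_mat (outdim S) (statedim S) \<and>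
          Kmat S s \<in> carrier_mat (statedim S) (statedim S) \<and>
          Bmat S s \<in> carrier_mat (statedim S) (indim S) \<and>
          (\<forall>j \<in> {1..indim S}. Nmat S j s \<in> carrier_mat (statedim S) (statedim S)))"

definition Kinv :: "bilinear_system \<Rightarrow> complex \<Rightarrow> complex mat" where
  "Kinv S s = mat_inv (Kmat S s)"

definition Nrow :: "bilinear_system \<Rightarrow> complex \<Rightarrow> complex mat" where
  "Nrow S s = Matrix.mat (statedim S) (statedim S * indim S)
     (\<lambda>(a, b). Nmat S (b div statedim S + 1) s $$ (a, b mod statedim S))"

definition Ncol :: "bilinear_system \<Rightarrow> complex \<Rightarrow> complex mat" where
  "Ncol S s = Matrix.mat (statedim S * indim S) (statedim S)
     (\<lambda>(a, b). Nmat S (a div statedim S + 1) s $$ (a mod statedim S, b))"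

text \<open>The regular subsystem transfer functions, for \<open>k \<ge> 1\<close>.\<close>

definition transfer :: "bilinear_system \<Rightarrow> nat \<Rightarrow> (nat \<Rightarrow> complex) \<Rightarrow> complex mat" where
  "transfer S k s =
     Cmat S (s k) * Kinv S (s k) *
     ordered_prod (statedim S)
       (\<lambda>j. kron (1\<^sub>m (indim S ^ (j - 1))) (Nrow S (s (k - j))) *
            kron (1\<^sub>m (indim S ^ j)) (Kinv S (s (k - j)))) 1 (k - 1) *
     kron (1\<^sub>m (indim S ^ (k - 1))) (Bmat S (s 1))"

definition reduced_system ::
    "complex mat \<Rightarrow> complex mat \<Rightarrow> bilinear_system \<Rightarrow> bilinear_system" where
  "reduced_system W V S =
     \<lparr> outdim = outdim S,
       statedim = dim_col V,
       indim = indim S,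
       Cmat = (\<lambda>s. Cmat S s * V),
       Kmat = (\<lambda>s. mat_adjoint W * Kmat S s * V),
       Bmat = (\<lambda>s. mat_adjoint W * Bmat S s),
       Nmat = (\<lambda>j s. mat_adjoint W * Nmat S j s * V) \<rparr>"

text \<open>Analyticity of \<open>K\<^sup>-\<^sup>1\<close> at \<open>z\<close> includes that it exists in a neighbourhood of \<open>z\<close>.\<close>

definition analytic_point :: "bilinear_system \<Rightarrow> complex \<Rightarrow> bool" where
  "analytic_point S z \<longleftrightarrow>
     mat_analytic_at (Cmat S) z \<and>
     (\<forall>\<^sub>F s in nhds z. invertible_mat (Kmat S s)) \<and> mat_analytic_at (Kinv S) z \<and>
     mat_analytic_at (Nrow S) z \<and>
     mat_analytic_at (Bmat S) z"

definition V_block ::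
    "bilinear_system \<Rightarrow> (nat \<Rightarrow> complex) \<Rightarrow> (nat \<Rightarrow> nat) \<Rightarrow> nat \<Rightarrow> nat \<Rightarrow> complex mat" where
  "V_block S \<sigma> l q j\<^sub>q =
     (if q = 1 then mat_deriv j\<^sub>q (\<lambda>s. Kinv S s * Bmat S s) (\<sigma> 1)
      else
        mat_deriv j\<^sub>q (Kinv S) (\<sigma> q) *
        ordered_prod (statedim S)
          (\<lambda>j. mat_deriv (l (q - j))
                 (\<lambda>s. kron (1\<^sub>m (indim S ^ (j - 1))) (Nrow S s) *
                      kron (1\<^sub>m (indim S ^ j)) (Kinv S s)) (\<sigma> (q - j))) 1 (q - 2) *
        mat_deriv (l 1)
          (\<lambda>s. kron (1\<^sub>m (indim S ^ (q - 2))) (Nrow S s) *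
               kron (1\<^sub>m (indim S ^ (q - 1))) (Kinv S s) *
               kron (1\<^sub>m (indim S ^ (q - 1))) (Bmat S s)) (\<sigma> 1))"

definition V_blocks ::
    "bilinear_system \<Rightarrow> nat \<Rightarrow> (nat \<Rightarrow> complex) \<Rightarrow> (nat \<Rightarrow> nat) \<Rightarrow> complex mat" where
  "V_blocks S k \<sigma> l =
     hconcat (statedim S) [V_block S \<sigma> l q j. q \<leftarrow> [1..<Suc k], j \<leftarrow> [0..<Suc (l q)]]"

text \<open>Derivatives of Hermitian conjugated functions are Hermitian conjugates of derivatives:
  \<open>KhCh_deriv S i z\<close> is the \<open>i\<close>-th derivative of \<open>K\<^sup>-\<^sup>H C\<^sup>H\<close> at \<open>z\<close>, and
  \<open>KhNh_deriv S i z\<close> the one of \<open>K\<^sup>-\<^sup>H Ncol\<^sup>H\<close>.\<close>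

definition KhCh_deriv :: "bilinear_system \<Rightarrow> nat \<Rightarrow> complex \<Rightarrow> complex mat" where
  "KhCh_deriv S i z = mat_adjoint (mat_deriv i (\<lambda>s. Cmat S s * Kinv S s) z)"

definition KhNh_deriv :: "bilinear_system \<Rightarrow> nat \<Rightarrow> complex \<Rightarrow> complex mat" where
  "KhNh_deriv S i z = mat_adjoint (mat_deriv i (\<lambda>s. Ncol S s * Kinv S s) z)"

text \<open>The last argument is the derivative order \<open>i\<close> with index \<open>\<theta> - \<eta> + 1\<close>. The product has
  \<open>m * n\<close> rows, as its first factor has (it starts with index 2).\<close>

definition W_block ::
    "bilinear_system \<Rightarrow> nat \<Rightarrow> (nat \<Rightarrow> complex) \<Rightarrow> (nat \<Rightarrow> nat) \<Rightarrow> nat \<Rightarrow> nat \<Rightarrow> complex mat" where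
  "W_block S \<theta> \<tau> \<nu> \<eta> i\<^sub>\<eta> =
     (if \<eta> = 1 then KhCh_deriv S i\<^sub>\<eta> (\<tau> \<theta>)
      else
        KhNh_deriv S i\<^sub>\<eta> (\<tau> (\<theta> - \<eta> + 1)) *
        ordered_prod (indim S * statedim S)
          (\<lambda>i. kron (1\<^sub>m (indim S ^ (i - 1)))
                 (KhNh_deriv S (\<nu> (\<theta> - \<eta> + i)) (\<tau> (\<theta> - \<eta> + i)))) 2 (\<eta> - 1) *
        kron (1\<^sub>m (indim S ^ (\<eta> - 1))) (KhCh_deriv S (\<nu> \<theta>) (\<tau> \<theta>)))"

definition W_blocks ::
    "bilinear_system \<Rightarrow> nat \<Rightarrow> (nat \<Rightarrow> complex) \<Rightarrow> (nat \<Rightarrow> nat) \<Rightarrow> complex mat" where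
  "W_blocks S \<theta> \<tau> \<nu> =
     hconcat (statedim S)
       [W_block S \<theta> \<tau> \<nu> \<eta> i. \<eta> \<leftarrow> [1..<Suc \<theta>], i \<leftarrow> [0..<Suc (\<nu> (\<theta> - \<eta> + 1))]]"

text \<open>Right interpolation uses the orders \<open>l 1, \<dots>, l (q - 1), j\<close>.\<close>

definition V_orders :: "(nat \<Rightarrow> nat) \<Rightarrow> nat \<Rightarrow> nat \<Rightarrow> nat \<Rightarrow> nat" where
  "V_orders l q j = l(q := j)"

text \<open>Left interpolation uses the points \<open>\<tau> (\<theta> - \<eta> + 1), \<dots>, \<tau> \<theta>\<close>, with orders
  \<open>i, \<nu> (\<theta> - \<eta> + 2), \<dots>, \<nu> \<theta>\<close>.\<close>

definition W_points :: "(nat \<Rightarrow> complex) \<Rightarrow> nat \<Rightarrow> nat \<Rightarrow> nat \<Rightarrow> complex" where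
  "W_points \<tau> \<theta> \<eta> = (\<lambda>a. \<tau> (\<theta> - \<eta> + a))"

definition W_orders :: "(nat \<Rightarrow> nat) \<Rightarrow> nat \<Rightarrow> nat \<Rightarrow> nat \<Rightarrow> nat \<Rightarrow> nat" where
  "W_orders \<nu> \<theta> \<eta> i = (\<lambda>a. \<nu> (\<theta> - \<eta> + a))(1 := i)"

text \<open>The first \<open>q\<close> entries of \<open>x\<close> followed by the entries \<open>y 1, y 2, \<dots>\<close>.\<close>

definition append_args :: "nat \<Rightarrow> (nat \<Rightarrow> 'a) \<Rightarrow> (nat \<Rightarrow> 'a) \<Rightarrow> nat \<Rightarrow> 'a" where
  "append_args q x y = (\<lambda>a. if a \<le> q then x a else y (a - q))"

end

theory Submission
  imports Defs
begin

text \<open>The two systems have states of different dimension, so single factors cannot be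
  compared. What can be compared is a chain cut at one variable, with the
  \<open>K\<^sup>-\<^sup>1\<close> of that variable left out on both sides: the reduced right part
  is \<open>W\<^sup>H\<close> times the full one, the reduced left part is the full one times
  \<open>V\<close>. These two relations are what the inductions carry, and the omitted
  \<open>K\<^sup>-\<^sup>1\<close> is where the projection identity acts.

  The outermost variable of a block needs all orders up to the prescribed one, because Leibniz's
  rule splits the derivative between the state and the factor next to it. The inner variables need
  only their prescribed order: once differentiated and evaluated, they contribute constants.

  For (c) the chain is cut between \<open>s\<^sub>q\<close> and
  \<open>s\<^sub>q\<^sub>+\<^sub>1\<close>. The differentiated left part, now with its
  \<open>K\<^sup>-\<^sup>1\<close>, is its reduced counterpart times \<open>W\<^sup>H\<close>, and
  just this \<open>W\<^sup>H\<close> turns the differentiated right part into the reduced one.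

  The matrix identities hold only near the points, where the inverses exist; derivatives see no more
  than that.\<close>

text \<open>
  Fix a word of indices in \<open>{1..m}\<close>, one for each bilinear factor. The corresponding column block
  of \<open>G\<^sub>k\<close> is \<open>C(s\<^sub>k) K(s\<^sub>k)\<^sup>-\<^sup>1 N(s\<^sub>k\<^sub>-\<^sub>1) K(s\<^sub>k\<^sub>-\<^sub>1)\<^sup>-\<^sup>1 \<dots> N(s\<^sub>1) K(s\<^sub>1)\<^sup>-\<^sup>1 B(s\<^sub>1)\<close>, a product of
  matrix functions of one variable each, so its mixed derivatives are products of ordinary
  derivatives. Let \<open>R = W\<^sup>H K V\<close>. As \<open>M V R\<^sup>-\<^sup>1 W\<^sup>H K\<close> acts on \<open>V\<close> like \<open>M\<close>, the Leibniz rule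
  shows that the derivatives of \<open>M K\<^sup>-\<^sup>1 Q\<close> and \<open>(M V) R\<^sup>-\<^sup>1 (W\<^sup>H Q)\<close> up to order \<open>l\<close> agree as soon
  as those of \<open>K\<^sup>-\<^sup>1 Q\<close> lie in the range of \<open>V\<close>; dually for \<open>P K\<^sup>-\<^sup>1 M\<close> and \<open>W\<^sup>H\<close>.
  Applied from the right with \<open>V\<close> and from the left with \<open>W\<close>, this replaces one factor after the
  other by its reduced counterpart.
\<close>

section \<open>Analytic matrix functions and their derivatives\<close>

lemma mult_mat_entry:
  assumes "A \<in> carrier_mat p n" "B \<in> carrier_mat n q" "i < p" "j < q"
  shows "(A * B) $$ (i, j) = (\<Sum>c = 0..<n. A $$ (i, c) * B $$ (c, j))"
  using assms by (auto simp: scalar_prod_def intro!: sum.cong)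

section \<open>Conjugate transposes\<close>

lemma mat_adjoint_carrier [simp]: "A \<in> carrier_mat p n \<Longrightarrow> mat_adjoint A \<in> carrier_mat n p"
  by (auto simp: mat_adjoint_def)

lemma dim_mat_adjoint [simp]: "dim_row (mat_adjoint A) = dim_col A" "dim_col (mat_adjoint A) = dim_row A"
  by (auto simp: mat_adjoint_def)

lemma mat_adjoint_entry:
  "A \<in> carrier_mat p n \<Longrightarrow> i < n \<Longrightarrow> j < p \<Longrightarrow> mat_adjoint A $$ (i, j) = cnj (A $$ (j, i))"
  by (auto simp: mat_adjoint_def mat_of_rows_def)

lemma mat_adjoint_mult:
  fixes A B :: "complex mat"
  assumes "A \<in> carrier_mat p n" "B \<in> carrier_mat n q"
  shows "mat_adjoint (A * B) = mat_adjoint B * mat_adjoint A"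
proof (rule eq_matI)
  have AB: "A * B \<in> carrier_mat p q" using assms by simp
  fix i j assume "i < dim_row (mat_adjoint B * mat_adjoint A)" "j < dim_col (mat_adjoint B * mat_adjoint A)"
  then have ij: "i < q" "j < p"
    using mat_adjoint_carrier[OF assms(1)] mat_adjoint_carrier[OF assms(2)] by auto
  show "mat_adjoint (A * B) $$ (i, j) = (mat_adjoint B * mat_adjoint A) $$ (i, j)"
    unfolding mat_adjoint_entry[OF AB ij] mult_mat_entry[OF assms ij(2,1)]
      mult_mat_entry[OF mat_adjoint_carrier[OF assms(2)] mat_adjoint_carrier[OF assms(1)] ij]
    by (auto simp: mat_adjoint_entry[OF assms(1)] mat_adjoint_entry[OF assms(2)] ij mult.commute
        intro!: sum.cong)
qed auto

lemma mat_adjoint_adjoint: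
  fixes A :: "complex mat"
  assumes "A \<in> carrier_mat p n"
  shows "mat_adjoint (mat_adjoint A) = A"
proof (rule eq_matI)
  fix i j assume "i < dim_row A" "j < dim_col A"
  then have "i < p" "j < n" using assms by auto
  then show "mat_adjoint (mat_adjoint A) $$ (i, j) = A $$ (i, j)"
    using mat_adjoint_entry[OF mat_adjoint_carrier[OF assms]] mat_adjoint_entry[OF assms] by simp
qed auto

text \<open>\<open>mat_inv\<close> has no known size where its argument is singular, so
  \<open>Kinv\<close> takes values of a fixed size only near a point. Therefore the size is part of
  this notion, and it is required in a neighbourhood instead of everywhere.\<close>

definition analytic_mat_at :: "nat \<Rightarrow> nat \<Rightarrow> (complex \<Rightarrow> complex mat) \<Rightarrow> complex \<Rightarrow> bool" where
  "analytic_mat_at p n F z \<longleftrightarrow> (\<forall>\<^sub>F s in nhds z. F s \<in> carrier_mat p n) \<and>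
     (\<forall>a < p. \<forall>b < n. (\<lambda>s. F s $$ (a, b)) analytic_on {z})"

lemma analytic_mat_at_carrier: "analytic_mat_at p n F z \<Longrightarrow> F z \<in> carrier_mat p n"
  unfolding analytic_mat_at_def using eventually_nhds_x_imp_x by fast

lemma analytic_mat_at_const [simp]: "A \<in> carrier_mat p n \<Longrightarrow> analytic_mat_at p n (\<lambda>_. A) z"
  by (auto simp: analytic_mat_at_def)

lemma analytic_mat_at_eventually_entry_mult:
  assumes "analytic_mat_at p n F z" "analytic_mat_at n q G z" "a < p" "b < q"
  shows "\<forall>\<^sub>F s in nhds z. (F s * G s) $$ (a, b) = (\<Sum>c = 0..<n. F s $$ (a, c) * G s $$ (c, b))"
proof -
  have "\<forall>\<^sub>F s in nhds z. F s \<in> carrier_mat p n" "\<forall>\<^sub>F s in nhds z. G s \<in> carrier_mat n q"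
    using assms by (auto simp: analytic_mat_at_def)
  then show ?thesis
    by eventually_elim (use assms mult_mat_entry in blast)
qed

lemma analytic_mat_at_mult:
  assumes "analytic_mat_at p n F z" "analytic_mat_at n q G z"
  shows "analytic_mat_at p q (\<lambda>s. F s * G s) z"
  unfolding analytic_mat_at_def
proof safe
  have "\<forall>\<^sub>F s in nhds z. F s \<in> carrier_mat p n" "\<forall>\<^sub>F s in nhds z. G s \<in> carrier_mat n q"
    using assms by (auto simp: analytic_mat_at_def)
  then show "\<forall>\<^sub>F s in nhds z. F s * G s \<in> carrier_mat p q"
    by eventually_elim auto
  fix a b assume ab: "a < p" "b < q"
  have "(\<lambda>s. \<Sum>c = 0..<n. F s $$ (a, c) * G s $$ (c, b)) analytic_on {z}"
    using assms ab by (intro analytic_intros) (auto simp: analytic_mat_at_def)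
  then show "(\<lambda>s. (F s * G s) $$ (a, b)) analytic_on {z}"
    using analytic_at_cong[OF analytic_mat_at_eventually_entry_mult[OF assms ab]] by blast
qed

lemma analytic_mat_at_minus:
  assumes "analytic_mat_at p n F z" "analytic_mat_at p n G z"
  shows "analytic_mat_at p n (\<lambda>s. F s - G s) z"
  unfolding analytic_mat_at_def
proof safe
  have ev: "\<forall>\<^sub>F s in nhds z. F s \<in> carrier_mat p n" "\<forall>\<^sub>F s in nhds z. G s \<in> carrier_mat p n"
    using assms by (auto simp: analytic_mat_at_def)
  then show "\<forall>\<^sub>F s in nhds z. F s - G s \<in> carrier_mat p n"
    by eventually_elim auto
  fix a b assume ab: "a < p" "b < n"
  have "(\<lambda>s. F s $$ (a, b) - G s $$ (a, b)) analytic_on {z}"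
    using assms ab by (intro analytic_intros) (auto simp: analytic_mat_at_def)
  moreover from ev have "\<forall>\<^sub>F s in nhds z. (F s - G s) $$ (a, b) = F s $$ (a, b) - G s $$ (a, b)"
    by eventually_elim (use ab in auto)
  ultimately show "(\<lambda>s. (F s - G s) $$ (a, b)) analytic_on {z}"
    by (simp add: analytic_at_cong)
qed

section \<open>Derivatives of matrix functions and Leibniz's rule\<close>

lemma mat_deriv_carrier: "analytic_mat_at p n F z \<Longrightarrow> mat_deriv j F z \<in> carrier_mat p n"
  using analytic_mat_at_carrier[of p n F z] by (auto simp: mat_deriv_def)

lemma mat_deriv_entry:
  "analytic_mat_at p n F z \<Longrightarrow> a < p \<Longrightarrow> b < n \<Longrightarrow>
   mat_deriv j F z $$ (a, b) = (deriv ^^ j) (\<lambda>s. F s $$ (a, b)) z"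
  using analytic_mat_at_carrier[of p n F z] by (auto simp: mat_deriv_def)

lemma mat_deriv_cong:
  assumes "\<forall>\<^sub>F s in nhds z. F s = G s"
  shows "mat_deriv j F z = mat_deriv j G z"
proof -
  have "(deriv ^^ j) (\<lambda>s. F s $$ (a, b)) z = (deriv ^^ j) (\<lambda>s. G s $$ (a, b)) z" for a b
    by (rule higher_deriv_cong_ev) (use assms in \<open>auto elim: eventually_mono\<close>)
  moreover have "F z = G z"
    using assms eventually_nhds_x_imp_x by fast
  ultimately show ?thesis by (simp add: mat_deriv_def)
qed

lemma higher_deriv_sum_at:
  fixes z :: complex
  assumes "finite I" "\<And>i. i \<in> I \<Longrightarrow> f i analytic_on {z}"
  shows "(deriv ^^ n) (\<lambda>w. \<Sum>i\<in>I. f i w) z = (\<Sum>i\<in>I. (deriv ^^ n) (f i) z)"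
  using assms
proof (induction I rule: finite_induct)
  case (insert i I)
  then have "(deriv ^^ n) (\<lambda>w. f i w + (\<Sum>i\<in>I. f i w)) z =
      (deriv ^^ n) (f i) z + (deriv ^^ n) (\<lambda>w. \<Sum>i\<in>I. f i w) z"
    by (intro higher_deriv_add_at analytic_intros) auto
  then show ?case using insert by simp
qed (simp)

text \<open>Leibniz's rule is taken entry by entry, so that the outer sum is one of complex numbers:
  the type of matrices contains all sizes and has no single zero from which a sum of matrices could
  start.\<close>

lemma mat_deriv_mult_entry:
  assumes F: "analytic_mat_at p n F z" and G: "analytic_mat_at n q G z" and "a < p" "b < q"
  shows "mat_deriv j (\<lambda>s. F s * G s) z $$ (a, b) =
    (\<Sum>i = 0..j. of_nat (j choose i) * (mat_deriv i F z * mat_deriv (j - i) G z) $$ (a, b))"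
proof -
  have "mat_deriv j (\<lambda>s. F s * G s) z $$ (a, b) = (deriv ^^ j) (\<lambda>s. (F s * G s) $$ (a, b)) z"
    using mat_deriv_entry[OF analytic_mat_at_mult[OF F G]] assms by blast
  also have "\<dots> = (deriv ^^ j) (\<lambda>s. \<Sum>c = 0..<n. F s $$ (a, c) * G s $$ (c, b)) z"
    by (rule higher_deriv_cong_ev[OF analytic_mat_at_eventually_entry_mult[OF assms]]) simp
  also have "\<dots> = (\<Sum>c = 0..<n. (deriv ^^ j) (\<lambda>s. F s $$ (a, c) * G s $$ (c, b)) z)"
    using assms by (intro higher_deriv_sum_at analytic_intros) (auto simp: analytic_mat_at_def)
  also have "\<dots> = (\<Sum>c = 0..<n. \<Sum>i = 0..j. of_nat (j choose i) *
      (deriv ^^ i) (\<lambda>s. F s $$ (a, c)) z * (deriv ^^ (j - i)) (\<lambda>s. G s $$ (c, b)) z)"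
    using assms by (intro sum.cong higher_deriv_mult_at refl) (auto simp: analytic_mat_at_def)
  also have "\<dots> = (\<Sum>i = 0..j. \<Sum>c = 0..<n. of_nat (j choose i) *
      (mat_deriv i F z $$ (a, c) * mat_deriv (j - i) G z $$ (c, b)))"
    by (subst sum.swap) (use assms in \<open>simp add: mat_deriv_entry[OF F] mat_deriv_entry[OF G] mult.assoc\<close>)
  also have "\<dots> = (\<Sum>i = 0..j. of_nat (j choose i) * (mat_deriv i F z * mat_deriv (j - i) G z) $$ (a, b))"
    by (simp add: mult_mat_entry[OF mat_deriv_carrier[OF F] mat_deriv_carrier[OF G] assms(3,4)]
        sum_distrib_left)
  finally show ?thesis .
qed

lemma mat_deriv_const:
  assumes "A \<in> carrier_mat p n"
  shows "mat_deriv j (\<lambda>_. A) z = (if j = 0 then A else 0\<^sub>m p n)"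
  using assms by (auto simp: mat_deriv_def intro!: eq_matI)

lemma mat_deriv_mult_right:
  assumes F: "analytic_mat_at p n F z" and A: "A \<in> carrier_mat n q"
  shows "mat_deriv j (\<lambda>s. F s * A) z = mat_deriv j F z * A"
proof (rule eq_matI)
  note FA = mat_deriv_carrier[OF analytic_mat_at_mult[OF F analytic_mat_at_const[OF A]]]
  note C = mat_deriv_carrier[OF F]
  fix a b assume "a < dim_row (mat_deriv j F z * A)" "b < dim_col (mat_deriv j F z * A)"
  then have ab: "a < p" "b < q" using C[of j] A by auto
  \<comment> \<open>Derivatives of positive order of the constant vanish, so a single Leibniz term
    survives.\<close>
  have "of_nat (j choose i) * (mat_deriv i F z * mat_deriv (j - i) (\<lambda>_. A) z) $$ (a, b) =
     (if i = j then (mat_deriv j F z * A) $$ (a, b) else 0)" if "i \<in> {0..j}" for i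
    using that ab C[of i] by (auto simp: mat_deriv_const[OF A])
  then have "mat_deriv j (\<lambda>s. F s * A) z $$ (a, b) =
      (\<Sum>i = 0..j. if i = j then (mat_deriv j F z * A) $$ (a, b) else 0)"
    unfolding mat_deriv_mult_entry[OF F analytic_mat_at_const[OF A] ab] by (intro sum.cong refl)
  then show "mat_deriv j (\<lambda>s. F s * A) z $$ (a, b) = (mat_deriv j F z * A) $$ (a, b)"
    by simp
qed (use mat_deriv_carrier[OF analytic_mat_at_mult[OF F analytic_mat_at_const[OF A]], of j] mat_deriv_carrier[OF F, of j] A in auto)

lemma mat_deriv_mult_left:
  assumes A: "A \<in> carrier_mat p n" and F: "analytic_mat_at n q F z"
  shows "mat_deriv j (\<lambda>s. A * F s) z = A * mat_deriv j F z"
proof (rule eq_matI)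
  note C = mat_deriv_carrier[OF F]
  fix a b assume "a < dim_row (A * mat_deriv j F z)" "b < dim_col (A * mat_deriv j F z)"
  then have ab: "a < p" "b < q" using C[of j] A by auto
  have "of_nat (j choose i) * (mat_deriv i (\<lambda>_. A) z * mat_deriv (j - i) F z) $$ (a, b) =
     (if i = 0 then (A * mat_deriv j F z) $$ (a, b) else 0)" if "i \<in> {0..j}" for i
    using that ab C[of "j - i"] by (auto simp: mat_deriv_const[OF A])
  then have "mat_deriv j (\<lambda>s. A * F s) z $$ (a, b) =
      (\<Sum>i = 0..j. if i = 0 then (A * mat_deriv j F z) $$ (a, b) else 0)"
    unfolding mat_deriv_mult_entry[OF analytic_mat_at_const[OF A] F ab] by (intro sum.cong refl)
  then show "mat_deriv j (\<lambda>s. A * F s) z $$ (a, b) = (A * mat_deriv j F z) $$ (a, b)"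
    by simp
qed (use mat_deriv_carrier[OF analytic_mat_at_mult[OF analytic_mat_at_const[OF A] F], of j] mat_deriv_carrier[OF F, of j] A in auto)

lemma mat_deriv_minus:
  assumes F: "analytic_mat_at p n F z" and G: "analytic_mat_at p n G z"
  shows "mat_deriv j (\<lambda>s. F s - G s) z = mat_deriv j F z - mat_deriv j G z"
proof (rule eq_matI)
  note C = mat_deriv_carrier[OF F, of j] mat_deriv_carrier[OF G, of j]
  fix a b assume "a < dim_row (mat_deriv j F z - mat_deriv j G z)" "b < dim_col (mat_deriv j F z - mat_deriv j G z)"
  then have ab: "a < p" "b < n" using C by auto
  have "\<forall>\<^sub>F s in nhds z. F s \<in> carrier_mat p n" "\<forall>\<^sub>F s in nhds z. G s \<in> carrier_mat p n"
    using assms by (auto simp: analytic_mat_at_def)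
  then have "\<forall>\<^sub>F s in nhds z. (F s - G s) $$ (a, b) = F s $$ (a, b) - G s $$ (a, b)"
    by eventually_elim (use ab in auto)
  then have "(deriv ^^ j) (\<lambda>s. (F s - G s) $$ (a, b)) z = (deriv ^^ j) (\<lambda>s. F s $$ (a, b) - G s $$ (a, b)) z"
    by (intro higher_deriv_cong_ev) auto
  also have "\<dots> = (deriv ^^ j) (\<lambda>s. F s $$ (a, b)) z - (deriv ^^ j) (\<lambda>s. G s $$ (a, b)) z"
    using assms ab by (intro higher_deriv_diff_at) (auto simp: analytic_mat_at_def)
  finally show "mat_deriv j (\<lambda>s. F s - G s) z $$ (a, b) = (mat_deriv j F z - mat_deriv j G z) $$ (a, b)"
    using ab C by (simp add: mat_deriv_entry[OF analytic_mat_at_minus[OF F G]] mat_deriv_entry[OF F] mat_deriv_entry[OF G])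
qed (use mat_deriv_carrier[OF analytic_mat_at_minus[OF F G], of j] mat_deriv_carrier[OF F, of j] mat_deriv_carrier[OF G, of j] in auto)

text \<open>Each Leibniz term contains a derivative of \<open>X\<close>, of the form
  \<open>V * Y\<close>, and a derivative of \<open>D\<close>. As \<open>V\<close> is constant, the
  latter times \<open>V\<close> is a derivative of \<open>D * V\<close>, which vanishes near
  \<open>z\<close>. All orders up to \<open>j\<close> of \<open>X\<close> occur, hence the
  hypothesis for every \<open>i \<le> j\<close>.\<close>

lemma mat_deriv_mult_eq_0:
  assumes D: "analytic_mat_at p n D z" and X: "analytic_mat_at n q X z" and V: "V \<in> carrier_mat n r"
    and DV: "\<forall>\<^sub>F s in nhds z. D s * V = 0\<^sub>m p r"
    and im: "\<And>i. i \<le> j \<Longrightarrow> \<exists>Y \<in> carrier_mat r q. mat_deriv i X z = V * Y"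
  shows "mat_deriv j (\<lambda>s. D s * X s) z = 0\<^sub>m p q"
proof (rule eq_matI)
  fix a b assume "a < dim_row (0\<^sub>m p q :: complex mat)" "b < dim_col (0\<^sub>m p q :: complex mat)"
  then have ab: "a < p" "b < q" by auto
  have "(mat_deriv i D z * mat_deriv (j - i) X z) $$ (a, b) = 0" if i: "i \<in> {0..j}" for i
  proof -
    obtain Y where Y: "Y \<in> carrier_mat r q" "mat_deriv (j - i) X z = V * Y"
      using im[of "j - i"] by auto
    have "mat_deriv i D z * mat_deriv (j - i) X z = mat_deriv i D z * V * Y"
      using Y V mat_deriv_carrier[OF D, of i] by simp
    also have "mat_deriv i D z * V = mat_deriv i (\<lambda>s. D s * V) z"
      using mat_deriv_mult_right[OF D V] by simp
    also have "\<dots> = mat_deriv i (\<lambda>_. 0\<^sub>m p r) z"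
      by (rule mat_deriv_cong[OF DV])
    also have "\<dots> = 0\<^sub>m p r"
      by (simp add: mat_deriv_const[of _ p r])
    finally show ?thesis using Y ab by simp
  qed
  then show "mat_deriv j (\<lambda>s. D s * X s) z $$ (a, b) = 0\<^sub>m p q $$ (a, b)"
    unfolding mat_deriv_mult_entry[OF D X ab] using ab by simp
qed (use mat_deriv_carrier[OF analytic_mat_at_mult[OF D X], of j] in auto)

lemma mat_deriv_mult_eq_0':
  assumes X: "analytic_mat_at p n X z" and D: "analytic_mat_at n q D z" and E: "E \<in> carrier_mat r n"
    and ED: "\<forall>\<^sub>F s in nhds z. E * D s = 0\<^sub>m r q"
    and im: "\<And>i. i \<le> j \<Longrightarrow> \<exists>Y \<in> carrier_mat p r. mat_deriv i X z = Y * E"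
  shows "mat_deriv j (\<lambda>s. X s * D s) z = 0\<^sub>m p q"
proof (rule eq_matI)
  fix a b assume "a < dim_row (0\<^sub>m p q :: complex mat)" "b < dim_col (0\<^sub>m p q :: complex mat)"
  then have ab: "a < p" "b < q" by auto
  have "(mat_deriv i X z * mat_deriv (j - i) D z) $$ (a, b) = 0" if i: "i \<in> {0..j}" for i
  proof -
    obtain Y where Y: "Y \<in> carrier_mat p r" "mat_deriv i X z = Y * E"
      using im[of i] i by auto
    have "mat_deriv i X z * mat_deriv (j - i) D z = Y * (E * mat_deriv (j - i) D z)"
      using Y E mat_deriv_carrier[OF D, of "j - i"] by simp
    also have "E * mat_deriv (j - i) D z = mat_deriv (j - i) (\<lambda>s. E * D s) z"
      using mat_deriv_mult_left[OF E D] by simp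
    also have "\<dots> = mat_deriv (j - i) (\<lambda>_. 0\<^sub>m r q) z"
      by (rule mat_deriv_cong[OF ED])
    also have "\<dots> = 0\<^sub>m r q"
      by (simp add: mat_deriv_const[of _ r q])
    finally show ?thesis using Y ab by simp
  qed
  then show "mat_deriv j (\<lambda>s. X s * D s) z $$ (a, b) = 0\<^sub>m p q $$ (a, b)"
    unfolding mat_deriv_mult_entry[OF X D ab] using ab by simp
qed (use mat_deriv_carrier[OF analytic_mat_at_mult[OF X D], of j] in auto)

section \<open>Projection of the resolvent\<close>

lemma det_analytic:
  assumes "analytic_mat_at n n F z"
  shows "(\<lambda>s. Determinant.det (F s)) analytic_on {z}"
proof -
  have "(\<lambda>s. \<Sum>p \<in> {p. p permutes {0..<n}}. signof p * (\<Prod>i = 0..<n. F s $$ (i, p i))) analytic_on {z}"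
    using assms permutes_in_image by (intro analytic_intros) (fastforce simp: analytic_mat_at_def)+
  moreover have "\<forall>\<^sub>F s in nhds z. Determinant.det (F s) =
      (\<Sum>p \<in> {p. p permutes {0..<n}}. signof p * (\<Prod>i = 0..<n. F s $$ (i, p i)))"
    using assms det_def' unfolding analytic_mat_at_def by (auto elim!: eventually_mono)
  ultimately show ?thesis by (simp add: analytic_at_cong)
qed

lemma analytic_mat_at_mat_delete:
  assumes "analytic_mat_at p n F z"
  shows "analytic_mat_at (p - 1) (n - 1) (\<lambda>s. mat_delete (F s) i j) z"
  unfolding analytic_mat_at_def
proof safe
  have ev: "\<forall>\<^sub>F s in nhds z. F s \<in> carrier_mat p n" using assms by (auto simp: analytic_mat_at_def)
  then show "\<forall>\<^sub>F s in nhds z. mat_delete (F s) i j \<in> carrier_mat (p - 1) (n - 1)"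
    by eventually_elim (auto simp: mat_delete_def)
  fix a b assume ab: "a < p - 1" "b < n - 1"
  have "(\<lambda>s. F s $$ (if a < i then a else Suc a, if b < j then b else Suc b)) analytic_on {z}"
    using assms ab by (auto simp: analytic_mat_at_def)
  moreover from ev have "\<forall>\<^sub>F s in nhds z. mat_delete (F s) i j $$ (a, b) =
      F s $$ (if a < i then a else Suc a, if b < j then b else Suc b)"
    by eventually_elim (use ab in \<open>auto simp: mat_delete_def\<close>)
  ultimately show "(\<lambda>s. mat_delete (F s) i j $$ (a, b)) analytic_on {z}"
    by (simp add: analytic_at_cong)
qed

text \<open>Cramer's rule: the entries of the inverse are cofactors divided by a determinant that
  does not vanish near \<open>z\<close>. This serves in both directions, to obtain
  \<open>Kmat\<close> from the analytic \<open>Kinv\<close>, and the reduced \<open>Kinv\<close>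
  from the reduced \<open>Kmat\<close>.\<close>

lemma analytic_mat_at_inverse:
  assumes F: "analytic_mat_at n n F z"
    and inv: "\<forall>\<^sub>F s in nhds z. G s \<in> carrier_mat n n \<and> F s * G s = 1\<^sub>m n \<and> G s * F s = 1\<^sub>m n"
  shows "analytic_mat_at n n G z"
  unfolding analytic_mat_at_def
proof safe
  show "\<forall>\<^sub>F s in nhds z. G s \<in> carrier_mat n n" using inv by (auto elim: eventually_mono)
  fix a b assume ab: "a < n" "b < n"
  have ev: "\<forall>\<^sub>F s in nhds z. F s \<in> carrier_mat n n" using assms by (auto simp: analytic_mat_at_def)
  have nz: "\<forall>\<^sub>F s in nhds z. Determinant.det (F s) \<noteq> 0"
    using inv ev
  proof eventually_elim
    case (elim s)
    then have "Determinant.det (F s) * Determinant.det (G s) = 1"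
      using det_mult[of "F s" n "G s"] by simp
    then show ?case by auto
  qed
  have "(\<lambda>s. cofactor (F s) b a / Determinant.det (F s)) analytic_on {z}"
    unfolding cofactor_def
    using det_analytic[OF F] det_analytic[OF analytic_mat_at_mat_delete[OF F]] eventually_nhds_x_imp_x[OF nz]
    by (intro analytic_intros) auto
  moreover from inv ev nz have "\<forall>\<^sub>F s in nhds z. G s $$ (a, b) = cofactor (F s) b a / Determinant.det (F s)"
  proof eventually_elim
    case (elim s)
    \<comment> \<open>Inserting \<open>G * F = 1\<close> in front of the adjugate lets
      \<open>F * adj F = det F\<close> act.\<close>
    have "adj_mat (F s) = G s * F s * adj_mat (F s)"
      using elim left_mult_one_mat[OF adj_mat(1)[of "F s" n]] by metis
    also have "\<dots> = G s * (F s * adj_mat (F s))"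
      using elim adj_mat(1)[of "F s" n] by (intro assoc_mult_mat[of _ n n _ n _ n]) auto
    also have "\<dots> = Determinant.det (F s) \<cdot>\<^sub>m G s"
      using elim adj_mat(2)[of "F s" n] mult_smult_distrib[of "G s" n n "1\<^sub>m n" n] right_mult_one_mat[of "G s" n n] by simp
    finally have "adj_mat (F s) $$ (a, b) = Determinant.det (F s) * G s $$ (a, b)"
      using ab elim by auto
    then have "cofactor (F s) b a = Determinant.det (F s) * G s $$ (a, b)"
      using ab elim by (simp add: adj_mat_def)
    then show ?case using elim by simp
  qed
  ultimately show "(\<lambda>s. G s $$ (a, b)) analytic_on {z}"
    by (simp add: analytic_at_cong)
qed

lemma mat_inv:
  assumes A: "A \<in> carrier_mat n n" and inv: "invertible_mat A"
  shows "mat_inv A \<in> carrier_mat n n" "A * mat_inv A = 1\<^sub>m n" "mat_inv A * A = 1\<^sub>m n"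
proof -
  obtain B where B: "inverts_mat A B" "inverts_mat B A"
    using inv by (auto simp: invertible_mat_def)
  then have AB: "A * B = 1\<^sub>m n" and BA: "B * A = 1\<^sub>m (dim_row B)"
    using A by (auto simp: inverts_mat_def)
  have "dim_col B = n" using arg_cong[OF AB, of dim_col] by simp
  moreover have "dim_row B = n" using arg_cong[OF BA, of dim_col] A by simp
  ultimately have "B \<in> carrier_mat n n" by auto
  \<comment> \<open>\<open>mat_inverse\<close> returns \<open>None\<close> only outside the units of
    the matrix ring.\<close>
  then have "A \<in> Units (ring_mat TYPE(complex) n ())"
    using A AB BA by (auto simp: Units_def ring_mat_simps intro!: bexI[of _ B])
  then obtain C where "mat_inverse A = Some C"
    using mat_inverse(1)[OF A, of "()"] by (cases "mat_inverse A") auto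
  with mat_inverse(2)[OF A] show "mat_inv A \<in> carrier_mat n n" "A * mat_inv A = 1\<^sub>m n" "mat_inv A * A = 1\<^sub>m n"
    by (auto simp: mat_inv_def)
qed

lemma analytic_mat_at_imp_mat_analytic_at: "analytic_mat_at p n F z \<Longrightarrow> mat_analytic_at F z"
  using analytic_mat_at_carrier[of p n F z] by (auto simp: mat_analytic_at_def analytic_mat_at_def)

lemma mat_analytic_at_imp:
  assumes "mat_analytic_at F z" "\<forall>\<^sub>F s in nhds z. F s \<in> carrier_mat p n"
  shows "analytic_mat_at p n F z"
  using assms eventually_nhds_x_imp_x[OF assms(2)] by (auto simp: mat_analytic_at_def analytic_mat_at_def)

lemma eventually_analytic_mat_at:
  assumes "analytic_mat_at p n F z"
  shows "\<forall>\<^sub>F s in nhds z. analytic_mat_at p n F s"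
proof -
  have "\<forall>\<^sub>F s in nhds z. \<forall>a \<in> {..<p}. \<forall>b \<in> {..<n}. (\<lambda>s. F s $$ (a, b)) analytic_on {s}"
  proof (intro eventually_ball_finite ballI finite_lessThan)
    fix a b assume "a \<in> {..<p}" "b \<in> {..<n}"
    then have "(\<lambda>s. F s $$ (a, b)) analytic_on {z}" using assms by (auto simp: analytic_mat_at_def)
    then obtain U where U: "open U" "z \<in> U" "(\<lambda>s. F s $$ (a, b)) holomorphic_on U"
      by (auto simp: analytic_at)
    then show "\<forall>\<^sub>F s in nhds z. (\<lambda>s. F s $$ (a, b)) analytic_on {s}"
      by (auto simp: eventually_nhds analytic_at intro!: exI[of _ U])
  qed
  moreover have "\<forall>\<^sub>F s in nhds z. \<forall>\<^sub>F t in nhds s. F t \<in> carrier_mat p n"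
    using assms by (simp add: analytic_mat_at_def eventually_eventually)
  ultimately show ?thesis
    by eventually_elim (auto simp: analytic_mat_at_def)
qed

section \<open>Analyticity of the system and of its reduction\<close>

lemma bilinear_carrier:
  assumes "is_bilinear_system S"
  shows "Cmat S s \<in> carrier_mat (outdim S) (statedim S)"
    "Kmat S s \<in> carrier_mat (statedim S) (statedim S)"
    "Bmat S s \<in> carrier_mat (statedim S) (indim S)"
    "j \<in> {1..indim S} \<Longrightarrow> Nmat S j s \<in> carrier_mat (statedim S) (statedim S)"
  using assms by (auto simp: is_bilinear_system_def)

lemma eventually_Kinv:
  assumes "is_bilinear_system S" "analytic_point S z"
  shows "\<forall>\<^sub>F s in nhds z. Kinv S s \<in> carrier_mat (statedim S) (statedim S) \<and>
     Kmat S s * Kinv S s = 1\<^sub>m (statedim S) \<and> Kinv S s * Kmat S s = 1\<^sub>m (statedim S)"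
proof -
  have "\<forall>\<^sub>F s in nhds z. invertible_mat (Kmat S s)"
    using assms by (auto simp: analytic_point_def)
  then show ?thesis
    by eventually_elim (use mat_inv[OF bilinear_carrier(2)[OF assms(1)]] in \<open>auto simp: Kinv_def\<close>)
qed

lemma analytic_point_iff:
  assumes S: "is_bilinear_system S"
  shows "analytic_point S z \<longleftrightarrow>
     analytic_mat_at (outdim S) (statedim S) (Cmat S) z \<and>
     (\<forall>\<^sub>F s in nhds z. invertible_mat (Kmat S s)) \<and> analytic_mat_at (statedim S) (statedim S) (Kinv S) z \<and>
     analytic_mat_at (statedim S) (statedim S * indim S) (Nrow S) z \<and>
     analytic_mat_at (statedim S) (indim S) (Bmat S) z" (is "?L \<longleftrightarrow> ?R")
proof
  assume ?L
  moreover have "\<forall>\<^sub>F s in nhds z. Kinv S s \<in> carrier_mat (statedim S) (statedim S)"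
    using eventually_Kinv[OF S \<open>?L\<close>] by (auto elim: eventually_mono)
  ultimately show ?R
    using bilinear_carrier[OF S]
    by (auto simp: analytic_point_def Nrow_def intro!: mat_analytic_at_imp)
qed (auto simp: analytic_point_def analytic_mat_at_imp_mat_analytic_at)

text \<open>The formula for the transfer functions as products over words is available at analytic
  points only. To differentiate it, it must hold in a neighbourhood, so being such a point has to be
  an open condition.\<close>

lemma eventually_analytic_point:
  assumes S: "is_bilinear_system S" and z: "analytic_point S z"
  shows "\<forall>\<^sub>F s in nhds z. analytic_point S s"
proof -
  have "\<forall>\<^sub>F s in nhds z. \<forall>\<^sub>F s in nhds s. invertible_mat (Kmat S s)"
    using z by (simp add: analytic_point_def eventually_eventually)
  then show ?thesis
    using z unfolding analytic_point_iff[OF S]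
    by (auto simp: eventually_conj_iff intro: eventually_analytic_mat_at)
qed

text \<open>Analyticity is assumed of \<open>Kinv\<close>, but the operators in the projection
  lemmas contain \<open>Kmat\<close> itself.\<close>

lemma analytic_mat_at_Kmat:
  assumes S: "is_bilinear_system S" and z: "analytic_point S z"
  shows "analytic_mat_at (statedim S) (statedim S) (Kmat S) z"
proof (rule analytic_mat_at_inverse)
  show "analytic_mat_at (statedim S) (statedim S) (Kinv S) z"
    using z analytic_point_iff[OF S] by blast
  show "\<forall>\<^sub>F s in nhds z. Kmat S s \<in> carrier_mat (statedim S) (statedim S) \<and>
     Kinv S s * Kmat S s = 1\<^sub>m (statedim S) \<and> Kmat S s * Kinv S s = 1\<^sub>m (statedim S)"
    using eventually_Kinv[OF assms] by eventually_elim (use bilinear_carrier(2)[OF S] in auto)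
qed

lemma Nrow_entry:
  assumes "a < statedim S" "b < statedim S" "c < indim S"
  shows "Nrow S s $$ (a, c * statedim S + b) = Nmat S (Suc c) s $$ (a, b)"
proof -
  have "c * statedim S + b < Suc c * statedim S" using assms by simp
  also have "\<dots> \<le> statedim S * indim S" using assms(3) by (metis Suc_leI mult.commute mult_le_mono2)
  finally show ?thesis using assms by (simp add: Nrow_def)
qed

lemma analytic_mat_at_Nmat:
  assumes S: "is_bilinear_system S" and z: "analytic_point S z" and c: "c < indim S"
  shows "analytic_mat_at (statedim S) (statedim S) (Nmat S (Suc c)) z"
  unfolding analytic_mat_at_def
proof safe
  show "\<forall>\<^sub>F s in nhds z. Nmat S (Suc c) s \<in> carrier_mat (statedim S) (statedim S)"
    using bilinear_carrier(4)[OF S] c by auto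
  fix a b assume ab: "a < statedim S" "b < statedim S"
  have "c * statedim S + b < Suc c * statedim S" using ab by simp
  also have "\<dots> \<le> statedim S * indim S" using c by (metis Suc_leI mult.commute mult_le_mono2)
  finally have "(\<lambda>s. Nrow S s $$ (a, c * statedim S + b)) analytic_on {z}"
    using z ab unfolding analytic_point_iff[OF S] analytic_mat_at_def by blast
  then show "(\<lambda>s. Nmat S (Suc c) s $$ (a, b)) analytic_on {z}"
    unfolding Nrow_entry[OF ab c] .
qed

lemma analytic_mat_at_system:
  assumes "is_bilinear_system S" "analytic_point S z"
  shows "analytic_mat_at (outdim S) (statedim S) (Cmat S) z" "analytic_mat_at (statedim S) (statedim S) (Kinv S) z"
     "analytic_mat_at (statedim S) (indim S) (Bmat S) z"
  using assms analytic_point_iff by blast+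

lemma reduced_simps [simp]:
  "outdim (reduced_system W V S) = outdim S" "statedim (reduced_system W V S) = dim_col V"
  "indim (reduced_system W V S) = indim S"
  "Cmat (reduced_system W V S) s = Cmat S s * V"
  "Kmat (reduced_system W V S) s = mat_adjoint W * Kmat S s * V"
  "Bmat (reduced_system W V S) s = mat_adjoint W * Bmat S s"
  "Nmat (reduced_system W V S) j s = mat_adjoint W * Nmat S j s * V"
  by (auto simp: reduced_system_def)

lemma is_bilinear_system_reduced:
  assumes S: "is_bilinear_system S" and "W \<in> carrier_mat (statedim S) r" "V \<in> carrier_mat (statedim S) r"
  shows "is_bilinear_system (reduced_system W V S)"
  using assms mat_adjoint_carrier[OF assms(2)] bilinear_carrier[OF S]
  by (auto simp: is_bilinear_system_def intro!: mult_carrier_mat)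

text \<open>Full rank at the single point \<open>z\<close> means a nonzero determinant there. As the
  determinant of the reduced \<open>K\<close> is analytic, it stays nonzero nearby, so the reduced
  inverse exists and is analytic in a neighbourhood.\<close>

lemma analytic_point_reduced:
  assumes S: "is_bilinear_system S" and W: "W \<in> carrier_mat (statedim S) r"
    and V: "V \<in> carrier_mat (statedim S) r" and z: "analytic_point S z"
    and rank: "vec_space.rank r (Kmat (reduced_system W V S) z) = r"
  shows "analytic_point (reduced_system W V S) z"
proof -
  define R where "R = reduced_system W V S"
  note E = mat_adjoint_carrier[OF W]
  have R: "is_bilinear_system R"
    unfolding R_def by (rule is_bilinear_system_reduced[OF S W V])
  have dims [simp]: "outdim R = outdim S" "statedim R = r" "indim R = indim S"
    using V by (auto simp: R_def)
  have K: "analytic_mat_at r r (Kmat R) z"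
    using analytic_mat_at_mult[OF analytic_mat_at_mult[OF analytic_mat_at_const[OF E] analytic_mat_at_Kmat[OF S z]] analytic_mat_at_const[OF V]]
    by (simp add: R_def reduced_system_def)
  have "Determinant.det (Kmat R z) \<noteq> 0"
    using rank vec_space.det_rank_iff[OF analytic_mat_at_carrier[OF K]] by (simp add: R_def)
  then have nz: "\<forall>\<^sub>F s in nhds z. Determinant.det (Kmat R s) \<noteq> 0"
    using analytic_at_neq_imp_eventually_neq[OF det_analytic[OF K]]
    by (simp add: eventually_nhds_conv_at)
  have inv: "\<forall>\<^sub>F s in nhds z. invertible_mat (Kmat R s)"
    using nz
  proof eventually_elim
    case (elim s)
    have KR: "Kmat R s \<in> carrier_mat r r" using bilinear_carrier(2)[OF R] by simp
    from det_non_zero_imp_unit[OF KR elim, of undefined] obtain B where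
      "B \<in> carrier_mat r r" "B * Kmat R s = 1\<^sub>m r" "Kmat R s * B = 1\<^sub>m r"
      by (auto simp: Units_def ring_mat_simps)
    then show ?case using KR by (auto simp: invertible_mat_def inverts_mat_def)
  qed
  have Kinv: "analytic_mat_at r r (Kinv R) z"
  proof (rule analytic_mat_at_inverse[OF K])
    show "\<forall>\<^sub>F s in nhds z. Kinv R s \<in> carrier_mat r r \<and> Kmat R s * Kinv R s = 1\<^sub>m r \<and> Kinv R s * Kmat R s = 1\<^sub>m r"
      using inv mat_inv[OF bilinear_carrier(2)[OF R]] by (auto simp: Kinv_def elim: eventually_mono)
  qed
  have N: "analytic_mat_at r (r * indim S) (Nrow R) z"
    unfolding analytic_mat_at_def
  proof safe
    show "\<forall>\<^sub>F s in nhds z. Nrow R s \<in> carrier_mat r (r * indim S)" by (auto simp: Nrow_def)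
    fix a b assume ab: "a < r" "b < r * indim S"
    then have c: "b div r < indim S" "b mod r < r"
      by (auto simp: less_mult_imp_div_less mult.commute intro!: mod_less_divisor)
    have "analytic_mat_at r r (Nmat R (Suc (b div r))) z"
      using analytic_mat_at_mult[OF analytic_mat_at_mult[OF analytic_mat_at_const[OF E] analytic_mat_at_Nmat[OF S z c(1)]] analytic_mat_at_const[OF V]]
      by (simp add: R_def reduced_system_def)
    then have "(\<lambda>s. Nmat R (Suc (b div r)) s $$ (a, b mod r)) analytic_on {z}"
      using ab c by (auto simp: analytic_mat_at_def)
    then show "(\<lambda>s. Nrow R s $$ (a, b)) analytic_on {z}"
      using ab by (simp add: Nrow_def)
  qed
  have "analytic_mat_at (outdim S) r (Cmat R) z"
    using analytic_mat_at_mult[OF analytic_mat_at_system(1)[OF S z] analytic_mat_at_const[OF V]] by (simp add: R_def reduced_system_def)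
  moreover have "analytic_mat_at r (indim S) (Bmat R) z"
    using analytic_mat_at_mult[OF analytic_mat_at_const[OF E] analytic_mat_at_system(3)[OF S z]] by (simp add: R_def reduced_system_def)
  ultimately show ?thesis
    using N Kinv inv analytic_point_iff[OF R] by (simp add: R_def[symmetric])
qed

section \<open>Projection identities from the right and from the left\<close>

lemma mult_mat_reassoc_right:
  assumes "A \<in> carrier_mat p r" "B \<in> carrier_mat r r" "E \<in> carrier_mat r n"
    "K \<in> carrier_mat n n" "X \<in> carrier_mat n q"
  shows "A * (B * (E * K)) * X = A * (B * (E * (K * X)))"
proof -
  have "A * (B * (E * K)) * X = A * (B * (E * K) * X)"
    using assms by (intro assoc_mult_mat[of _ p r _ n _ q]) auto
  also have "B * (E * K) * X = B * (E * K * X)"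
    using assms by (intro assoc_mult_mat[of _ r r _ n _ q]) auto
  also have "E * K * X = E * (K * X)"
    using assms by (intro assoc_mult_mat[of _ r n _ n _ q]) auto
  finally show ?thesis .
qed

lemma mult_mat_reassoc_left:
  assumes "X \<in> carrier_mat p n" "K \<in> carrier_mat n n" "V \<in> carrier_mat n r"
    "B \<in> carrier_mat r r" "Y \<in> carrier_mat r q"
  shows "X * (K * V * (B * Y)) = X * K * V * B * Y"
proof -
  have "X * (K * V * (B * Y)) = X * (K * V) * (B * Y)"
    using assms by (intro assoc_mult_mat[of _ p n _ r _ q, symmetric]) auto
  also have "X * (K * V) = X * K * V"
    using assms by (intro assoc_mult_mat[of _ p n _ n _ r, symmetric]) auto
  also have "X * K * V * (B * Y) = X * K * V * B * Y"
    using assms by (intro assoc_mult_mat[of _ p r _ r _ q, symmetric]) auto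
  finally show ?thesis .
qed

text \<open>\<open>D = M - M V (W\<^sup>H K V)\<^sup>-\<^sup>1 W\<^sup>H K\<close> satisfies \<open>D V = 0\<close> near \<open>z\<close>, so \<open>D\<close> and all its
  derivatives annihilate the derivatives of \<open>K\<^sup>-\<^sup>1 Q\<close>, which lie in the range of \<open>V\<close>.\<close>

lemma right_projection:
  assumes S: "is_bilinear_system S" and W: "W \<in> carrier_mat (statedim S) r"
    and V: "V \<in> carrier_mat (statedim S) r" and z: "analytic_point S z"
    and rz: "analytic_point (reduced_system W V S) z"
    and M: "analytic_mat_at p (statedim S) M z" and Q: "analytic_mat_at (statedim S) q Q z"
    and im: "\<And>i. i \<le> j \<Longrightarrow> \<exists>Y \<in> carrier_mat r q. mat_deriv i (\<lambda>s. Kinv S s * Q s) z = V * Y"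
  shows "mat_deriv j (\<lambda>s. M s * (Kinv S s * Q s)) z =
    mat_deriv j (\<lambda>s. M s * V * (Kinv (reduced_system W V S) s * (mat_adjoint W * Q s))) z"
proof -
  define n where "n = statedim S"
  define E where "E = mat_adjoint W"
  define K Ki Kr where "K = Kmat S" and "Ki = Kinv S" and "Kr = Kinv (reduced_system W V S)"
  have E: "E \<in> carrier_mat r n" and V': "V \<in> carrier_mat n r"
    using mat_adjoint_carrier[OF W] V by (simp_all add: E_def n_def)
  note R = is_bilinear_system_reduced[OF S W V]
  have K: "analytic_mat_at n n K z" and Ki: "analytic_mat_at n n Ki z" and Kr: "analytic_mat_at r r Kr z"
    using analytic_mat_at_Kmat[OF S z] analytic_mat_at_system(2)[OF S z] analytic_mat_at_system(2)[OF R rz] V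
    by (auto simp: n_def K_def Ki_def Kr_def)
  have ev: "\<forall>\<^sub>F s in nhds z. K s \<in> carrier_mat n n \<and> Ki s \<in> carrier_mat n n \<and> Kr s \<in> carrier_mat r r \<and>
      M s \<in> carrier_mat p n \<and> Q s \<in> carrier_mat n q"
    using K Ki Kr M Q unfolding analytic_mat_at_def n_def by (auto simp: eventually_conj_iff)
  define D where "D = (\<lambda>s. M s - M s * V * (Kr s * (E * K s)))"
  have MP: "analytic_mat_at p n (\<lambda>s. M s * V * (Kr s * (E * K s))) z"
    using M V' E K Kr by (auto intro!: analytic_mat_at_mult analytic_mat_at_const simp: n_def)
  have D: "analytic_mat_at p n D z"
    unfolding D_def using M by (intro analytic_mat_at_minus MP) (simp add: n_def)
  have X: "analytic_mat_at n q (\<lambda>s. Ki s * Q s) z"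
    using analytic_mat_at_mult[OF Ki, of q Q] Q by (simp add: n_def)
  have DV: "\<forall>\<^sub>F s in nhds z. D s * V = 0\<^sub>m p r"
    using ev eventually_Kinv[OF R rz]
  proof eventually_elim
    case (elim s)
    then have "Kr s * (E * K s * V) = 1\<^sub>m r"
      using V by (simp add: Kr_def E_def K_def del: assoc_mult_mat)
    then have 1: "Kr s * (E * K s) * V = 1\<^sub>m r"
      using elim V' E by (subst assoc_mult_mat[of _ r r _ n _ r]) auto
    have "M s * V * (Kr s * (E * K s)) * V = M s * V * (Kr s * (E * K s) * V)"
      using elim V' E by (intro assoc_mult_mat[of _ p r _ n _ r]) auto
    also have "\<dots> = M s * V" using elim V' unfolding 1 by simp
    finally show ?case
      using elim V' E unfolding D_def by (subst minus_mult_distrib_mat[of _ p n]) auto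
  qed
  have "mat_deriv j (\<lambda>s. D s * (Ki s * Q s)) z = 0\<^sub>m p q"
    by (rule mat_deriv_mult_eq_0[OF D X V' DV]) (use im in \<open>simp add: Ki_def\<close>)
  \<comment> \<open>In the subtracted part of \<open>D\<close> the factor \<open>K\<close> cancels
    against \<open>Ki\<close>, so the vanishing derivative is the difference of the two sides of the
    claim.\<close>
  also have "mat_deriv j (\<lambda>s. D s * (Ki s * Q s)) z =
      mat_deriv j (\<lambda>s. M s * (Ki s * Q s) - M s * V * (Kr s * (E * Q s))) z"
  proof (rule mat_deriv_cong)
    show "\<forall>\<^sub>F s in nhds z. D s * (Ki s * Q s) = M s * (Ki s * Q s) - M s * V * (Kr s * (E * Q s))"
      using ev eventually_Kinv[OF S z]
    proof eventually_elim
      case (elim s)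
      then have "K s * (Ki s * Q s) = Q s"
        using assoc_mult_mat[of "K s" n n "Ki s" n "Q s" q, symmetric] left_mult_one_mat[of "Q s" n q]
        by (simp add: K_def[symmetric] Ki_def[symmetric] n_def[symmetric])
      moreover have "M s * V * (Kr s * (E * K s)) * (Ki s * Q s) = M s * V * (Kr s * (E * (K s * (Ki s * Q s))))"
        using elim V' E by (intro mult_mat_reassoc_right[of _ p r _ _ n _ _ q]) auto
      ultimately have "M s * V * (Kr s * (E * K s)) * (Ki s * Q s) = M s * V * (Kr s * (E * Q s))"
        by simp
      then show ?case
        using elim V' E unfolding D_def by (subst minus_mult_distrib_mat[of _ p n]) auto
    qed
  qed
  also have "\<dots> = mat_deriv j (\<lambda>s. M s * (Ki s * Q s)) z - mat_deriv j (\<lambda>s. M s * V * (Kr s * (E * Q s))) z"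
    using M Q V' E Ki Kr by (intro mat_deriv_minus[of p q] analytic_mat_at_mult analytic_mat_at_const) (auto simp: n_def)
  finally have eq: "mat_deriv j (\<lambda>s. M s * (Ki s * Q s)) z - mat_deriv j (\<lambda>s. M s * V * (Kr s * (E * Q s))) z = 0\<^sub>m p q" .
  have c: "mat_deriv j (\<lambda>s. M s * (Ki s * Q s)) z \<in> carrier_mat p q"
     "mat_deriv j (\<lambda>s. M s * V * (Kr s * (E * Q s))) z \<in> carrier_mat p q"
    using M Q V' E Ki Kr by (auto intro!: mat_deriv_carrier analytic_mat_at_mult analytic_mat_at_const simp: n_def)
  have "mat_deriv j (\<lambda>s. M s * (Ki s * Q s)) z = mat_deriv j (\<lambda>s. M s * V * (Kr s * (E * Q s))) z"
  proof (rule eq_matI)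
    fix a b assume "a < dim_row (mat_deriv j (\<lambda>s. M s * V * (Kr s * (E * Q s))) z)"
      "b < dim_col (mat_deriv j (\<lambda>s. M s * V * (Kr s * (E * Q s))) z)"
    then show "mat_deriv j (\<lambda>s. M s * (Ki s * Q s)) z $$ (a, b) =
      mat_deriv j (\<lambda>s. M s * V * (Kr s * (E * Q s))) z $$ (a, b)"
      using arg_cong[OF eq, of "\<lambda>A. A $$ (a, b)"] c by auto
  qed (use c in auto)
  then show ?thesis by (simp add: Ki_def Kr_def E_def)
qed

text \<open>The mirror image: now
  \<open>D = M - K V (W\<^sup>H K V)\<^sup>-\<^sup>1 W\<^sup>H M\<close> is annihilated by
  \<open>W\<^sup>H\<close> from the left, and the derivatives of \<open>P K\<^sup>-\<^sup>1\<close>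
  end in \<open>W\<^sup>H\<close> by assumption. In \<open>P K\<^sup>-\<^sup>1 D\<close> the factor
  \<open>K\<close> cancels again.\<close>

lemma left_projection:
  assumes S: "is_bilinear_system S" and W: "W \<in> carrier_mat (statedim S) r"
    and V: "V \<in> carrier_mat (statedim S) r" and z: "analytic_point S z"
    and rz: "analytic_point (reduced_system W V S) z"
    and P: "analytic_mat_at p (statedim S) P z" and M: "analytic_mat_at (statedim S) q M z"
    and im: "\<And>i. i \<le> j \<Longrightarrow>
      \<exists>Y \<in> carrier_mat p r. mat_deriv i (\<lambda>s. P s * Kinv S s) z = Y * mat_adjoint W"
  shows "mat_deriv j (\<lambda>s. P s * Kinv S s * M s) z =
    mat_deriv j (\<lambda>s. P s * V * Kinv (reduced_system W V S) s * (mat_adjoint W * M s)) z"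
proof -
  define n where "n = statedim S"
  define E where "E = mat_adjoint W"
  define K Ki Kr where "K = Kmat S" and "Ki = Kinv S" and "Kr = Kinv (reduced_system W V S)"
  have E: "E \<in> carrier_mat r n" and V': "V \<in> carrier_mat n r"
    using mat_adjoint_carrier[OF W] V by (simp_all add: E_def n_def)
  note R = is_bilinear_system_reduced[OF S W V]
  have K: "analytic_mat_at n n K z" and Ki: "analytic_mat_at n n Ki z" and Kr: "analytic_mat_at r r Kr z"
    using analytic_mat_at_Kmat[OF S z] analytic_mat_at_system(2)[OF S z] analytic_mat_at_system(2)[OF R rz] V
    by (auto simp: n_def K_def Ki_def Kr_def)
  have ev: "\<forall>\<^sub>F s in nhds z. K s \<in> carrier_mat n n \<and> Ki s \<in> carrier_mat n n \<and> Kr s \<in> carrier_mat r r \<and>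
      M s \<in> carrier_mat n q \<and> P s \<in> carrier_mat p n"
    using K Ki Kr M P unfolding analytic_mat_at_def n_def by (auto simp: eventually_conj_iff)
  define D where "D = (\<lambda>s. M s - K s * V * (Kr s * (E * M s)))"
  have MP: "analytic_mat_at n q (\<lambda>s. K s * V * (Kr s * (E * M s))) z"
    using M V' E K Kr by (auto intro!: analytic_mat_at_mult analytic_mat_at_const simp: n_def)
  have D: "analytic_mat_at n q D z"
    unfolding D_def using M by (intro analytic_mat_at_minus MP) (simp add: n_def)
  have X: "analytic_mat_at p n (\<lambda>s. P s * Ki s) z"
    using analytic_mat_at_mult[OF _ Ki, of p P] P by (simp add: n_def)
  have ED: "\<forall>\<^sub>F s in nhds z. E * D s = 0\<^sub>m r q"
    using ev eventually_Kinv[OF R rz]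
  proof eventually_elim
    case (elim s)
    \<comment> \<open>Here \<open>Kr\<close> acts as a right inverse of
      \<open>W\<^sup>H K V\<close>; for the projection from the right it acted as a left
      inverse.\<close>
    then have "E * K s * V * Kr s = 1\<^sub>m r"
      using V by (simp add: Kr_def E_def K_def del: assoc_mult_mat)
    moreover have "E * (K s * V * (Kr s * (E * M s))) = E * K s * V * Kr s * (E * M s)"
      using elim V' E by (intro mult_mat_reassoc_left[of _ r n _ _ r _ _ q]) auto
    ultimately have "E * (K s * V * (Kr s * (E * M s))) = E * M s"
      using elim E left_mult_one_mat[of "E * M s" r q] by auto
    then show ?case
      using elim V' E unfolding D_def by (subst mult_minus_distrib_mat[of _ r n _ q]) auto
  qed
  have "mat_deriv j (\<lambda>s. P s * Ki s * D s) z = 0\<^sub>m p q"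
    by (rule mat_deriv_mult_eq_0'[OF X D E ED]) (use im in \<open>simp add: Ki_def E_def\<close>)
  also have "mat_deriv j (\<lambda>s. P s * Ki s * D s) z =
      mat_deriv j (\<lambda>s. P s * Ki s * M s - P s * V * Kr s * (E * M s)) z"
  proof (rule mat_deriv_cong)
    show "\<forall>\<^sub>F s in nhds z. P s * Ki s * D s = P s * Ki s * M s - P s * V * Kr s * (E * M s)"
      using ev eventually_Kinv[OF S z]
    proof eventually_elim
      case (elim s)
      then have "P s * Ki s * K s = P s"
        using assoc_mult_mat[of "P s" p n "Ki s" n "K s" n] right_mult_one_mat[of "P s" p n]
        by (simp add: K_def[symmetric] Ki_def[symmetric] n_def[symmetric])
      moreover have "P s * Ki s * (K s * V * (Kr s * (E * M s))) = P s * Ki s * K s * V * Kr s * (E * M s)"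
        using elim V' E by (intro mult_mat_reassoc_left[of _ p n _ _ r _ _ q]) auto
      ultimately have "P s * Ki s * (K s * V * (Kr s * (E * M s))) = P s * V * Kr s * (E * M s)"
        by simp
      then show ?case
        using elim V' E unfolding D_def by (subst mult_minus_distrib_mat[of _ p n _ q]) auto
    qed
  qed
  also have "\<dots> = mat_deriv j (\<lambda>s. P s * Ki s * M s) z - mat_deriv j (\<lambda>s. P s * V * Kr s * (E * M s)) z"
    using M P V' E Ki Kr by (intro mat_deriv_minus[of p q] analytic_mat_at_mult analytic_mat_at_const) (auto simp: n_def)
  finally have eq: "mat_deriv j (\<lambda>s. P s * Ki s * M s) z - mat_deriv j (\<lambda>s. P s * V * Kr s * (E * M s)) z = 0\<^sub>m p q" .
  have c: "mat_deriv j (\<lambda>s. P s * Ki s * M s) z \<in> carrier_mat p q"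
     "mat_deriv j (\<lambda>s. P s * V * Kr s * (E * M s)) z \<in> carrier_mat p q"
    using M P V' E Ki Kr by (auto intro!: mat_deriv_carrier analytic_mat_at_mult analytic_mat_at_const simp: n_def)
  have "mat_deriv j (\<lambda>s. P s * Ki s * M s) z = mat_deriv j (\<lambda>s. P s * V * Kr s * (E * M s)) z"
  proof (rule eq_matI)
    fix a b assume "a < dim_row (mat_deriv j (\<lambda>s. P s * V * Kr s * (E * M s)) z)"
      "b < dim_col (mat_deriv j (\<lambda>s. P s * V * Kr s * (E * M s)) z)"
    then show "mat_deriv j (\<lambda>s. P s * Ki s * M s) z $$ (a, b) =
      mat_deriv j (\<lambda>s. P s * V * Kr s * (E * M s)) z $$ (a, b)"
      using arg_cong[OF eq, of "\<lambda>A. A $$ (a, b)"] c by auto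
  qed (use c in auto)
  then show ?thesis by (simp add: Ki_def Kr_def E_def)
qed

section \<open>Column blocks and words\<close>

text \<open>Column blocks are the device that removes the Kronecker products: fixing a block of the
  result selects one diagonal copy in every factor \<open>I \<otimes> A\<close> and one
  \<open>N\<^sub>j\<close> in every row \<open>[N\<^sub>1 ... N\<^sub>m]\<close>.\<close>

definition block_col :: "nat \<Rightarrow> nat \<Rightarrow> complex mat \<Rightarrow> complex mat" where
  "block_col n w P = Matrix.mat (dim_row P) n (\<lambda>(a, b). P $$ (a, w * n + b))"

lemma block_col_carrier [simp]: "P \<in> carrier_mat p N \<Longrightarrow> block_col n w P \<in> carrier_mat p n"
  by (auto simp: block_col_def)

lemma dim_block_col [simp]: "dim_row (block_col n w P) = dim_row P" "dim_col (block_col n w P) = n"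
  by (auto simp: block_col_def)

lemma block_col_entry: "a < dim_row P \<Longrightarrow> b < n \<Longrightarrow> block_col n w P $$ (a, b) = P $$ (a, w * n + b)"
  by (simp add: block_col_def)

lemma block_index_less: "w < N \<Longrightarrow> b < n \<Longrightarrow> w * n + b < N * (n :: nat)"
proof -
  assume "w < N" "b < n"
  then have "w * n + b < Suc w * n" by simp
  also have "\<dots> \<le> N * n" using \<open>w < N\<close> by (intro mult_le_mono1) simp
  finally show ?thesis .
qed

lemma block_col_0: "P \<in> carrier_mat p n \<Longrightarrow> block_col n 0 P = P"
  by (auto simp: block_col_def intro!: eq_matI)

lemma block_col_mult:
  assumes "A \<in> carrier_mat p q" "P \<in> carrier_mat q (N * n)" "w < N"
  shows "block_col n w (A * P) = A * block_col n w P"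
  using assms block_index_less[OF assms(3)]
  by (auto simp: block_col_def scalar_prod_def intro!: eq_matI sum.cong)

text \<open>Refining a block of width \<open>n * m\<close> into \<open>m\<close> blocks of width
  \<open>n\<close> appends one base-\<open>m\<close> digit to the block number. This is the
  recursion of \<open>word_index\<close> below.\<close>

lemma block_col_block_col:
  assumes "P \<in> carrier_mat p M" "c < m"
  shows "block_col n c (block_col (n * m) w P) = block_col n (w * m + c) P"
  using assms block_index_less[of c m _ n]
  by (auto simp: block_col_def algebra_simps intro!: eq_matI)

lemma kron_one_entry:
  assumes "A \<in> carrier_mat p n" "i < N * p" "j < N * n"
  shows "kron (1\<^sub>m N) A $$ (i, j) = (if i div p = j div n then A $$ (i mod p, j mod n) else 0)"
  using assms by (auto simp: kron_def less_mult_imp_div_less)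

lemma kron_one_carrier: "A \<in> carrier_mat p n \<Longrightarrow> kron (1\<^sub>m N) A \<in> carrier_mat (N * p) (N * n)"
  by (auto simp: kron_def)

lemma kron_one_one: "A \<in> carrier_mat p n \<Longrightarrow> kron (1\<^sub>m 1) A = A"
  by (intro eq_matI) (auto simp: kron_def)

text \<open>\<open>I \<otimes> A\<close> is block diagonal: its column block \<open>w\<close> is
  nonzero only in row block \<open>w\<close>, where it equals \<open>A\<close>, so only block
  \<open>w\<close> of \<open>P\<close> contributes.\<close>

lemma block_col_mult_kron:
  assumes P: "P \<in> carrier_mat p (N * n)" and A: "A \<in> carrier_mat n q" and w: "w < N"
  shows "block_col q w (P * kron (1\<^sub>m N) A) = block_col n w P * A"
proof (rule eq_matI)
  note K = kron_one_carrier[OF A, of N]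
  fix a b assume "a < dim_row (block_col n w P * A)" "b < dim_col (block_col n w P * A)"
  then have ab: "a < p" "b < q" using P A by auto
  note wb = block_index_less[OF w ab(2)]
  have "block_col q w (P * kron (1\<^sub>m N) A) $$ (a, b) = (P * kron (1\<^sub>m N) A) $$ (a, w * q + b)"
    using ab P by (simp add: block_col_def)
  also have "\<dots> = (\<Sum>i = 0..<N * n. P $$ (a, i) * kron (1\<^sub>m N) A $$ (i, w * q + b))"
    by (rule mult_mat_entry[OF P K ab(1) wb])
  also have "\<dots> = (\<Sum>i = 0..<N * n. if i div n = w then P $$ (a, i) * A $$ (i mod n, b) else 0)"
    using ab wb by (intro sum.cong refl) (simp add: kron_one_entry[OF A])
  also have "\<dots> = (\<Sum>i \<in> {i \<in> {0..<N * n}. i div n = w}. P $$ (a, i) * A $$ (i mod n, b))"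
    by (rule sum.inter_filter[symmetric]) simp
  \<comment> \<open>The remaining indices are those of row block \<open>w\<close>, written as
    \<open>w * n + c\<close>.\<close>
  also have "\<dots> = (\<Sum>c = 0..<n. P $$ (a, w * n + c) * A $$ (c, b))"
  proof (rule sum.reindex_bij_witness[of _ "\<lambda>c. w * n + c" "\<lambda>i. i mod n"])
    fix i assume "i \<in> {i \<in> {0..<N * n}. i div n = w}"
    then have i: "i < N * n" "i div n = w" by auto
    then have "n > 0" by (cases n) auto
    then show "i mod n \<in> {0..<n}" by simp
    show *: "w * n + i mod n = i" using i(2) by (metis div_mult_mod_eq)
    then show "P $$ (a, w * n + i mod n) * A $$ (i mod n, b) = P $$ (a, i) * A $$ (i mod n, b)"
      by simp
  next
    fix c assume "c \<in> {0..<n}"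
    then show "(w * n + c) mod n = c" "w * n + c \<in> {i \<in> {0..<N * n}. i div n = w}"
      using block_index_less[OF w, of c n] by auto
  qed
  also have "\<dots> = (block_col n w P * A) $$ (a, b)"
    using P ab by (subst mult_mat_entry[OF block_col_carrier[OF P] A ab]) (simp add: block_col_def)
  finally show "block_col q w (P * kron (1\<^sub>m N) A) $$ (a, b) = (block_col n w P * A) $$ (a, b)" .
qed (use P A in auto)

lemma analytic_mat_at_block_col:
  assumes F: "analytic_mat_at p (N * n) F z" and w: "w < N"
  shows "analytic_mat_at p n (\<lambda>s. block_col n w (F s)) z"
  unfolding analytic_mat_at_def
proof safe
  have ev: "\<forall>\<^sub>F s in nhds z. F s \<in> carrier_mat p (N * n)" using F by (auto simp: analytic_mat_at_def)
  then show "\<forall>\<^sub>F s in nhds z. block_col n w (F s) \<in> carrier_mat p n"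
    by (auto elim: eventually_mono)
  fix a b assume ab: "a < p" "b < n"
  have "(\<lambda>s. F s $$ (a, w * n + b)) analytic_on {z}"
    using F ab block_index_less[OF w ab(2)] by (auto simp: analytic_mat_at_def)
  moreover from ev have "\<forall>\<^sub>F s in nhds z. block_col n w (F s) $$ (a, b) = F s $$ (a, w * n + b)"
    by eventually_elim (use ab in \<open>auto simp: block_col_def\<close>)
  ultimately show "(\<lambda>s. block_col n w (F s) $$ (a, b)) analytic_on {z}"
    by (simp add: analytic_at_cong)
qed

lemma block_col_mat_deriv:
  assumes F: "analytic_mat_at p (N * n) F z" and w: "w < N"
  shows "block_col n w (mat_deriv j F z) = mat_deriv j (\<lambda>s. block_col n w (F s)) z"
proof (rule eq_matI)
  note B = analytic_mat_at_block_col[OF F w]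
  fix a b assume "a < dim_row (mat_deriv j (\<lambda>s. block_col n w (F s)) z)" "b < dim_col (mat_deriv j (\<lambda>s. block_col n w (F s)) z)"
  then have ab: "a < p" "b < n" using mat_deriv_carrier[OF B, of j] by auto
  have "\<forall>\<^sub>F s in nhds z. F s \<in> carrier_mat p (N * n)" using F by (auto simp: analytic_mat_at_def)
  then have "\<forall>\<^sub>F s in nhds z. block_col n w (F s) $$ (a, b) = F s $$ (a, w * n + b)"
    by eventually_elim (use ab in \<open>auto simp: block_col_def\<close>)
  then have "(deriv ^^ j) (\<lambda>s. block_col n w (F s) $$ (a, b)) z = (deriv ^^ j) (\<lambda>s. F s $$ (a, w * n + b)) z"
    by (rule higher_deriv_cong_ev) simp
  then show "block_col n w (mat_deriv j F z) $$ (a, b) = mat_deriv j (\<lambda>s. block_col n w (F s)) z $$ (a, b)"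
    using ab mat_deriv_carrier[OF F, of j] block_index_less[OF w ab(2)]
    by (simp add: mat_deriv_entry[OF B] mat_deriv_entry[OF F] block_col_entry)
qed (use mat_deriv_carrier[OF analytic_mat_at_block_col[OF F w], of j] mat_deriv_carrier[OF F, of j] in auto)

lemma analytic_mat_at_kron_one:
  assumes F: "analytic_mat_at p n F z"
  shows "analytic_mat_at (N * p) (N * n) (\<lambda>s. kron (1\<^sub>m N) (F s)) z"
  unfolding analytic_mat_at_def
proof safe
  have ev: "\<forall>\<^sub>F s in nhds z. F s \<in> carrier_mat p n" using F by (auto simp: analytic_mat_at_def)
  then show "\<forall>\<^sub>F s in nhds z. kron (1\<^sub>m N) (F s) \<in> carrier_mat (N * p) (N * n)"
    by eventually_elim (rule kron_one_carrier)
  fix i j assume ij: "i < N * p" "j < N * n"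
  then have "p > 0" "n > 0" by (auto intro!: Nat.gr0I)
  then have "(\<lambda>s. if i div p = j div n then F s $$ (i mod p, j mod n) else 0) analytic_on {z}"
    using F by (cases "i div p = j div n") (auto simp: analytic_mat_at_def)
  moreover from ev have "\<forall>\<^sub>F s in nhds z. kron (1\<^sub>m N) (F s) $$ (i, j) =
      (if i div p = j div n then F s $$ (i mod p, j mod n) else 0)"
    by eventually_elim (use kron_one_entry ij in blast)
  ultimately show "(\<lambda>s. kron (1\<^sub>m N) (F s) $$ (i, j)) analytic_on {z}"
    by (simp only: analytic_at_cong)
qed

text \<open>The Kronecker ordering of the words \<open>u 1, \<dots>, u e\<close>: \<open>u 1\<close> is the most significant digit.\<close>

primrec word_index :: "nat \<Rightarrow> (nat \<Rightarrow> nat) \<Rightarrow> nat \<Rightarrow> nat" where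
  "word_index m u 0 = 0"
| "word_index m u (Suc e) = word_index m u e * m + u (Suc e)"

lemma word_index_less: "(\<And>i. i \<in> {1..e} \<Longrightarrow> u i < m) \<Longrightarrow> word_index m u e < m ^ e"
proof (induction e)
  case (Suc e)
  then have "word_index m u e < m ^ e" "u (Suc e) < m" by auto
  from block_index_less[OF this] show ?case by (simp add: mult.commute)
qed simp

lemma word_index_cong: "(\<And>i. i \<in> {1..e} \<Longrightarrow> u i = v i) \<Longrightarrow> word_index m u e = word_index m v e"
  by (induction e) auto

text \<open>Base-\<open>m\<close> expansion, with the last digit split off by \<open>div\<close> and
  \<open>mod\<close>. It is what allows an equality of whole matrices to be proved word by
  word.\<close>

lemma word_index_surj:
  assumes "w < m ^ e"
  obtains u where "\<And>i. i \<in> {1..e} \<Longrightarrow> u i < m" "word_index m u e = w"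
proof -
  have "\<exists>u. (\<forall>i \<in> {1..e}. u i < m) \<and> word_index m u e = w"
    using assms
  proof (induction e arbitrary: w)
    case (Suc e)
    then have "m > 0" "w div m < m ^ e"
      by (auto intro!: Nat.gr0I less_mult_imp_div_less simp: mult.commute)
    with Suc obtain u where u: "\<forall>i \<in> {1..e}. u i < m" "word_index m u e = w div m" by blast
    have "word_index m (u(Suc e := w mod m)) e = w div m"
      using u(2) word_index_cong[of e "u(Suc e := w mod m)" u m] by auto
    then have "word_index m (u(Suc e := w mod m)) (Suc e) = w" by simp
    moreover have "\<forall>i \<in> {1..Suc e}. (u(Suc e := w mod m)) i < m"
      using u \<open>m > 0\<close> by (auto simp: le_Suc_eq)
    ultimately show ?case by blast
  qed simp
  then show ?thesis using that by blast
qed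

section \<open>Column blocks of ordered products of Kronecker factors\<close>

lemma ordered_prod_empty: "b < a \<Longrightarrow> ordered_prod d A a b = 1\<^sub>m d"
  by (simp add: ordered_prod_def)

lemma ordered_prod_Suc: "a \<le> Suc b \<Longrightarrow> ordered_prod d A a (Suc b) = ordered_prod d A a b * A (Suc b)"
  by (simp add: ordered_prod_def)

lemma ordered_prod_cong:
  assumes "\<And>i. i \<in> {a..b} \<Longrightarrow> A i = B i"
  shows "ordered_prod d A a b = ordered_prod d B a b"
proof -
  have "foldl (\<lambda>P j. P * A j) X js = foldl (\<lambda>P j. P * B j) X js" if "\<And>j. j \<in> set js \<Longrightarrow> A j = B j" for X js
    using that by (induction js arbitrary: X) auto
  then show ?thesis unfolding ordered_prod_def using assms by (metis atLeastAtMost_iff atLeastLessThan_iff atLeastLessThan_upt less_Suc_eq_le)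
qed

lemma ordered_prod_square_carrier:
  assumes "\<And>i. i \<in> {1..e} \<Longrightarrow> F i \<in> carrier_mat n n"
  shows "ordered_prod n F 1 e \<in> carrier_mat n n"
  using assms by (induction e) (auto simp: ordered_prod_empty ordered_prod_Suc intro!: mult_carrier_mat)

text \<open>The pattern shared by the blocks for \<open>V\<close> and for \<open>W\<close>: if each
  factor \<open>A i\<close> refines the block number by the letter \<open>u i\<close> at the price
  of a square factor \<open>F i\<close>, then the block of the whole product that belongs to the
  word is the product of the \<open>F i\<close>.\<close>

lemma block_col_ordered_prod:
  assumes "\<And>i. i \<in> {1..e} \<Longrightarrow> A i \<in> carrier_mat (m ^ (i - 1) * n) (m ^ i * n)"
    and "\<And>i. i \<in> {1..e} \<Longrightarrow> u i < m"
    and "\<And>i X w. i \<in> {1..e} \<Longrightarrow> X \<in> carrier_mat n (m ^ (i - 1) * n) \<Longrightarrow> w < m ^ (i - 1) \<Longrightarrow>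
      block_col n (w * m + u i) (X * A i) = block_col n w X * F i"
  shows "ordered_prod n A 1 e \<in> carrier_mat n (m ^ e * n) \<and>
    block_col n (word_index m u e) (ordered_prod n A 1 e) = ordered_prod n F 1 e"
  using assms
proof (induction e)
  case 0
  show ?case using block_col_0[OF one_carrier_mat] by (simp add: ordered_prod_empty)
next
  case (Suc e)
  have IH: "ordered_prod n A 1 e \<in> carrier_mat n (m ^ e * n)"
    "block_col n (word_index m u e) (ordered_prod n A 1 e) = ordered_prod n F 1 e"
    using Suc by auto
  have "word_index m u e < m ^ e" using Suc.prems(2) by (intro word_index_less) auto
  with Suc.prems(3)[of "Suc e" "ordered_prod n A 1 e" "word_index m u e"] IH Suc.prems(1)[of "Suc e"] show ?case
    by (auto simp: ordered_prod_Suc intro!: mult_carrier_mat)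
qed

lemma Nrow_carrier [simp]: "Nrow S s \<in> carrier_mat (statedim S) (statedim S * indim S)"
  by (simp add: Nrow_def)

lemma block_col_Nrow:
  assumes S: "is_bilinear_system S" and c: "c < indim S"
  shows "block_col (statedim S) c (Nrow S s) = Nmat S (Suc c) s"
proof (rule eq_matI)
  have N: "Nmat S (Suc c) s \<in> carrier_mat (statedim S) (statedim S)"
    using bilinear_carrier(4)[OF S] c by auto
  then show "dim_row (block_col (statedim S) c (Nrow S s)) = dim_row (Nmat S (Suc c) s)"
    "dim_col (block_col (statedim S) c (Nrow S s)) = dim_col (Nmat S (Suc c) s)"
    by (auto simp: Nrow_def)
  fix a b assume "a < dim_row (Nmat S (Suc c) s)" "b < dim_col (Nmat S (Suc c) s)"
  then have "a < statedim S" "b < statedim S" using N by auto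
  then show "block_col (statedim S) c (Nrow S s) $$ (a, b) = Nmat S (Suc c) s $$ (a, b)"
    using Nrow_entry[OF _ _ c] by (simp add: block_col_def Nrow_def)
qed

lemma kron_Nrow_carrier:
  "kron (1\<^sub>m (indim S ^ e)) (Nrow S s) \<in>
    carrier_mat (indim S ^ e * statedim S) (indim S ^ Suc e * statedim S)"
  using kron_one_carrier[OF Nrow_carrier[of S s], of "indim S ^ e"] by (simp add: ac_simps)

text \<open>Block \<open>w * m + c\<close> is first pulled through \<open>I \<otimes> L\<close>. It
  is then part \<open>c\<close> of block \<open>w\<close> of width \<open>n * m\<close>; the digit
  \<open>w\<close> selects a copy of the row \<open>[N\<^sub>1 ... N\<^sub>m]\<close>, and
  \<open>c\<close> selects the entry \<open>N\<^sub>c\<^sub>+\<^sub>1\<close> in it.\<close>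

lemma block_col_mult_kron_Nrow:
  assumes S: "is_bilinear_system S" and X: "X \<in> carrier_mat p (indim S ^ e * statedim S)"
    and w: "w < indim S ^ e" and c: "c < indim S" and L: "L \<in> carrier_mat (statedim S) q"
  shows "block_col q (w * indim S + c) (X * (kron (1\<^sub>m (indim S ^ e)) (Nrow S s) * kron (1\<^sub>m (indim S ^ Suc e)) L)) =
    block_col (statedim S) w X * (Nmat S (Suc c) s * L)"
proof -
  define n m where "n = statedim S" and "m = indim S"
  define N where "N = kron (1\<^sub>m (m ^ e)) (Nrow S s)"
  have N: "N \<in> carrier_mat (m ^ e * n) (m ^ Suc e * n)"
    unfolding N_def n_def m_def by (rule kron_Nrow_carrier)
  note X' = X[folded n_def m_def] and L' = L[folded n_def]
  have Nc: "Nmat S (Suc c) s \<in> carrier_mat n n"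
    using bilinear_carrier(4)[OF S, of "Suc c"] c by (simp add: n_def)
  have XN: "X * N \<in> carrier_mat p (m ^ Suc e * n)"
    using X' N by simp
  have "block_col q (w * m + c) (X * (N * kron (1\<^sub>m (m ^ Suc e)) L)) = block_col q (w * m + c) (X * N * kron (1\<^sub>m (m ^ Suc e)) L)"
    using assoc_mult_mat[OF X' N kron_one_carrier[OF L']] by simp
  also have "\<dots> = block_col n (w * m + c) (X * N) * L"
    using block_index_less[OF w c] by (intro block_col_mult_kron[OF XN L']) (simp add: m_def mult.commute)
  also have "block_col n (w * m + c) (X * N) = block_col n c (block_col (n * m) w (X * N))"
    using block_col_block_col[OF XN, of c m n w] c by (simp add: m_def)
  also have "block_col (n * m) w (X * N) = block_col n w X * Nrow S s"
    unfolding N_def using X w by (intro block_col_mult_kron) (auto simp: n_def m_def)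
  also have "block_col n c \<dots> = block_col n w X * Nmat S (Suc c) s"
    using block_col_mult[OF block_col_carrier[OF X'], where P = "Nrow S s" and N = m and n = n and w = c] c
      block_col_Nrow[OF S c, of s] Nrow_carrier[of S s]
    by (simp add: n_def m_def mult.commute[of "indim S"])
  also have "\<dots> * L = block_col n w X * (Nmat S (Suc c) s * L)"
    by (rule assoc_mult_mat[OF block_col_carrier[OF X'] Nc L'])
  finally show ?thesis by (simp add: n_def m_def N_def)
qed

text \<open>Selecting columns and multiplying by the constant \<open>X\<close> commute with
  differentiation, so the pointwise identity carries over. \<open>L\<close> is kept general because
  it is \<open>K\<^sup>-\<^sup>1\<close> in the inner factors of \<open>V_block\<close> and
  \<open>K\<^sup>-\<^sup>1 B\<close> in the last one.\<close>

lemma block_col_mult_mat_deriv_kron: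
  assumes S: "is_bilinear_system S" and z: "analytic_point S z"
    and X: "X \<in> carrier_mat p (indim S ^ e * statedim S)"
    and w: "w < indim S ^ e" and c: "c < indim S" and L: "analytic_mat_at (statedim S) q L z"
  shows "block_col q (w * indim S + c) (X * mat_deriv j
      (\<lambda>s. kron (1\<^sub>m (indim S ^ e)) (Nrow S s) * kron (1\<^sub>m (indim S ^ Suc e)) (L s)) z) =
    block_col (statedim S) w X * mat_deriv j (\<lambda>s. Nmat S (Suc c) s * L s) z"
proof -
  define F where "F = (\<lambda>s. kron (1\<^sub>m (indim S ^ e)) (Nrow S s) * kron (1\<^sub>m (indim S ^ Suc e)) (L s))"
  have "analytic_mat_at (indim S ^ e * statedim S) (indim S ^ Suc e * statedim S) (\<lambda>s. kron (1\<^sub>m (indim S ^ e)) (Nrow S s)) z"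
    using analytic_mat_at_kron_one[of "statedim S" "statedim S * indim S" "Nrow S" z "indim S ^ e"] z
    by (simp add: analytic_point_iff[OF S] ac_simps)
  then have F: "analytic_mat_at (indim S ^ e * statedim S) (indim S ^ Suc e * q) F z"
    unfolding F_def by (rule analytic_mat_at_mult[OF _ analytic_mat_at_kron_one[OF L]])
  have lt: "w * indim S + c < indim S ^ Suc e"
    using block_index_less[OF w c] by (simp add: mult.commute)
  have "block_col q (w * indim S + c) (X * mat_deriv j F z) = block_col q (w * indim S + c) (mat_deriv j (\<lambda>s. X * F s) z)"
    using mat_deriv_mult_left[OF X F] by simp
  also have "\<dots> = mat_deriv j (\<lambda>s. block_col q (w * indim S + c) (X * F s)) z"
    by (rule block_col_mat_deriv[OF analytic_mat_at_mult[OF analytic_mat_at_const[OF X] F] lt])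
  also have "\<dots> = mat_deriv j (\<lambda>s. block_col (statedim S) w X * (Nmat S (Suc c) s * L s)) z"
  proof (rule mat_deriv_cong)
    have "\<forall>\<^sub>F s in nhds z. L s \<in> carrier_mat (statedim S) q" using L by (auto simp: analytic_mat_at_def)
    then show "\<forall>\<^sub>F s in nhds z. block_col q (w * indim S + c) (X * F s) = block_col (statedim S) w X * (Nmat S (Suc c) s * L s)"
      unfolding F_def by eventually_elim (rule block_col_mult_kron_Nrow[OF S X w c])
  qed
  also have "\<dots> = block_col (statedim S) w X * mat_deriv j (\<lambda>s. Nmat S (Suc c) s * L s) z"
    by (rule mat_deriv_mult_left[OF block_col_carrier[OF X] analytic_mat_at_mult[OF analytic_mat_at_Nmat[OF S z c] L]])
  finally show ?thesis by (simp add: F_def)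
qed

section \<open>Right states\<close>

lemma mat_deriv_0: "mat_deriv 0 F z = F z"
  by (auto simp: mat_deriv_def intro!: eq_matI)

lemma kron_one_mult:
  assumes A: "A \<in> carrier_mat p n" and B: "B \<in> carrier_mat n q"
  shows "kron (1\<^sub>m N) A * kron (1\<^sub>m N) B = kron (1\<^sub>m N) (A * B)"
proof (rule eq_matI)
  have AB: "A * B \<in> carrier_mat p q" using A B by simp
  note KA = kron_one_carrier[OF A, of N]
  fix i j assume "i < dim_row (kron (1\<^sub>m N) (A * B))" "j < dim_col (kron (1\<^sub>m N) (A * B))"
  then have ij: "i < N * p" "j < N * q" using kron_one_carrier[OF AB, of N] by auto
  then have "p > 0" "q > 0" by (auto intro!: Nat.gr0I)
  define w b where "w = j div q" and "b = j mod q"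
  have w: "w < N" "b < q" and j: "j = w * q + b"
    using ij \<open>q > 0\<close> by (auto simp: w_def b_def less_mult_imp_div_less)
  have ip: "i mod p < p" using \<open>p > 0\<close> by simp
  have "(kron (1\<^sub>m N) A * kron (1\<^sub>m N) B) $$ (i, j) = block_col q w (kron (1\<^sub>m N) A * kron (1\<^sub>m N) B) $$ (i, b)"
    using ij w KA unfolding j by (subst block_col_entry) auto
  also have "block_col q w (kron (1\<^sub>m N) A * kron (1\<^sub>m N) B) = block_col n w (kron (1\<^sub>m N) A) * B"
    by (rule block_col_mult_kron[OF KA B w(1)])
  also have "\<dots> $$ (i, b) = (\<Sum>c = 0..<n. block_col n w (kron (1\<^sub>m N) A) $$ (i, c) * B $$ (c, b))"
    by (rule mult_mat_entry[OF block_col_carrier[OF KA] B ij(1) w(2)])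
  also have "\<dots> = (\<Sum>c = 0..<n. (if i div p = w then A $$ (i mod p, c) else 0) * B $$ (c, b))"
    using KA ij by (intro sum.cong refl)
      (auto simp: block_col_entry kron_one_entry[OF A ij(1) block_index_less[OF w(1)]])
  also have "\<dots> = kron (1\<^sub>m N) (A * B) $$ (i, j)"
    using w(2) by (simp add: kron_one_entry[OF AB ij] mult_mat_entry[OF A B ip] w_def[symmetric] b_def[symmetric])
  finally show "(kron (1\<^sub>m N) A * kron (1\<^sub>m N) B) $$ (i, j) = kron (1\<^sub>m N) (A * B) $$ (i, j)" .
qed (use A B in \<open>auto simp: kron_def\<close>)

text \<open>Up to the factor \<open>K\<^sup>-\<^sup>1\<close>, \<open>right_state S x l \<sigma> q\<close> is what stands to the right of the variable
  \<open>s\<^sub>q\<^sub>+\<^sub>1\<close> in the column block of \<open>G\<^sub>k\<close> that belongs to the word \<open>x\<close>, after differentiating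
  with respect to the first \<open>q\<close> variables. Only \<open>B\<close> still depends on its variable, for \<open>q > 0\<close>
  the value is a constant. Letters are counted from 0, hence the \<open>Suc (x _)\<close>.
  With \<open>l = (\<lambda>_. 0)\<close> nothing is differentiated.\<close>

primrec right_state :: "bilinear_system \<Rightarrow> (nat \<Rightarrow> nat) \<Rightarrow> (nat \<Rightarrow> nat) \<Rightarrow> (nat \<Rightarrow> complex) \<Rightarrow> nat \<Rightarrow> complex \<Rightarrow> complex mat" where
  "right_state S x l \<sigma> 0 = Bmat S"
| "right_state S x l \<sigma> (Suc q) = (\<lambda>_. mat_deriv (l (Suc q))
     (\<lambda>s. Nmat S (Suc (x (Suc q))) s * (Kinv S s * right_state S x l \<sigma> q s)) (\<sigma> (Suc q)))"

lemma analytic_mat_at_right_state: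
  assumes S: "is_bilinear_system S" and "analytic_point S z"
    and "\<And>i. i \<in> {1..q} \<Longrightarrow> analytic_point S (\<sigma> i)" "\<And>i. i \<in> {1..q} \<Longrightarrow> x i < indim S"
  shows "analytic_mat_at (statedim S) (indim S) (right_state S x l \<sigma> q) z"
  using assms(2-)
proof (induction q arbitrary: z)
  case 0
  then show ?case using analytic_mat_at_system(3)[OF S] by simp
next
  case (Suc q)
  have "analytic_mat_at (statedim S) (indim S) (right_state S x l \<sigma> q) (\<sigma> (Suc q))"
    by (rule Suc.IH) (use Suc.prems in auto)
  then show ?case
    using Suc.prems unfolding right_state.simps
    by (intro analytic_mat_at_const mat_deriv_carrier analytic_mat_at_mult[OF analytic_mat_at_Nmat[OF S]] analytic_mat_at_mult[OF analytic_mat_at_system(2)[OF S]]) auto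
qed

lemma right_state_cong:
  assumes "\<And>i. i \<in> {1..q} \<Longrightarrow> l i = l' i" "\<And>i. i \<in> {1..q} \<Longrightarrow> \<sigma> i = \<sigma>' i"
  shows "right_state S x l \<sigma> q = right_state S x l' \<sigma>' q"
  using assms by (induction q) auto

lemma analytic_mat_at_eventually_assoc:
  assumes "analytic_mat_at p n F z" "analytic_mat_at n q G z" "analytic_mat_at q r H z"
  shows "\<forall>\<^sub>F s in nhds z. F s * (G s * H s) = F s * G s * H s"
proof -
  have "\<forall>\<^sub>F s in nhds z. F s \<in> carrier_mat p n" "\<forall>\<^sub>F s in nhds z. G s \<in> carrier_mat n q"
     "\<forall>\<^sub>F s in nhds z. H s \<in> carrier_mat q r"
    using assms by (auto simp: analytic_mat_at_def)
  then show ?thesis by eventually_elim simp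
qed

lemma mat_deriv_assoc_const:
  assumes F: "analytic_mat_at p n F z" and G: "analytic_mat_at n q G z" and A: "A \<in> carrier_mat q r"
  shows "mat_deriv j (\<lambda>s. F s * (G s * A)) z = mat_deriv j (\<lambda>s. F s * G s) z * A"
proof -
  have "mat_deriv j (\<lambda>s. F s * (G s * A)) z = mat_deriv j (\<lambda>s. F s * G s * A) z"
    by (rule mat_deriv_cong[OF analytic_mat_at_eventually_assoc[OF F G analytic_mat_at_const[OF A]]])
  then show ?thesis using mat_deriv_mult_right[OF analytic_mat_at_mult[OF F G] A] by simp
qed

lemma mat_deriv_const_assoc:
  assumes A: "A \<in> carrier_mat p n" and F: "analytic_mat_at n q F z" and G: "analytic_mat_at q r G z"
  shows "mat_deriv j (\<lambda>s. A * F s * G s) z = A * mat_deriv j (\<lambda>s. F s * G s) z"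
proof -
  have "\<forall>\<^sub>F s in nhds z. A * F s * G s = A * (F s * G s)"
    using analytic_mat_at_eventually_assoc[OF analytic_mat_at_const[OF A] F G] by (auto elim: eventually_mono)
  then have "mat_deriv j (\<lambda>s. A * F s * G s) z = mat_deriv j (\<lambda>s. A * (F s * G s)) z"
    by (rule mat_deriv_cong)
  then show ?thesis using mat_deriv_mult_left[OF A analytic_mat_at_mult[OF F G]] by simp
qed

text \<open>Unrolls \<open>e\<close> steps of the recursion. Since \<open>e < q\<close>, the state
  that remains is still a constant, hence can be taken out of the derivative as a right factor,
  which leaves the derivative of \<open>N K\<^sup>-\<^sup>1\<close> alone, as in
  \<open>V_block\<close>.\<close>

lemma right_state_ordered_prod:
  assumes S: "is_bilinear_system S"
    and \<sigma>: "\<And>i. i \<in> {1..q} \<Longrightarrow> analytic_point S (\<sigma> i)" and x: "\<And>i. i \<in> {1..q} \<Longrightarrow> x i < indim S"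
    and e: "e < q"
  shows "right_state S x l \<sigma> q t = ordered_prod (statedim S)
     (\<lambda>i. mat_deriv (l (Suc q - i)) (\<lambda>s. Nmat S (Suc (x (Suc q - i))) s * Kinv S s) (\<sigma> (Suc q - i))) 1 e *
     right_state S x l \<sigma> (q - e) t"
  using e
proof (induction e)
  case 0
  have "analytic_point S (\<sigma> q)" using 0 \<sigma> by auto
  then have "right_state S x l \<sigma> q (\<sigma> q) \<in> carrier_mat (statedim S) (indim S)"
    by (intro analytic_mat_at_carrier analytic_mat_at_right_state[OF S]) (use \<sigma> x in auto)
  \<comment> \<open>For \<open>q > 0\<close> the state ignores its argument, so its size, known at
    the analytic point \<open>\<sigma> q\<close>, is known at every \<open>t\<close>.\<close>
  moreover have "right_state S x l \<sigma> q (\<sigma> q) = right_state S x l \<sigma> q t" using 0 by (cases q) auto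
  ultimately show ?case by (simp add: ordered_prod_empty)
next
  case (Suc e)
  define F where "F = (\<lambda>i. mat_deriv (l (Suc q - i)) (\<lambda>s. Nmat S (Suc (x (Suc q - i))) s * Kinv S s) (\<sigma> (Suc q - i)))"
  define d where "d = q - Suc (Suc e)"
  have d: "q - e = Suc (Suc d)" "q - Suc e = Suc d" "Suc q - Suc e = Suc (Suc d)" "Suc (Suc d) \<in> {1..q}"
    using Suc.prems by (auto simp: d_def)
  have F: "F i \<in> carrier_mat (statedim S) (statedim S)" if "i \<in> {1..q}" for i
  proof -
    have "Suc q - i \<in> {1..q}" using that by auto
    from \<sigma>[OF this] x[OF this] show ?thesis
      unfolding F_def
      by (intro mat_deriv_carrier[OF analytic_mat_at_mult[OF analytic_mat_at_Nmat[OF S] analytic_mat_at_system(2)[OF S]]])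
  qed
  note sd = \<sigma>[OF d(4)] and xd = x[OF d(4)]
  have "analytic_mat_at (statedim S) (indim S) (right_state S x l \<sigma> (Suc d)) (\<sigma> (Suc (Suc d)))"
    by (rule analytic_mat_at_right_state[OF S sd]) (use \<sigma> x d in auto)
  then have R: "right_state S x l \<sigma> (Suc d) t \<in> carrier_mat (statedim S) (indim S)"
    using analytic_mat_at_carrier by force
  have 1: "right_state S x l \<sigma> (Suc (Suc d)) t = F (Suc e) * right_state S x l \<sigma> (Suc d) t"
    using mat_deriv_assoc_const[OF analytic_mat_at_Nmat[OF S sd xd] analytic_mat_at_system(2)[OF S sd] R]
    by (simp add: F_def d)
  have OP: "ordered_prod (statedim S) F 1 e \<in> carrier_mat (statedim S) (statedim S)"
    by (rule ordered_prod_square_carrier) (use F Suc.prems in auto)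
  have "right_state S x l \<sigma> q t = ordered_prod (statedim S) F 1 e * (F (Suc e) * right_state S x l \<sigma> (Suc d) t)"
    using Suc 1 d by (simp add: F_def)
  also have "\<dots> = ordered_prod (statedim S) F 1 (Suc e) * right_state S x l \<sigma> (Suc d) t"
    using assoc_mult_mat[OF OP F R, of "Suc e"] Suc.prems by (simp add: ordered_prod_Suc)
  finally show ?case by (simp add: F_def d)
qed

lemma analytic_mat_at_kron_factor:
  assumes S: "is_bilinear_system S" and z: "analytic_point S z"
  shows "analytic_mat_at (indim S ^ e * statedim S) (indim S ^ Suc e * statedim S)
     (\<lambda>s. kron (1\<^sub>m (indim S ^ e)) (Nrow S s) * kron (1\<^sub>m (indim S ^ Suc e)) (Kinv S s)) z"
proof -
  have "analytic_mat_at (indim S ^ e * statedim S) (indim S ^ Suc e * statedim S) (\<lambda>s. kron (1\<^sub>m (indim S ^ e)) (Nrow S s)) z"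
    using analytic_mat_at_kron_one[of "statedim S" "statedim S * indim S" "Nrow S" z "indim S ^ e"] z
    by (simp add: analytic_point_iff[OF S] ac_simps)
  then show ?thesis
    by (rule analytic_mat_at_mult[OF _ analytic_mat_at_kron_one[OF analytic_mat_at_system(2)[OF S z]]])
qed

text \<open>This is the bridge from the hypothesis on the span, which speaks of
  \<open>V_block\<close>, to the range condition of \<open>right_projection\<close>, which speaks of
  states. The factors of \<open>V_block\<close> run from \<open>\<sigma> (q - 1)\<close> down to
  \<open>\<sigma> 1\<close>, whereas \<open>x i\<close> is the letter of the variable
  \<open>s\<^sub>i\<close>; hence the reversed word \<open>x (q - i)\<close>.\<close>

lemma V_block_word:
  assumes S: "is_bilinear_system S" and q: "q \<ge> 1"
    and \<sigma>: "\<And>i. i \<in> {1..q} \<Longrightarrow> analytic_point S (\<sigma> i)" and x: "\<And>i. i \<in> {1..<q} \<Longrightarrow> x i < indim S"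
  shows "V_block S \<sigma> l q j \<in> carrier_mat (statedim S) (indim S ^ (q - 1) * indim S) \<and>
    block_col (indim S) (word_index (indim S) (\<lambda>i. x (q - i)) (q - 1)) (V_block S \<sigma> l q j) =
      mat_deriv j (\<lambda>s. Kinv S s * right_state S x l \<sigma> (q - 1) s) (\<sigma> q)"
proof (cases "q = 1")
  case True
  then have s1: "analytic_point S (\<sigma> 1)" using \<sigma> by auto
  have "mat_deriv j (\<lambda>s. Kinv S s * Bmat S s) (\<sigma> 1) \<in> carrier_mat (statedim S) (indim S)"
    by (rule mat_deriv_carrier[OF analytic_mat_at_mult[OF analytic_mat_at_system(2,3)[OF S s1]]])
  then show ?thesis using True block_col_0 by (simp add: V_block_def)
next
  case False
  define p where "p = q - 2"
  have q: "q = Suc (Suc p)" using False assms(2) by (simp add: p_def)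
  define n m where "n = statedim S" and "m = indim S"
  define A where "A = (\<lambda>i. mat_deriv (l (q - i))
      (\<lambda>s. kron (1\<^sub>m (m ^ (i - 1))) (Nrow S s) * kron (1\<^sub>m (m ^ i)) (Kinv S s)) (\<sigma> (q - i)))"
  define F where "F = (\<lambda>i. mat_deriv (l (q - i)) (\<lambda>s. Nmat S (Suc (x (q - i))) s * Kinv S s) (\<sigma> (q - i)))"
  define u where "u = (\<lambda>i. x (q - i))"
  have s: "analytic_point S (\<sigma> (q - i))" "u i < m" if "i \<in> {1..Suc p}" for i
    using that \<sigma>[of "q - i"] x[of "q - i"] by (auto simp: q m_def u_def)
  have OP: "ordered_prod n A 1 p \<in> carrier_mat n (m ^ p * n) \<and>
    block_col n (word_index m u p) (ordered_prod n A 1 p) = ordered_prod n F 1 p"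
  proof (rule block_col_ordered_prod)
    fix i assume i: "i \<in> {1..p}"
    then have s': "analytic_point S (\<sigma> (q - i))" "x (q - i) < indim S" "Suc (i - 1) = i"
      using s[of i] by (auto simp: u_def m_def)
    show "u i < m" using i s by auto
    show "A i \<in> carrier_mat (m ^ (i - 1) * n) (m ^ i * n)"
      unfolding A_def n_def m_def
      using mat_deriv_carrier[OF analytic_mat_at_kron_factor[OF S s'(1), of "i - 1"]] s'(3) by simp
    fix X :: "complex mat" and w assume X: "X \<in> carrier_mat n (m ^ (i - 1) * n)" and w: "w < m ^ (i - 1)"
    show "block_col n (w * m + u i) (X * A i) = block_col n w X * F i"
      using block_col_mult_mat_deriv_kron[OF S s'(1) X[unfolded n_def m_def] w[unfolded m_def] s'(2)
          analytic_mat_at_system(2)[OF S s'(1)]] s'(3)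
      by (simp add: A_def F_def n_def m_def u_def)
  qed
  have s1: "analytic_point S (\<sigma> 1)" and x1: "x 1 < indim S"
    using s[of "Suc p"] by (auto simp: q u_def m_def)
  have sq: "analytic_point S (\<sigma> q)" using \<sigma> q by auto
  have Kq: "mat_deriv j (Kinv S) (\<sigma> q) \<in> carrier_mat n n"
    unfolding n_def by (rule mat_deriv_carrier[OF analytic_mat_at_system(2)[OF S sq]])
  define X where "X = mat_deriv j (Kinv S) (\<sigma> q) * ordered_prod n A 1 p"
  have X: "X \<in> carrier_mat n (m ^ p * n)" unfolding X_def using Kq OP by auto
  have cp: "word_index m u p < m ^ p" by (rule word_index_less) (use s in auto)
  have bX: "block_col n (word_index m u p) X = mat_deriv j (Kinv S) (\<sigma> q) * ordered_prod n F 1 p"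
    unfolding X_def using block_col_mult[OF Kq _ cp, of "ordered_prod n A 1 p" n] OP by simp
  define L where "L = mat_deriv (l 1) (\<lambda>s. kron (1\<^sub>m (m ^ p)) (Nrow S s) * kron (1\<^sub>m (m ^ Suc p)) (Kinv S s * Bmat S s)) (\<sigma> 1)"
  have KB: "analytic_mat_at n m (\<lambda>s. Kinv S s * Bmat S s) (\<sigma> 1)"
    unfolding n_def m_def by (rule analytic_mat_at_mult[OF analytic_mat_at_system(2,3)[OF S s1]])
  have kN: "analytic_mat_at (m ^ p * n) (m ^ Suc p * n) (\<lambda>s. kron (1\<^sub>m (m ^ p)) (Nrow S s)) (\<sigma> 1)"
    using analytic_mat_at_kron_one[of "statedim S" "statedim S * indim S" "Nrow S" "\<sigma> 1" "indim S ^ p"] s1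
    by (simp add: analytic_point_iff[OF S] ac_simps n_def m_def)
  have L: "L \<in> carrier_mat (m ^ p * n) (m ^ Suc p * m)"
    unfolding L_def by (rule mat_deriv_carrier[OF analytic_mat_at_mult[OF kN analytic_mat_at_kron_one[OF KB]]])
  \<comment> \<open>The mixed product rule merges \<open>K\<^sup>-\<^sup>1\<close> and
    \<open>B\<close> under one Kronecker product. Then the last factor is of the same kind as the
    others, with \<open>L = K\<^sup>-\<^sup>1 B\<close>.\<close>
  have "mat_deriv (l 1) (\<lambda>s. kron (1\<^sub>m (m ^ p)) (Nrow S s) * kron (1\<^sub>m (m ^ Suc p)) (Kinv S s) *
      kron (1\<^sub>m (m ^ Suc p)) (Bmat S s)) (\<sigma> 1) = L"
    unfolding L_def
  proof (rule mat_deriv_cong)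
    have "\<forall>\<^sub>F s in nhds (\<sigma> 1). Kinv S s \<in> carrier_mat n n"
      using analytic_mat_at_system(2)[OF S s1] by (simp add: analytic_mat_at_def n_def)
    then show "\<forall>\<^sub>F s in nhds (\<sigma> 1). kron (1\<^sub>m (m ^ p)) (Nrow S s) * kron (1\<^sub>m (m ^ Suc p)) (Kinv S s) *
      kron (1\<^sub>m (m ^ Suc p)) (Bmat S s) = kron (1\<^sub>m (m ^ p)) (Nrow S s) * kron (1\<^sub>m (m ^ Suc p)) (Kinv S s * Bmat S s)"
    proof eventually_elim
      case (elim s)
      have B: "Bmat S s \<in> carrier_mat n m" using bilinear_carrier(3)[OF S] by (simp add: n_def m_def)
      show ?case
        unfolding kron_one_mult[OF elim B, symmetric]
        by (rule assoc_mult_mat[OF kron_Nrow_carrier[of S p s, folded n_def m_def]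
            kron_one_carrier[OF elim] kron_one_carrier[OF B]])
    qed
  qed
  then have V: "V_block S \<sigma> l q j = X * L"
    using False by (simp add: V_block_def X_def A_def n_def m_def q)
  have R1: "right_state S x l \<sigma> 1 (\<sigma> q) \<in> carrier_mat n m"
    unfolding n_def m_def by (rule analytic_mat_at_carrier[OF analytic_mat_at_right_state[OF S sq]]) (use s1 x1 in auto)
  have "block_col m (word_index m u (Suc p)) (V_block S \<sigma> l q j) = block_col m (word_index m u p * m + u (Suc p)) (X * L)"
    by (simp add: V)
  also have "\<dots> = block_col n (word_index m u p) X * right_state S x l \<sigma> 1 (\<sigma> q)"
    unfolding L_def n_def m_def
    using block_col_mult_mat_deriv_kron[OF S s1 X[unfolded n_def m_def] cp[unfolded m_def] x1 KB[unfolded n_def m_def]]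
    by (simp add: u_def q)
  also have "\<dots> = mat_deriv j (Kinv S) (\<sigma> q) * (ordered_prod n F 1 p * right_state S x l \<sigma> 1 (\<sigma> q))"
    unfolding bX
    by (rule assoc_mult_mat[OF Kq ordered_prod_square_carrier R1])
      (use s in \<open>auto simp: F_def n_def u_def m_def intro!: mat_deriv_carrier analytic_mat_at_mult[OF analytic_mat_at_Nmat[OF S] analytic_mat_at_system(2)[OF S]]\<close>)
  \<comment> \<open>Unrolling \<open>p\<close> of the \<open>p + 1\<close> steps leaves the state at
    index 1, the one that has absorbed \<open>B\<close>.\<close>
  also have "ordered_prod n F 1 p * right_state S x l \<sigma> 1 (\<sigma> q) = right_state S x l \<sigma> (Suc p) (\<sigma> q)"
    using right_state_ordered_prod[OF S, of "Suc p" \<sigma> x p l "\<sigma> q"] \<sigma> x by (simp add: F_def n_def q)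
  also have "mat_deriv j (Kinv S) (\<sigma> q) * \<dots> = mat_deriv j (\<lambda>s. Kinv S s * right_state S x l \<sigma> (Suc p) s) (\<sigma> q)"
  proof -
    have "right_state S x l \<sigma> (Suc p) (\<sigma> q) \<in> carrier_mat n m"
      unfolding n_def m_def by (rule analytic_mat_at_carrier[OF analytic_mat_at_right_state[OF S sq]]) (use \<sigma> x q in auto)
    from mat_deriv_mult_right[OF analytic_mat_at_system(2)[OF S sq], folded n_def, OF this] show ?thesis by simp
  qed
  finally have "block_col m (word_index m u (Suc p)) (V_block S \<sigma> l q j) =
      mat_deriv j (\<lambda>s. Kinv S s * right_state S x l \<sigma> (Suc p) s) (\<sigma> q)" .
  moreover have "V_block S \<sigma> l q j \<in> carrier_mat n (m ^ Suc p * m)"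
    unfolding V by (rule mult_carrier_mat[OF X L])
  moreover have "q - 1 = Suc p" by (simp add: q)
  ultimately show ?thesis unfolding u_def n_def m_def by metis
qed

text \<open>With all orders 0 the derivatives in \<open>V_block\<close> are values. Hence the word
  decomposition of the transfer functions is a special case of that of \<open>V_block\<close> and
  needs no induction of its own.\<close>

lemma transfer_V_block:
  assumes S: "is_bilinear_system S" and k: "k \<ge> 1"
    and s: "\<And>i. i \<in> {1..k} \<Longrightarrow> analytic_point S (s i)"
  shows "transfer S k s = Cmat S (s k) * V_block S s (\<lambda>_. 0) k 0"
proof -
  define n m where "n = statedim S" and "m = indim S"
  have sk: "analytic_point S (s k)" and s1: "analytic_point S (s 1)" using s k by auto
  have C: "Cmat S (s k) \<in> carrier_mat (outdim S) n" and B: "Bmat S (s 1) \<in> carrier_mat n m"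
    using bilinear_carrier[OF S] by (auto simp: n_def m_def)
  have K: "Kinv S (s k) \<in> carrier_mat n n"
    unfolding n_def by (rule analytic_mat_at_carrier[OF analytic_mat_at_system(2)[OF S sk]])
  show ?thesis
  proof (cases "k = 1")
    case True
    then show ?thesis
      using C K B by (simp add: transfer_def V_block_def mat_deriv_0 ordered_prod_empty kron_one_one[OF B, simplified] n_def)
  next
    case False
    define p where "p = k - 2"
    have kp: "k = Suc (Suc p)" using False k by (simp add: p_def)
    define A where "A = (\<lambda>j. kron (1\<^sub>m (m ^ (j - 1))) (Nrow S (s (k - j))) * kron (1\<^sub>m (m ^ j)) (Kinv S (s (k - j))))"
    have A: "A j \<in> carrier_mat (m ^ (j - 1) * n) (m ^ j * n)" if j: "j \<in> {1..Suc p}" for j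
    proof -
      have "analytic_point S (s (k - j))" "Suc (j - 1) = j" using s[of "k - j"] j by (auto simp: kp)
      then show ?thesis
        using analytic_mat_at_carrier[OF analytic_mat_at_kron_factor[OF S, of "s (k - j)" "j - 1"]]
        by (simp add: A_def n_def m_def)
    qed
    have OP: "ordered_prod n A 1 e \<in> carrier_mat n (m ^ e * n)" if "e \<le> Suc p" for e
      using that
    proof (induction e)
      case (Suc e)
      then show ?case using A[of "Suc e"] by (auto simp: ordered_prod_Suc intro!: mult_carrier_mat)
    qed (simp add: ordered_prod_empty)
    have kB: "kron (1\<^sub>m (m ^ Suc p)) (Bmat S (s 1)) \<in> carrier_mat (m ^ Suc p * n) (m ^ Suc p * m)"
      by (rule kron_one_carrier[OF B])
    have "Cmat S (s k) * Kinv S (s k) * ordered_prod n A 1 (Suc p) * kron (1\<^sub>m (m ^ Suc p)) (Bmat S (s 1)) =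
       Cmat S (s k) * (Kinv S (s k) * ordered_prod n A 1 p * (A (Suc p) * kron (1\<^sub>m (m ^ Suc p)) (Bmat S (s 1))))"
    proof -
      let ?P = "ordered_prod n A 1 p" and ?L = "kron (1\<^sub>m (m ^ Suc p)) (Bmat S (s 1))"
      note P = OP[of p, OF le_SucI[OF le_refl]]
      have A': "A (Suc p) \<in> carrier_mat (m ^ p * n) (m ^ Suc p * n)" using A[of "Suc p"] by simp
      have "Cmat S (s k) * Kinv S (s k) * (?P * A (Suc p)) * ?L = Cmat S (s k) * Kinv S (s k) * (?P * A (Suc p) * ?L)"
        by (rule assoc_mult_mat[OF mult_carrier_mat[OF C K] mult_carrier_mat[OF P A'] kB])
      also have "?P * A (Suc p) * ?L = ?P * (A (Suc p) * ?L)"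
        by (rule assoc_mult_mat[OF P A' kB])
      also have "Cmat S (s k) * Kinv S (s k) * (?P * (A (Suc p) * ?L)) = Cmat S (s k) * (Kinv S (s k) * (?P * (A (Suc p) * ?L)))"
        by (rule assoc_mult_mat[OF C K mult_carrier_mat[OF P mult_carrier_mat[OF A' kB]]])
      also have "Kinv S (s k) * (?P * (A (Suc p) * ?L)) = Kinv S (s k) * ?P * (A (Suc p) * ?L)"
        by (rule assoc_mult_mat[OF K P mult_carrier_mat[OF A' kB], symmetric])
      finally show ?thesis by (simp add: ordered_prod_Suc)
    qed
    then show ?thesis
      by (simp add: transfer_def V_block_def mat_deriv_0 A_def n_def m_def kp)
  qed
qed

lemma transfer_word:
  assumes S: "is_bilinear_system S" and k: "k \<ge> 1"
    and s: "\<And>i. i \<in> {1..k} \<Longrightarrow> analytic_point S (s i)" and x: "\<And>i. i \<in> {1..<k} \<Longrightarrow> x i < indim S"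
    and a: "a < outdim S" and b: "b < indim S"
  shows "transfer S k s $$ (a, word_index (indim S) (\<lambda>i. x (k - i)) (k - 1) * indim S + b) =
    (Cmat S (s k) * (Kinv S (s k) * right_state S x (\<lambda>_. 0) s (k - 1) (s k))) $$ (a, b)"
proof -
  note C = bilinear_carrier(1)[OF S, of "s k"]
  note V = V_block_word[of S k s x "\<lambda>_. 0" 0, OF S k s x]
  have "word_index (indim S) (\<lambda>i. x (k - i)) (k - 1) < indim S ^ (k - 1)"
    by (rule word_index_less) (use x in auto)
  from block_col_mult[OF C conjunct1[OF V] this]
  have "block_col (indim S) (word_index (indim S) (\<lambda>i. x (k - i)) (k - 1)) (transfer S k s) =
     Cmat S (s k) * (Kinv S (s k) * right_state S x (\<lambda>_. 0) s (k - 1) (s k))"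
    using conjunct2[OF V] transfer_V_block[of S k s, OF S k s] by (simp add: mat_deriv_0)
  moreover have "dim_row (transfer S k s) = outdim S"
    using C by (simp add: transfer_def)
  ultimately show ?thesis using a b block_col_entry[of a "transfer S k s" b] by metis
qed

section \<open>Left states and mixed derivatives\<close>

text \<open>Likewise, \<open>left_state S y \<nu> \<tau> e\<close> is what stands to the left of \<open>K\<^sup>-\<^sup>1\<close> at the variable with
  distance \<open>e\<close> from the last one; all its index functions count from the last variable.\<close>

primrec left_state :: "bilinear_system \<Rightarrow> (nat \<Rightarrow> nat) \<Rightarrow> (nat \<Rightarrow> nat) \<Rightarrow> (nat \<Rightarrow> complex) \<Rightarrow> nat \<Rightarrow> complex \<Rightarrow> complex mat" where
  "left_state S y \<nu> \<tau> 0 = Cmat S"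
| "left_state S y \<nu> \<tau> (Suc e) = (\<lambda>s. mat_deriv (\<nu> e) (\<lambda>s. left_state S y \<nu> \<tau> e s * Kinv S s) (\<tau> e) * Nmat S (Suc (y (Suc e))) s)"

lemma analytic_mat_at_left_state:
  assumes S: "is_bilinear_system S" and "analytic_point S z"
    and "\<And>i. i < e \<Longrightarrow> analytic_point S (\<tau> i)" "\<And>i. i \<in> {1..e} \<Longrightarrow> y i < indim S"
  shows "analytic_mat_at (outdim S) (statedim S) (left_state S y \<nu> \<tau> e) z"
  using assms(2-)
proof (induction e arbitrary: z)
  case 0
  then show ?case using analytic_mat_at_system(1)[OF S] by simp
next
  case (Suc e)
  have "analytic_mat_at (outdim S) (statedim S) (left_state S y \<nu> \<tau> e) (\<tau> e)"
    by (rule Suc.IH) (use Suc.prems in auto)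
  moreover have "analytic_point S (\<tau> e)" "y (Suc e) < indim S" using Suc.prems by auto
  ultimately show ?case
    unfolding left_state.simps
    by (intro analytic_mat_at_mult[OF analytic_mat_at_const[OF mat_deriv_carrier[OF analytic_mat_at_mult[OF _ analytic_mat_at_system(2)[OF S]]]]
          analytic_mat_at_Nmat[OF S Suc.prems(1)]])
qed

lemma left_state_cong:
  assumes "\<And>i. i < e \<Longrightarrow> \<nu> i = \<nu>' i" "\<And>i. i < e \<Longrightarrow> \<tau> i = \<tau>' i" "\<And>i. i \<in> {1..e} \<Longrightarrow> y i = y' i"
  shows "left_state S y \<nu> \<tau> e = left_state S y' \<nu>' \<tau>' e"
  using assms by (induction e) auto

section \<open>Mixed derivatives of the transfer functions\<close>

lemma partial_deriv_funpow:
  "(partial_deriv i ^^ n) f z = (deriv ^^ n) (\<lambda>t. f (z(i := t))) (z i)"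
proof (induction n arbitrary: z)
  case (Suc n)
  have "(partial_deriv i ^^ Suc n) f z = deriv (\<lambda>t. (partial_deriv i ^^ n) f (z(i := t))) (z i)"
    by (simp add: partial_deriv_def)
  then show ?case by (simp only: Suc fun_upd_upd fun_upd_same funpow.simps comp_def)
qed simp

text \<open>\<open>mixed_deriv\<close> treats the last variable first. What stands to the right of
  that variable does not depend on it, so differentiating gives a constant \<open>G\<close> times
  the state, and \<open>G\<close> times the next \<open>N\<close> becomes the new left factor. This
  is why \<open>M\<close> is arbitrary instead of \<open>Cmat\<close>. The formula for
  \<open>f\<close> is required only where it can be guaranteed: at analytic points whose later
  coordinates are those of \<open>z\<close>, already evaluated.\<close>

lemma mixed_deriv_state:
  assumes S: "is_bilinear_system S"
    and "\<And>i. i \<in> {1..Suc q} \<Longrightarrow> analytic_point S (z i)" "\<And>i. i \<in> {1..q} \<Longrightarrow> x i < indim S"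
    and "analytic_mat_at p (statedim S) M (z (Suc q))" "a < p" "b < indim S"
    and "\<And>s. (\<And>i. i \<in> {1..Suc q} \<Longrightarrow> analytic_point S (s i)) \<Longrightarrow> (\<And>i. i > Suc q \<Longrightarrow> s i = z i) \<Longrightarrow>
       f s = (M (s (Suc q)) * (Kinv S (s (Suc q)) * right_state S x (\<lambda>_. 0) s q (s (Suc q)))) $$ (a, b)"
  shows "mixed_deriv (Suc q) j f z =
    mat_deriv (j (Suc q)) (\<lambda>s. M s * (Kinv S s * right_state S x j z q s)) (z (Suc q)) $$ (a, b)"
  using assms(2-)
proof (induction q arbitrary: f M p a)
  case 0
  have z1: "analytic_point S (z 1)" using 0 by auto
  have "mixed_deriv (Suc 0) j f z = (deriv ^^ j 1) (\<lambda>t. f (z(1 := t))) (z 1)"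
    by (simp add: partial_deriv_funpow)
  also have "\<dots> = (deriv ^^ j 1) (\<lambda>t. (M t * (Kinv S t * Bmat S t)) $$ (a, b)) (z 1)"
  proof (rule higher_deriv_cong_ev)
    show "\<forall>\<^sub>F t in nhds (z 1). f (z(1 := t)) = (M t * (Kinv S t * Bmat S t)) $$ (a, b)"
      using eventually_analytic_point[OF S z1]
      by eventually_elim (use 0(6) in auto)
  qed simp
  also have "\<dots> = mat_deriv (j 1) (\<lambda>t. M t * (Kinv S t * Bmat S t)) (z 1) $$ (a, b)"
    using 0 analytic_mat_at_system(2,3)[OF S z1]
    by (subst mat_deriv_entry[of p "indim S"]) (auto intro!: analytic_mat_at_mult[of p "statedim S"] analytic_mat_at_mult[of _ "statedim S"])
  finally show ?case by simp
next
  case (Suc q)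
  define k where "k = Suc (Suc q)"
  define g where "g = (partial_deriv k ^^ j k) f"
  define G where "G = mat_deriv (j k) (\<lambda>t. M t * Kinv S t) (z k)"
  have zk: "analytic_point S (z k)" and M: "analytic_mat_at p (statedim S) M (z k)" and xq: "x (Suc q) < indim S"
    using Suc.prems by (auto simp: k_def)
  have zq: "analytic_point S (z (Suc q))" using Suc.prems by auto
  note K = analytic_mat_at_system(2)[OF S zk]
  have G: "G \<in> carrier_mat p (statedim S)"
    unfolding G_def by (rule mat_deriv_carrier[OF analytic_mat_at_mult[OF M K]])
  \<comment> \<open>After the last variable has been dealt with, \<open>g\<close> meets the
    hypothesis of the induction with \<open>G * N\<close> in the role of \<open>M\<close>.\<close>
  have g: "g s = (G * Nmat S (Suc (x (Suc q))) (s (Suc q)) * (Kinv S (s (Suc q)) * right_state S x (\<lambda>_. 0) s q (s (Suc q)))) $$ (a, b)"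
    if s: "\<And>i. i \<in> {1..Suc q} \<Longrightarrow> analytic_point S (s i)" "\<And>i. i > Suc q \<Longrightarrow> s i = z i" for s
  proof -
    define T where "T = right_state S x (\<lambda>_. 0) s (Suc q) (z k)"
    have sk: "s k = z k" using s(2) by (simp add: k_def)
    have sq: "analytic_point S (s (Suc q))" using s(1) by auto
    have R: "right_state S x (\<lambda>_. 0) s q (s (Suc q)) \<in> carrier_mat (statedim S) (indim S)"
      by (rule analytic_mat_at_carrier[OF analytic_mat_at_right_state[OF S sq]]) (use s Suc.prems in auto)
    have T: "T \<in> carrier_mat (statedim S) (indim S)"
      unfolding T_def by (rule analytic_mat_at_carrier[OF analytic_mat_at_right_state[OF S zk]]) (use s Suc.prems in auto)
    have "g s = (deriv ^^ j k) (\<lambda>t. f (s(k := t))) (z k)"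
      by (simp add: g_def partial_deriv_funpow sk)
    also have "\<dots> = (deriv ^^ j k) (\<lambda>t. (M t * (Kinv S t * T)) $$ (a, b)) (z k)"
    proof (rule higher_deriv_cong_ev)
      show "\<forall>\<^sub>F t in nhds (z k). f (s(k := t)) = (M t * (Kinv S t * T)) $$ (a, b)"
        using eventually_analytic_point[OF S zk]
      proof eventually_elim
        case (elim t)
        have "f (s(k := t)) = (M ((s(k := t)) k) * (Kinv S ((s(k := t)) k) *
            right_state S x (\<lambda>_. 0) (s(k := t)) (Suc q) ((s(k := t)) k))) $$ (a, b)"
          unfolding k_def by (rule Suc.prems(6)) (use s elim in \<open>auto simp: k_def\<close>)
        \<comment> \<open>This state involves only the points with index below \<open>k\<close>,
          which the update leaves alone.\<close>
        also have "right_state S x (\<lambda>_. 0) (s(k := t)) (Suc q) = right_state S x (\<lambda>_. 0) s (Suc q)"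
          by (rule right_state_cong) (auto simp: k_def)
        also have "right_state S x (\<lambda>_. 0) s (Suc q) ((s(k := t)) k) = T"
          by (simp add: T_def)
        finally show ?case by (simp only: fun_upd_same)
      qed
    qed simp
    also have "\<dots> = mat_deriv (j k) (\<lambda>t. M t * (Kinv S t * T)) (z k) $$ (a, b)"
      using Suc.prems(4,5) M K T
      by (intro mat_deriv_entry[symmetric, of p "indim S"] analytic_mat_at_mult analytic_mat_at_const)
    also have "mat_deriv (j k) (\<lambda>t. M t * (Kinv S t * T)) (z k) = G * T"
      unfolding G_def by (rule mat_deriv_assoc_const[OF M K T])
    also have "G * T = G * Nmat S (Suc (x (Suc q))) (s (Suc q)) * (Kinv S (s (Suc q)) * right_state S x (\<lambda>_. 0) s q (s (Suc q)))"
      unfolding T_def right_state.simps mat_deriv_0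
      by (rule assoc_mult_mat[OF G analytic_mat_at_carrier[OF analytic_mat_at_Nmat[OF S sq xq]]
            mult_carrier_mat[OF analytic_mat_at_carrier[OF analytic_mat_at_system(2)[OF S sq]] R], symmetric])
    finally show ?thesis .
  qed
  have R: "analytic_mat_at (statedim S) (indim S) (right_state S x j z q) (z (Suc q))"
    by (rule analytic_mat_at_right_state[OF S zq]) (use Suc.prems in auto)
  have "mixed_deriv k j f z = mixed_deriv (Suc q) j g z"
    by (simp add: k_def g_def)
  also have "\<dots> = mat_deriv (j (Suc q)) (\<lambda>s. G * Nmat S (Suc (x (Suc q))) s * (Kinv S s * right_state S x j z q s)) (z (Suc q)) $$ (a, b)"
  proof (rule Suc.IH)
    show "analytic_mat_at p (statedim S) (\<lambda>s. G * Nmat S (Suc (x (Suc q))) s) (z (Suc q))"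
      by (rule analytic_mat_at_mult[OF analytic_mat_at_const[OF G] analytic_mat_at_Nmat[OF S zq xq]])
  qed (use Suc.prems g in auto)
  also have "mat_deriv (j (Suc q)) (\<lambda>s. G * Nmat S (Suc (x (Suc q))) s * (Kinv S s * right_state S x j z q s)) (z (Suc q)) =
     G * right_state S x j z (Suc q) (z k)"
    using mat_deriv_const_assoc[OF G analytic_mat_at_Nmat[OF S zq xq] analytic_mat_at_mult[OF analytic_mat_at_system(2)[OF S zq] R]] by simp
  \<comment> \<open>The inner variables have now been differentiated into the state, which is again
    a constant and returns under the derivative with respect to the last variable.\<close>
  also have "\<dots> = mat_deriv (j k) (\<lambda>s. M s * (Kinv S s * right_state S x j z (Suc q) s)) (z k)"
  proof -
    have "right_state S x j z (Suc q) (z k) \<in> carrier_mat (statedim S) (indim S)"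
      by (rule analytic_mat_at_carrier[OF analytic_mat_at_right_state[OF S zk]]) (use Suc.prems in auto)
    from mat_deriv_assoc_const[OF M K this] show ?thesis by (simp add: G_def)
  qed
  finally show ?case by (simp add: k_def)
qed

lemma transfer_dim:
  assumes "is_bilinear_system S"
  shows "dim_row (transfer S k s) = outdim S" "dim_col (transfer S k s) = indim S ^ (k - 1) * indim S"
  using bilinear_carrier[OF assms] by (auto simp: transfer_def kron_def)

lemma mat_mixed_deriv_transfer:
  assumes S: "is_bilinear_system S" and k: "k \<ge> 1"
    and z: "\<And>i. i \<in> {1..k} \<Longrightarrow> analytic_point S (z i)" and x: "\<And>i. i \<in> {1..<k} \<Longrightarrow> x i < indim S"
    and a: "a < outdim S" and b: "b < indim S"
  shows "mat_mixed_deriv k j (transfer S k) z $$ (a, word_index (indim S) (\<lambda>i. x (k - i)) (k - 1) * indim S + b) =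
    mat_deriv (j k) (\<lambda>s. Cmat S s * (Kinv S s * right_state S x j z (k - 1) s)) (z k) $$ (a, b)"
proof -
  obtain q where q: "k = Suc q" using k by (cases k) auto
  define c where "c = word_index (indim S) (\<lambda>i. x (k - i)) (k - 1) * indim S + b"
  have "word_index (indim S) (\<lambda>i. x (k - i)) (k - 1) < indim S ^ (k - 1)"
    by (rule word_index_less) (use x in auto)
  then have c: "c < indim S ^ (k - 1) * indim S"
    unfolding c_def by (rule block_index_less[OF _ b])
  have "mat_mixed_deriv k j (transfer S k) z $$ (a, c) = mixed_deriv k j (\<lambda>s. transfer S k s $$ (a, c)) z"
    using c a by (simp add: mat_mixed_deriv_def transfer_dim[OF S])
  also have "\<dots> = mat_deriv (j k) (\<lambda>s. Cmat S s * (Kinv S s * right_state S x j z (k - 1) s)) (z k) $$ (a, b)"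
    unfolding q diff_Suc_1
  proof (rule mixed_deriv_state[OF S])
    show "analytic_mat_at (outdim S) (statedim S) (Cmat S) (z (Suc q))"
      by (rule analytic_mat_at_system(1)[OF S]) (use z q in auto)
    fix s assume "\<And>i. i \<in> {1..Suc q} \<Longrightarrow> analytic_point S (s i)"
    then show "transfer S (Suc q) s $$ (a, c) =
       (Cmat S (s (Suc q)) * (Kinv S (s (Suc q)) * right_state S x (\<lambda>_. 0) s q (s (Suc q)))) $$ (a, b)"
      using transfer_word[OF S k _ x a b, of s] unfolding c_def q by auto
  qed (use z x a b q in auto)
  finally show ?thesis unfolding c_def .
qed

text \<open>The same derivative can be written with the cut at any variable. To move the cut one
  place to the right, the constant right state is taken out of the derivative, leaving
  \<open>A\<close>, the derivative of left state times \<open>K\<^sup>-\<^sup>1\<close>; then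
  \<open>A\<close> is drawn into the derivative by which that right state is defined. The maps
  \<open>Suc k - i\<close> translate to counting from the last variable.\<close>

lemma left_state_right_state_shift:
  assumes S: "is_bilinear_system S" and k: "e + q = k"
    and z: "\<And>i. i \<in> {1..Suc k} \<Longrightarrow> analytic_point S (z i)" and x: "\<And>i. i \<in> {1..k} \<Longrightarrow> x i < indim S"
  shows "mat_deriv (j (Suc k)) (\<lambda>s. Cmat S s * (Kinv S s * right_state S x j z k s)) (z (Suc k)) =
    mat_deriv (j (Suc q)) (\<lambda>s. left_state S (\<lambda>i. x (Suc k - i)) (\<lambda>i. j (Suc k - i)) (\<lambda>i. z (Suc k - i)) e s *
      (Kinv S s * right_state S x j z q s)) (z (Suc q))"
  using k
proof (induction e arbitrary: q)
  case 0
  then show ?case by simp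
next
  case (Suc e)
  define P where "P = left_state S (\<lambda>i. x (Suc k - i)) (\<lambda>i. j (Suc k - i)) (\<lambda>i. z (Suc k - i))"
  have ke: "Suc k - e = Suc (Suc q)" "k - e = Suc q" using Suc.prems by auto
  have z1: "analytic_point S (z (Suc q))" and z2: "analytic_point S (z (Suc (Suc q)))"
    using z Suc.prems by auto
  have xq: "x (Suc q) < indim S" using x Suc.prems by auto
  have P: "analytic_mat_at (outdim S) (statedim S) (P e) (z (Suc (Suc q)))"
    unfolding P_def
  proof (rule analytic_mat_at_left_state[OF S z2])
    show "analytic_point S (z (Suc k - i))" if "i < e" for i
      using z[of "Suc k - i"] that Suc.prems by auto
    show "x (Suc k - i) < indim S" if "i \<in> {1..e}" for i
      using that Suc.prems by (intro x) auto
  qed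
  have R: "analytic_mat_at (statedim S) (indim S) (right_state S x j z q) (z (Suc q))"
    by (rule analytic_mat_at_right_state[OF S z1]) (use z x Suc.prems in auto)
  have R': "right_state S x j z (Suc q) (z (Suc q)) \<in> carrier_mat (statedim S) (indim S)"
    by (rule analytic_mat_at_carrier[OF analytic_mat_at_right_state[OF S z1]]) (use z x Suc.prems in auto)
  define A where "A = mat_deriv (j (Suc (Suc q))) (\<lambda>s. P e s * Kinv S s) (z (Suc (Suc q)))"
  have A: "A \<in> carrier_mat (outdim S) (statedim S)"
    unfolding A_def by (rule mat_deriv_carrier[OF analytic_mat_at_mult[OF P analytic_mat_at_system(2)[OF S z2]]])
  have "mat_deriv (j (Suc k)) (\<lambda>s. Cmat S s * (Kinv S s * right_state S x j z k s)) (z (Suc k)) =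
    mat_deriv (j (Suc (Suc q))) (\<lambda>s. P e s * (Kinv S s * right_state S x j z (Suc q) s)) (z (Suc (Suc q)))"
    using Suc.IH[of "Suc q"] Suc.prems by (simp add: P_def)
  also have "\<dots> = A * right_state S x j z (Suc q) (z (Suc q))"
    using mat_deriv_assoc_const[OF P analytic_mat_at_system(2)[OF S z2] R'] by (simp add: A_def)
  also have "\<dots> = mat_deriv (j (Suc q)) (\<lambda>s. A * Nmat S (Suc (x (Suc q))) s * (Kinv S s * right_state S x j z q s)) (z (Suc q))"
    using mat_deriv_const_assoc[OF A analytic_mat_at_Nmat[OF S z1 xq] analytic_mat_at_mult[OF analytic_mat_at_system(2)[OF S z1] R]] by simp
  also have "(\<lambda>s. A * Nmat S (Suc (x (Suc q))) s) = P (Suc e)"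
    using ke by (simp add: P_def A_def)
  finally show ?case unfolding P_def[symmetric] by (metis (no_types, lifting))
qed

section \<open>Words in the left blocks\<close>

lemma Ncol_carrier [simp]: "Ncol S s \<in> carrier_mat (statedim S * indim S) (statedim S)"
  by (simp add: Ncol_def)

lemma Ncol_entry:
  assumes "c < indim S" "b < statedim S" "a < statedim S"
  shows "Ncol S s $$ (c * statedim S + b, a) = Nmat S (Suc c) s $$ (b, a)"
  using assms block_index_less[OF assms(1,2)] by (simp add: Ncol_def mult.commute)

lemma analytic_mat_at_Ncol:
  assumes S: "is_bilinear_system S" and z: "analytic_point S z"
  shows "analytic_mat_at (statedim S * indim S) (statedim S) (Ncol S) z"
  unfolding analytic_mat_at_def
proof safe
  fix i a assume i: "i < statedim S * indim S" and a: "a < statedim S"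
  then have c: "i div statedim S < indim S" "i mod statedim S < statedim S"
    by (auto simp: less_mult_imp_div_less mult.commute)
  have "(\<lambda>s. Nmat S (Suc (i div statedim S)) s $$ (i mod statedim S, a)) analytic_on {z}"
    using analytic_mat_at_Nmat[OF S z c(1)] c(2) a by (auto simp: analytic_mat_at_def)
  then show "(\<lambda>s. Ncol S s $$ (i, a)) analytic_on {z}"
    using i a by (simp add: Ncol_def)
qed simp

lemma KhNh_deriv_carrier:
  assumes "is_bilinear_system S" "analytic_point S z"
  shows "KhNh_deriv S i z \<in> carrier_mat (statedim S) (indim S * statedim S)"
  using mat_adjoint_carrier[OF mat_deriv_carrier[OF analytic_mat_at_mult[OF analytic_mat_at_Ncol[OF assms] analytic_mat_at_system(2)[OF assms]]]]
  by (simp add: KhNh_deriv_def mult.commute)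

text \<open>Conjugate transposition turns the row blocks \<open>N\<^sub>j K\<^sup>-\<^sup>1\<close>
  of the stacked matrix into column blocks, so words can be read off from column blocks here as
  well.\<close>

lemma block_col_KhNh_deriv:
  assumes S: "is_bilinear_system S" and z: "analytic_point S z" and c: "c < indim S"
  shows "block_col (statedim S) c (KhNh_deriv S i z) = mat_adjoint (mat_deriv i (\<lambda>s. Nmat S (Suc c) s * Kinv S s) z)"
proof (rule eq_matI)
  note NK = analytic_mat_at_mult[OF analytic_mat_at_Ncol[OF S z] analytic_mat_at_system(2)[OF S z]]
  note NK' = analytic_mat_at_mult[OF analytic_mat_at_Nmat[OF S z c] analytic_mat_at_system(2)[OF S z]]
  note D = mat_deriv_carrier[OF NK, of i] and D' = mat_deriv_carrier[OF NK', of i]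
  note KN = KhNh_deriv_carrier[OF S z, of i]
  fix a b assume "a < dim_row (mat_adjoint (mat_deriv i (\<lambda>s. Nmat S (Suc c) s * Kinv S s) z))"
    "b < dim_col (mat_adjoint (mat_deriv i (\<lambda>s. Nmat S (Suc c) s * Kinv S s) z))"
  then have ab: "a < statedim S" "b < statedim S" using D' by auto
  note cb = block_index_less[OF c ab(2)]
  have cb': "c * statedim S + b < statedim S * indim S" using cb by (simp add: mult.commute)
  have "\<forall>\<^sub>F s in nhds z. Kinv S s \<in> carrier_mat (statedim S) (statedim S)"
    using analytic_mat_at_system(2)[OF S z] by (simp add: analytic_mat_at_def)
  then have "\<forall>\<^sub>F s in nhds z. (Ncol S s * Kinv S s) $$ (c * statedim S + b, a) = (Nmat S (Suc c) s * Kinv S s) $$ (b, a)"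
  proof eventually_elim
    case (elim s)
    have N: "Nmat S (Suc c) s \<in> carrier_mat (statedim S) (statedim S)"
      using bilinear_carrier(4)[OF S] c by simp
    show ?case
      unfolding mult_mat_entry[OF Ncol_carrier elim cb' ab(1)] mult_mat_entry[OF N elim ab(2,1)]
      by (intro sum.cong refl) (simp add: Ncol_entry[OF c ab(2)])
  qed
  then have "(deriv ^^ i) (\<lambda>s. (Ncol S s * Kinv S s) $$ (c * statedim S + b, a)) z =
     (deriv ^^ i) (\<lambda>s. (Nmat S (Suc c) s * Kinv S s) $$ (b, a)) z"
    by (rule higher_deriv_cong_ev) simp
  then have "mat_deriv i (\<lambda>s. Ncol S s * Kinv S s) z $$ (c * statedim S + b, a) =
      mat_deriv i (\<lambda>s. Nmat S (Suc c) s * Kinv S s) z $$ (b, a)"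
    unfolding mat_deriv_entry[OF NK cb' ab(1)] mat_deriv_entry[OF NK' ab(2,1)] .
  then have "KhNh_deriv S i z $$ (a, c * statedim S + b) =
      mat_adjoint (mat_deriv i (\<lambda>s. Nmat S (Suc c) s * Kinv S s) z) $$ (a, b)"
    unfolding KhNh_deriv_def mat_adjoint_entry[OF D ab(1) cb'] mat_adjoint_entry[OF D' ab] by simp
  then show "block_col (statedim S) c (KhNh_deriv S i z) $$ (a, b) =
      mat_adjoint (mat_deriv i (\<lambda>s. Nmat S (Suc c) s * Kinv S s) z) $$ (a, b)"
    using ab KN by (subst block_col_entry) auto
qed (use KhNh_deriv_carrier[OF S z, of i]
      mat_deriv_carrier[OF analytic_mat_at_mult[OF analytic_mat_at_Nmat[OF S z c] analytic_mat_at_system(2)[OF S z]], of i] in auto)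

text \<open>Here the word is not reversed: \<open>x b\<close> belongs to the \<open>b\<close>-th of
  the points \<open>\<tau> (\<theta> - \<eta> + 1), ..., \<tau> \<theta>\<close>, and the factors of
  \<open>W_block\<close> pass through them in this order. Taking the adjoint reverses the product
  and puts \<open>C K\<^sup>-\<^sup>1\<close> in front, as in \<open>left_state\<close>; the latter
  counts from the last variable, which explains \<open>\<eta> - e\<close> and
  \<open>\<theta> - e\<close>.\<close>

lemma W_block_word:
  assumes S: "is_bilinear_system S" and \<eta>: "\<eta> \<ge> 1" "\<eta> \<le> \<theta>"
    and \<tau>: "\<And>i. i \<in> {1..\<theta>} \<Longrightarrow> analytic_point S (\<tau> i)" and x: "\<And>i. i \<in> {1..<\<eta>} \<Longrightarrow> x i < indim S"
  shows "W_block S \<theta> \<tau> \<nu> \<eta> i \<in> carrier_mat (statedim S) (indim S ^ (\<eta> - 1) * outdim S) \<and>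
    block_col (outdim S) (word_index (indim S) x (\<eta> - 1)) (W_block S \<theta> \<tau> \<nu> \<eta> i) =
      mat_adjoint (mat_deriv i (\<lambda>s. left_state S (\<lambda>e. x (\<eta> - e)) (\<lambda>e. \<nu> (\<theta> - e)) (\<lambda>e. \<tau> (\<theta> - e)) (\<eta> - 1) s * Kinv S s)
        (\<tau> (\<theta> - \<eta> + 1)))"
proof (cases "\<eta> = 1")
  case True
  have z: "analytic_point S (\<tau> \<theta>)" using \<tau> \<eta> by auto
  have "KhCh_deriv S i (\<tau> \<theta>) \<in> carrier_mat (statedim S) (outdim S)"
    unfolding KhCh_deriv_def
    by (rule mat_adjoint_carrier[OF mat_deriv_carrier[OF analytic_mat_at_mult[OF analytic_mat_at_system(1,2)[OF S z]]]])
  moreover have "\<theta> - \<eta> + 1 = \<theta>" using True \<eta> by simp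
  ultimately show ?thesis
    using True by (simp add: W_block_def block_col_0) (simp add: KhCh_deriv_def)
next
  case False
  define p where "p = \<eta> - 2"
  have \<eta>p: "\<eta> = Suc (Suc p)" using False \<eta> by (simp add: p_def)
  define n m where "n = statedim S" and "m = indim S"
  \<comment> \<open>The free order \<open>i\<close> and the prescribed orders are put into one
    function, so that the separate first factor of \<open>W_block\<close> becomes the factor with
    index 1 of a uniform product.\<close>
  define o' where "o' = (\<lambda>b. if b = 1 then i else \<nu> (\<theta> - \<eta> + b))"
  define t where "t = (\<lambda>b. \<tau> (\<theta> - \<eta> + b))"
  define A where "A = (\<lambda>b. kron (1\<^sub>m (m ^ (b - 1))) (KhNh_deriv S (o' b) (t b)))"
  define NK where "NK = (\<lambda>b. mat_deriv (o' b) (\<lambda>s. Nmat S (Suc (x b)) s * Kinv S s) (t b))"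
  define F where "F = (\<lambda>b. mat_adjoint (NK b))"
  define LF where "LF = left_state S (\<lambda>e. x (\<eta> - e)) (\<lambda>e. \<nu> (\<theta> - e)) (\<lambda>e. \<tau> (\<theta> - e))"
  define LC where "LC = (\<lambda>e. mat_deriv (\<nu> (\<theta> - e)) (\<lambda>s. LF e s * Kinv S s) (\<tau> (\<theta> - e)))"
  have t: "analytic_point S (t b)" if "b \<in> {1..\<eta>}" for b
    unfolding t_def by (rule \<tau>) (use that \<eta> in auto)
  have xb: "x b < m" if "b \<in> {1..Suc p}" for b
    using that x[of b] by (auto simp: \<eta>p m_def)
  have NK: "NK b \<in> carrier_mat n n" if "b \<in> {1..Suc p}" for b
    unfolding NK_def n_def
    using t[of b] xb[OF that] that
    by (intro mat_deriv_carrier[OF analytic_mat_at_mult[OF analytic_mat_at_Nmat[OF S] analytic_mat_at_system(2)[OF S]]]) (auto simp: \<eta>p m_def)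
  have F: "F b \<in> carrier_mat n n" if "b \<in> {1..Suc p}" for b
    unfolding F_def by (rule mat_adjoint_carrier[OF NK[OF that]])
  have KN: "KhNh_deriv S j (t b) \<in> carrier_mat n (m * n)" if "b \<in> {1..\<eta>}" for b j
    unfolding n_def m_def by (rule KhNh_deriv_carrier[OF S t[OF that]])
  have A: "A b \<in> carrier_mat (m ^ (b - 1) * n) (m ^ b * n)" if "b \<in> {1..Suc p}" for b
  proof -
    have b': "b \<in> {1..\<eta>}" "m ^ b = m ^ (b - 1) * m" using that by (auto simp: \<eta>p power_Suc2[symmetric])
    show ?thesis unfolding A_def b'(2) using kron_one_carrier[OF KN[OF b'(1)]] by (simp add: mult.assoc)
  qed
  have OP: "ordered_prod n A 1 (Suc p) \<in> carrier_mat n (m ^ Suc p * n) \<and>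
    block_col n (word_index m x (Suc p)) (ordered_prod n A 1 (Suc p)) = ordered_prod n F 1 (Suc p)"
  proof (rule block_col_ordered_prod)
    fix b assume b: "b \<in> {1..Suc p}"
    then have b': "b \<in> {1..\<eta>}" by (auto simp: \<eta>p)
    show "x b < m" using xb b .
    show "A b \<in> carrier_mat (m ^ (b - 1) * n) (m ^ b * n)" by (rule A[OF b])
    fix X :: "complex mat" and w assume X: "X \<in> carrier_mat n (m ^ (b - 1) * n)" and w: "w < m ^ (b - 1)"
    have XA: "X * A b \<in> carrier_mat n (m ^ b * n)"
      using X A[OF b] by simp
    have KN': "KhNh_deriv S (o' b) (t b) \<in> carrier_mat n (n * m)"
      using KN[OF b'] by (simp add: mult.commute)
    have "block_col n (w * m + x b) (X * A b) = block_col n (x b) (block_col (n * m) w (X * A b))"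
      using block_col_block_col[OF XA xb[OF b]] by simp
    also have "block_col (n * m) w (X * A b) = block_col n w X * KhNh_deriv S (o' b) (t b)"
      unfolding A_def by (rule block_col_mult_kron[OF X KN' w])
    also have "block_col n (x b) \<dots> = block_col n w X * block_col n (x b) (KhNh_deriv S (o' b) (t b))"
      by (rule block_col_mult[OF block_col_carrier[OF X] KN[OF b'] xb[OF b]])
    also have "block_col n (x b) (KhNh_deriv S (o' b) (t b)) = F b"
      unfolding n_def F_def NK_def using block_col_KhNh_deriv[OF S t[OF b']] xb[OF b] by (simp add: m_def)
    finally show "block_col n (w * m + x b) (X * A b) = block_col n w X * F b" .
  qed
  \<comment> \<open>The product in \<open>W_block\<close> starts at index 2 with an identity of size
    \<open>m * n\<close>; putting \<open>A 1\<close> in front gives the uniform product.\<close>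
  have split: "ordered_prod n A 1 (Suc b) = A 1 * ordered_prod (m * n) A 2 (Suc b) \<and>
      ordered_prod (m * n) A 2 (Suc b) \<in> carrier_mat (m * n) (m ^ Suc b * n)" if "b \<le> p" for b
    using that
  proof (induction b)
    case 0
    then show ?case
      using A[of 1] by (simp add: ordered_prod_Suc ordered_prod_empty)
  next
    case (Suc b)
    have A1: "A 1 \<in> carrier_mat n (m * n)" using A[of 1] by simp
    have A2: "A (Suc (Suc b)) \<in> carrier_mat (m ^ Suc b * n) (m ^ Suc (Suc b) * n)"
      using A[of "Suc (Suc b)"] Suc.prems by simp
    from Suc have IH: "ordered_prod n A 1 (Suc b) = A 1 * ordered_prod (m * n) A 2 (Suc b)"
      and c: "ordered_prod (m * n) A 2 (Suc b) \<in> carrier_mat (m * n) (m ^ Suc b * n)" by auto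
    have "ordered_prod n A 1 (Suc (Suc b)) = A 1 * ordered_prod (m * n) A 2 (Suc b) * A (Suc (Suc b))"
      unfolding IH[symmetric] by (rule ordered_prod_Suc) simp
    also have "\<dots> = A 1 * (ordered_prod (m * n) A 2 (Suc b) * A (Suc (Suc b)))"
      by (rule assoc_mult_mat[OF A1 c A2])
    also have "ordered_prod (m * n) A 2 (Suc b) * A (Suc (Suc b)) = ordered_prod (m * n) A 2 (Suc (Suc b))"
      by (rule ordered_prod_Suc[symmetric]) simp
    finally show ?case
      using mult_carrier_mat[OF c A2] by (simp add: ordered_prod_Suc)
  qed
  have A1: "A 1 = KhNh_deriv S i (\<tau> (\<theta> - \<eta> + 1))"
    using kron_one_one[OF KN[of 1 i]] by (simp add: A_def o'_def t_def \<eta>p)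
  have "ordered_prod (m * n) (\<lambda>i. kron (1\<^sub>m (m ^ (i - 1))) (KhNh_deriv S (\<nu> (\<theta> - \<eta> + i)) (\<tau> (\<theta> - \<eta> + i)))) 2 (Suc p) =
    ordered_prod (m * n) A 2 (Suc p)"
    by (rule ordered_prod_cong) (auto simp: A_def o'_def t_def)
  then have W: "W_block S \<theta> \<tau> \<nu> \<eta> i = ordered_prod n A 1 (Suc p) * kron (1\<^sub>m (m ^ Suc p)) (KhCh_deriv S (\<nu> \<theta>) (\<tau> \<theta>))"
    using False A1 split[of p] by (simp add: W_block_def \<eta>p n_def m_def)
  have z: "analytic_point S (\<tau> \<theta>)" using \<tau> \<eta> by auto
  have CK: "LC 0 \<in> carrier_mat (outdim S) n"
    unfolding LC_def LF_def n_def using analytic_mat_at_mult[OF analytic_mat_at_system(1,2)[OF S z]] by (simp add: mat_deriv_carrier)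
  have KC: "KhCh_deriv S (\<nu> \<theta>) (\<tau> \<theta>) = mat_adjoint (LC 0)"
    by (simp add: KhCh_deriv_def LC_def LF_def)
  note KC' = mat_adjoint_carrier[OF CK]
  have LF: "analytic_mat_at (outdim S) n (LF e) z" if "e \<le> Suc p" "analytic_point S z" for e z
    unfolding LF_def n_def
  proof (rule analytic_mat_at_left_state[OF S that(2)])
    show "analytic_point S (\<tau> (\<theta> - e'))" if "e' < e" for e'
      using that \<open>e \<le> Suc p\<close> \<eta> by (intro \<tau>) (auto simp: \<eta>p)
    show "x (\<eta> - e') < indim S" if "e' \<in> {1..e}" for e'
      using that \<open>e \<le> Suc p\<close> by (intro x) (auto simp: \<eta>p)
  qed
  have LC: "LC e \<in> carrier_mat (outdim S) n" if "e \<le> Suc p" for e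
    unfolding LC_def n_def
    by (intro mat_deriv_carrier[OF analytic_mat_at_mult[OF LF[OF that, unfolded n_def] analytic_mat_at_system(2)[OF S]]] \<tau>)
       (use that \<eta> in \<open>auto simp: \<eta>p\<close>)
  have LC_Suc: "mat_deriv j (\<lambda>s. LF (Suc e) s * Kinv S s) z =
      LC e * mat_deriv j (\<lambda>s. Nmat S (Suc (x (\<eta> - Suc e))) s * Kinv S s) z"
    if "e \<le> p" "analytic_point S z" for j e z
    using mat_deriv_const_assoc[OF LC[unfolded n_def] analytic_mat_at_Nmat[OF S that(2)] analytic_mat_at_system(2)[OF S that(2)], of e "x (\<eta> - Suc e)" j]
      that(1) xb[of "\<eta> - Suc e"] by (simp add: LF_def LC_def \<eta>p m_def)
  \<comment> \<open>The derivative is peeled from its right end: each step moves one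
    \<open>N K\<^sup>-\<^sup>1\<close> from the constant \<open>LC\<close> into the adjoint, until
    for \<open>b = p\<close> only \<open>LC 0\<close>, the derivative of
    \<open>C K\<^sup>-\<^sup>1\<close>, is left.\<close>
  have adj: "mat_deriv i (\<lambda>s. LF (Suc p) s * Kinv S s) (t 1) = LC (p - b) * mat_adjoint (ordered_prod n F 1 (Suc b))"
    if "b \<le> p" for b
    using that
  proof (induction b)
    case 0
    have "ordered_prod n F 1 (Suc 0) = F 1"
      using F[of 1] by (simp add: ordered_prod_Suc ordered_prod_empty)
    then show ?case
      using LC_Suc[of p "t 1" i] t[of 1] NK[of 1] mat_adjoint_adjoint
      by (simp add: F_def NK_def o'_def \<eta>p)
  next
    case (Suc b)
    define e where "e = p - Suc b"
    have e: "p - b = Suc e" "\<eta> - Suc e = Suc (Suc b)" "\<theta> - Suc e = \<theta> - \<eta> + Suc (Suc b)"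
      using Suc.prems \<eta> by (auto simp: e_def \<eta>p)
    have b2: "Suc (Suc b) \<in> {1..Suc p}" using Suc.prems by auto
    have t2: "analytic_point S (t (Suc (Suc b)))" using b2 by (intro t) (auto simp: \<eta>p)
    have OPc: "ordered_prod n F 1 (Suc b) \<in> carrier_mat n n"
      by (rule ordered_prod_square_carrier) (use F Suc.prems in auto)
    have "LC (Suc e) = LC e * NK (Suc (Suc b))"
    proof -
      have "NK (Suc (Suc b)) = mat_deriv (\<nu> (\<theta> - Suc e)) (\<lambda>s. Nmat S (Suc (x (\<eta> - Suc e))) s * Kinv S s) (t (Suc (Suc b)))"
        unfolding NK_def e(2) by (simp add: o'_def e(3))
      moreover have "LC (Suc e) = mat_deriv (\<nu> (\<theta> - Suc e)) (\<lambda>s. LF (Suc e) s * Kinv S s) (t (Suc (Suc b)))"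
        unfolding LC_def t_def e(3) ..
      moreover have "e \<le> p" by (simp add: e_def)
      ultimately show ?thesis using LC_Suc[OF _ t2] by simp
    qed
    then have "mat_deriv i (\<lambda>s. LF (Suc p) s * Kinv S s) (t 1) =
        LC e * NK (Suc (Suc b)) * mat_adjoint (ordered_prod n F 1 (Suc b))"
      using Suc e by simp
    also have "\<dots> = LC e * (NK (Suc (Suc b)) * mat_adjoint (ordered_prod n F 1 (Suc b)))"
      by (rule assoc_mult_mat[OF LC NK[OF b2] mat_adjoint_carrier[OF OPc]]) (simp add: e_def)
    also have "NK (Suc (Suc b)) * mat_adjoint (ordered_prod n F 1 (Suc b)) =
        mat_adjoint (ordered_prod n F 1 (Suc b) * F (Suc (Suc b)))"
      using mat_adjoint_mult[OF OPc F[OF b2]] mat_adjoint_adjoint[OF NK[OF b2]] by (simp add: F_def)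
    also have "ordered_prod n F 1 (Suc b) * F (Suc (Suc b)) = ordered_prod n F 1 (Suc (Suc b))"
      by (rule ordered_prod_Suc[symmetric]) simp
    finally show ?case by (simp add: e_def)
  qed
  have OPc: "ordered_prod n F 1 (Suc p) \<in> carrier_mat n n"
    by (rule ordered_prod_square_carrier) (use F in auto)
  have cx: "word_index m x (Suc p) < m ^ Suc p" by (rule word_index_less) (use xb in auto)
  have "block_col (outdim S) (word_index m x (Suc p)) (W_block S \<theta> \<tau> \<nu> \<eta> i) = ordered_prod n F 1 (Suc p) * mat_adjoint (LC 0)"
    unfolding W KC using block_col_mult_kron[OF conjunct1[OF OP] KC' cx] OP by simp
  also have "\<dots> = mat_adjoint (mat_deriv i (\<lambda>s. LF (Suc p) s * Kinv S s) (t 1))"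
    unfolding adj[OF le_refl] diff_self_eq_0
    using mat_adjoint_mult[OF CK mat_adjoint_carrier[OF OPc]] mat_adjoint_adjoint[OF OPc] by simp
  finally have "block_col (outdim S) (word_index m x (Suc p)) (W_block S \<theta> \<tau> \<nu> \<eta> i) =
     mat_adjoint (mat_deriv i (\<lambda>s. LF (Suc p) s * Kinv S s) (t 1))" .
  moreover have "W_block S \<theta> \<tau> \<nu> \<eta> i \<in> carrier_mat n (m ^ Suc p * outdim S)"
    unfolding W KC using OP by (intro mult_carrier_mat[OF _ kron_one_carrier[OF KC']]) blast
  moreover have "\<eta> - 1 = Suc p" by (simp add: \<eta>p)
  ultimately show ?thesis unfolding n_def m_def LF_def t_def by metis
qed

section \<open>Interpolation\<close>

text \<open>Every column of a block lies in the column space of \<open>V\<close>; the coefficient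
  vectors, chosen column by column, form \<open>Y\<close>. All blocks must have \<open>n\<close>
  rows, for only then are the columns of the concatenation those of the blocks.\<close>

lemma col_space_block:
  assumes Bs: "\<And>X. X \<in> set Bs \<Longrightarrow> \<exists>q. X \<in> carrier_mat n q"
    and sub: "vec_space.col_space n (hconcat n Bs) \<subseteq> vec_space.col_space n V"
    and V: "V \<in> carrier_mat n r" and X: "X \<in> set Bs" "X \<in> carrier_mat n q"
  shows "\<exists>Y \<in> carrier_mat r q. X = V * Y"
proof -
  interpret vec_space "TYPE(complex)" n .
  let ?cs = "concat (map cols Bs)"
  have cs: "set ?cs \<subseteq> carrier_vec n"
  proof -
    have "set (cols X) \<subseteq> carrier_vec n" if "X \<in> set Bs" for X
      using Bs[OF that] cols_dim[of X] by (metis carrier_matD(1))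
    then show ?thesis by auto
  qed
  have "\<exists>y \<in> carrier_vec r. V *\<^sub>v y = col X c" if c: "c < q" for c
  proof -
    have "col X c \<in> set (cols X)" using c X(2) by (auto simp: cols_def)
    then have mem: "col X c \<in> set ?cs" using X(1) by auto
    have "cols (hconcat n Bs) = ?cs"
      unfolding hconcat_def by (rule cols_mat_of_cols[OF cs])
    then have "col X c \<in> vec_space.col_space n (hconcat n Bs)"
      unfolding col_space_def using mem span_mem[of "set ?cs" "col X c"] cs by simp
    then show ?thesis
      using sub vec_space.col_space_eq[OF V] V by auto
  qed
  then obtain y where y: "\<And>c. c < q \<Longrightarrow> y c \<in> carrier_vec r \<and> V *\<^sub>v y c = col X c"
    by metis
  define Y where "Y = mat_of_cols r (map y [0..<q])"
  have Y: "Y \<in> carrier_mat r q" unfolding Y_def using mat_of_cols_carrier(1)[of r "map y [0..<q]"] by simp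
  have "X = V * Y"
  proof (rule eq_matI)
    fix a c assume "a < dim_row (V * Y)" "c < dim_col (V * Y)"
    then have ac: "a < n" "c < q" using V Y by auto
    have "col Y c = y c" using y ac by (simp add: Y_def)
    then have "(V * Y) $$ (a, c) = (V *\<^sub>v y c) $ a" using ac V Y by simp
    then show "X $$ (a, c) = (V * Y) $$ (a, c)" using y ac X(2) by simp
  qed (use X V Y in auto)
  then show ?thesis using Y by blast
qed

lemma block_col_mult_image:
  assumes "X = V * Y" "V \<in> carrier_mat n r" "Y \<in> carrier_mat r (N * q)" "w < N"
  shows "\<exists>Z \<in> carrier_mat r q. block_col q w X = V * Z"
  using block_col_mult[OF assms(2,3,4)] block_col_carrier[OF assms(3)] unfolding assms(1) by auto

lemma V_block_image:
  assumes S: "is_bilinear_system S" and V: "V \<in> carrier_mat (statedim S) r"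
    and \<sigma>: "\<And>i. i \<in> {1..k} \<Longrightarrow> analytic_point S (\<sigma> i)"
    and sub: "vec_space.col_space (statedim S) (V_blocks S k \<sigma> l) \<subseteq> vec_space.col_space (statedim S) V"
    and q: "q \<in> {1..k}" and j: "j \<le> l q" and x: "\<And>i. i \<in> {1..<q} \<Longrightarrow> x i < indim S"
  shows "\<exists>Y \<in> carrier_mat r (indim S). mat_deriv j (\<lambda>s. Kinv S s * right_state S x l \<sigma> (q - 1) s) (\<sigma> q) = V * Y"
proof -
  note w = V_block_word[of S q \<sigma> x l j, OF S _ \<sigma> x]
  have w: "V_block S \<sigma> l q j \<in> carrier_mat (statedim S) (indim S ^ (q - 1) * indim S)"
    "block_col (indim S) (word_index (indim S) (\<lambda>i. x (q - i)) (q - 1)) (V_block S \<sigma> l q j) =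
      mat_deriv j (\<lambda>s. Kinv S s * right_state S x l \<sigma> (q - 1) s) (\<sigma> q)"
    using w q by auto
  have "\<exists>Y \<in> carrier_mat r (indim S ^ (q - 1) * indim S). V_block S \<sigma> l q j = V * Y"
  proof (rule col_space_block[OF _ sub[unfolded V_blocks_def] V _ w(1)])
    fix X assume "X \<in> set [V_block S \<sigma> l q j. q \<leftarrow> [1..<Suc k], j \<leftarrow> [0..<Suc (l q)]]"
    then obtain q' j' where X: "X = V_block S \<sigma> l q' j'" and q': "q' \<in> {1..k}" by auto
    show "\<exists>c. X \<in> carrier_mat (statedim S) c"
    \<comment> \<open>If \<open>indim S = 0\<close> and \<open>q' > 1\<close>, there is no word to
      which \<open>V_block_word\<close> could be applied. The number of rows is then read off from
      the first factor.\<close>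
    proof (cases "q' = 1 \<or> indim S > 0")
      case True
      then have "V_block S \<sigma> l q' j' \<in> carrier_mat (statedim S) (indim S ^ (q' - 1) * indim S)"
        using V_block_word[of S q' \<sigma> "\<lambda>_. 0" l j', OF S _ \<sigma>] q' by auto
      then show ?thesis unfolding X by blast
    next
      case False
      have "analytic_point S (\<sigma> q')" using \<sigma> q' by auto
      from mat_deriv_carrier[OF analytic_mat_at_system(2)[OF S this], of j'] False
      have "dim_row (V_block S \<sigma> l q' j') = statedim S"
        unfolding V_block_def by auto
      then show ?thesis unfolding X by (metis carrier_matI)
    qed
  next
    show "V_block S \<sigma> l q j \<in> set [V_block S \<sigma> l q j. q \<leftarrow> [1..<Suc k], j \<leftarrow> [0..<Suc (l q)]]"
      using q j by (simp del: upt_Suc) (intro bexI[of _ q] imageI, auto)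
  qed
  then obtain Y where "V_block S \<sigma> l q j = V * Y" "Y \<in> carrier_mat r (indim S ^ (q - 1) * indim S)"
    by blast
  moreover have "word_index (indim S) (\<lambda>i. x (q - i)) (q - 1) < indim S ^ (q - 1)"
    by (rule word_index_less) (use x in auto)
  ultimately show ?thesis
    unfolding w(2)[symmetric] by (intro block_col_mult_image[OF _ V])
qed

text \<open>The span condition speaks of adjoints: with \<open>D\<close> the derivative in the claim
  it gives \<open>D\<^sup>H = W * Z\<close>, hence \<open>D = Z\<^sup>H * W\<^sup>H\<close>.\<close>

lemma W_block_image:
  assumes S: "is_bilinear_system S" and W: "W \<in> carrier_mat (statedim S) r"
    and \<tau>: "\<And>i. i \<in> {1..\<theta>} \<Longrightarrow> analytic_point S (\<tau> i)"
    and sub: "vec_space.col_space (statedim S) (W_blocks S \<theta> \<tau> \<nu>) \<subseteq> vec_space.col_space (statedim S) W"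
    and e: "e < \<theta>" and i: "i \<le> \<nu> (\<theta> - e)" and y: "\<And>i. i \<in> {1..e} \<Longrightarrow> y i < indim S"
  shows "\<exists>Y \<in> carrier_mat (outdim S) r.
    mat_deriv i (\<lambda>s. left_state S y (\<lambda>e. \<nu> (\<theta> - e)) (\<lambda>e. \<tau> (\<theta> - e)) e s * Kinv S s) (\<tau> (\<theta> - e)) = Y * mat_adjoint W"
proof -
  define \<eta> where "\<eta> = Suc e"
  define x where "x = (\<lambda>b. y (\<eta> - b))"
  define D where "D = mat_deriv i (\<lambda>s. left_state S y (\<lambda>e. \<nu> (\<theta> - e)) (\<lambda>e. \<tau> (\<theta> - e)) e s * Kinv S s) (\<tau> (\<theta> - e))"
  have \<eta>: "1 \<le> \<eta>" "\<eta> \<le> \<theta>" "\<theta> - \<eta> + 1 = \<theta> - e" "\<eta> - 1 = e" using e by (auto simp: \<eta>_def)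
  have x: "x b < indim S" if "b \<in> {1..<\<eta>}" for b
    unfolding x_def using that by (intro y) (auto simp: \<eta>_def)
  have lf: "left_state S (\<lambda>e. x (\<eta> - e)) (\<lambda>e. \<nu> (\<theta> - e)) (\<lambda>e. \<tau> (\<theta> - e)) e = left_state S y (\<lambda>e. \<nu> (\<theta> - e)) (\<lambda>e. \<tau> (\<theta> - e)) e"
    by (rule left_state_cong) (auto simp: x_def \<eta>_def)
  have w: "W_block S \<theta> \<tau> \<nu> \<eta> i \<in> carrier_mat (statedim S) (indim S ^ e * outdim S)"
    "block_col (outdim S) (word_index (indim S) x e) (W_block S \<theta> \<tau> \<nu> \<eta> i) = mat_adjoint D"
    using W_block_word[of S \<eta> \<theta> \<tau> x \<nu> i, OF S \<eta>(1,2) \<tau> x] unfolding \<eta>(3,4) lf D_def by auto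
  have "\<exists>Y \<in> carrier_mat r (indim S ^ e * outdim S). W_block S \<theta> \<tau> \<nu> \<eta> i = W * Y"
  proof (rule col_space_block[OF _ sub[unfolded W_blocks_def] W _ w(1)])
    fix X assume "X \<in> set [W_block S \<theta> \<tau> \<nu> \<eta> i. \<eta> \<leftarrow> [1..<Suc \<theta>], i \<leftarrow> [0..<Suc (\<nu> (\<theta> - \<eta> + 1))]]"
    then obtain \<eta>' i' where X: "X = W_block S \<theta> \<tau> \<nu> \<eta>' i'" and \<eta>': "\<eta>' \<in> {1..\<theta>}" by auto
    show "\<exists>c. X \<in> carrier_mat (statedim S) c"
    proof (cases "\<eta>' = 1 \<or> indim S > 0")
      case True
      then have "W_block S \<theta> \<tau> \<nu> \<eta>' i' \<in> carrier_mat (statedim S) (indim S ^ (\<eta>' - 1) * outdim S)"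
        using W_block_word[of S \<eta>' \<theta> \<tau> "\<lambda>_. 0" \<nu> i', OF S _ _ \<tau>] \<eta>' by auto
      then show ?thesis unfolding X by blast
    next
      case False
      have "analytic_point S (\<tau> (\<theta> - \<eta>' + 1))" by (rule \<tau>) (use \<eta>' in auto)
      from KhNh_deriv_carrier[OF S this, of i'] False
      have "dim_row (W_block S \<theta> \<tau> \<nu> \<eta>' i') = statedim S"
        unfolding W_block_def by auto
      then show ?thesis unfolding X by (metis carrier_matI)
    qed
  next
    show "W_block S \<theta> \<tau> \<nu> \<eta> i \<in> set [W_block S \<theta> \<tau> \<nu> \<eta> i. \<eta> \<leftarrow> [1..<Suc \<theta>], i \<leftarrow> [0..<Suc (\<nu> (\<theta> - \<eta> + 1))]]"
      using \<eta> i by (simp del: upt_Suc One_nat_def add_Suc_right add_0_right) (intro bexI[of _ \<eta>] imageI, auto)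
  qed
  moreover have "word_index (indim S) x e < indim S ^ e"
    by (rule word_index_less) (use x in \<open>auto simp: \<eta>_def\<close>)
  ultimately obtain Z where Z: "Z \<in> carrier_mat r (outdim S)" "mat_adjoint D = W * Z"
    using block_col_mult_image[OF _ W] w(2) by metis
  have ze: "analytic_point S (\<tau> (\<theta> - e))" by (rule \<tau>) (use e in auto)
  have "analytic_mat_at (outdim S) (statedim S) (left_state S y (\<lambda>e. \<nu> (\<theta> - e)) (\<lambda>e. \<tau> (\<theta> - e)) e) (\<tau> (\<theta> - e))"
    by (rule analytic_mat_at_left_state[OF S ze]) (use \<tau> e y in auto)
  then have "D \<in> carrier_mat (outdim S) (statedim S)"
    unfolding D_def by (rule mat_deriv_carrier[OF analytic_mat_at_mult[OF _ analytic_mat_at_system(2)[OF S ze]]])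
  then have "D = mat_adjoint (W * Z)"
    using mat_adjoint_adjoint Z(2) by metis
  also have "\<dots> = mat_adjoint Z * mat_adjoint W"
    by (rule mat_adjoint_mult[OF W Z(1)])
  finally show ?thesis using mat_adjoint_carrier[OF Z(1)] unfolding D_def by blast
qed

text \<open>The instance \<open>M = W\<^sup>H N\<close> of \<open>right_projection\<close>: then
  \<open>M V\<close> is the reduced \<open>N\<close>, and the constant \<open>W\<^sup>H\<close> can
  be taken out on the other side.\<close>

lemma mat_deriv_reduced_N:
  assumes S: "is_bilinear_system S" and W: "W \<in> carrier_mat (statedim S) r"
    and V: "V \<in> carrier_mat (statedim S) r" and z: "analytic_point S z"
    and rz: "analytic_point (reduced_system W V S) z" and c: "c < indim S"
    and Q: "analytic_mat_at (statedim S) q Q z"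
    and im: "\<And>i. i \<le> j \<Longrightarrow> \<exists>Y \<in> carrier_mat r q. mat_deriv i (\<lambda>s. Kinv S s * Q s) z = V * Y"
  shows "mat_deriv j (\<lambda>s. Nmat (reduced_system W V S) (Suc c) s *
      (Kinv (reduced_system W V S) s * (mat_adjoint W * Q s))) z =
    mat_adjoint W * mat_deriv j (\<lambda>s. Nmat S (Suc c) s * (Kinv S s * Q s)) z"
proof -
  note E = mat_adjoint_carrier[OF W]
  note N = analytic_mat_at_Nmat[OF S z c]
  show ?thesis
    using right_projection[OF S W V z rz analytic_mat_at_mult[OF analytic_mat_at_const[OF E] N] Q im]
      mat_deriv_const_assoc[OF E N analytic_mat_at_mult[OF analytic_mat_at_system(2)[OF S z] Q], of j]
    by simp
qed

text \<open>Passing from one state to the next replaces one \<open>K\<^sup>-\<^sup>1\<close> by its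
  reduced counterpart. Leibniz's rule at the \<open>i\<close>-th variable involves all orders up to
  \<open>l i\<close>, which is what \<open>im\<close> provides.\<close>

lemma right_state_reduced:
  assumes S: "is_bilinear_system S" and W: "W \<in> carrier_mat (statedim S) r"
    and V: "V \<in> carrier_mat (statedim S) r"
    and \<sigma>: "\<And>i. i \<in> {1..q} \<Longrightarrow> analytic_point S (\<sigma> i)"
    and r\<sigma>: "\<And>i. i \<in> {1..q} \<Longrightarrow> analytic_point (reduced_system W V S) (\<sigma> i)"
    and x: "\<And>i. i \<in> {1..q} \<Longrightarrow> x i < indim S"
    and im: "\<And>i j. i \<in> {1..q} \<Longrightarrow> j \<le> l i \<Longrightarrow> \<exists>Y \<in> carrier_mat r (indim S).
      mat_deriv j (\<lambda>s. Kinv S s * right_state S x l \<sigma> (i - 1) s) (\<sigma> i) = V * Y"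
  shows "right_state (reduced_system W V S) x l \<sigma> q s = mat_adjoint W * right_state S x l \<sigma> q s"
  using \<sigma> r\<sigma> x im
proof (induction q arbitrary: s)
  case 0
  then show ?case by simp
next
  case (Suc q)
  have IH: "right_state (reduced_system W V S) x l \<sigma> q s = mat_adjoint W * right_state S x l \<sigma> q s" for s
    by (rule Suc.IH) (use Suc.prems in auto)
  have z: "analytic_point S (\<sigma> (Suc q))" "analytic_point (reduced_system W V S) (\<sigma> (Suc q))"
    "x (Suc q) < indim S" using Suc.prems by auto
  have "analytic_mat_at (statedim S) (indim S) (right_state S x l \<sigma> q) (\<sigma> (Suc q))"
    by (rule analytic_mat_at_right_state[OF S z(1)]) (use Suc.prems in auto)
  from mat_deriv_reduced_N[OF S W V z this, of "l (Suc q)"] Suc.prems(4)[of "Suc q"] show ?case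
    by (simp add: IH del: reduced_simps)
qed

text \<open>The instance \<open>M = 1\<close> of \<open>left_projection\<close>. The trailing
  \<open>W\<^sup>H\<close> survives as a right factor, ready to meet the next \<open>N V\<close> or,
  at the cut, the right part of the chain.\<close>

lemma mat_deriv_left_state_reduced:
  assumes S: "is_bilinear_system S" and W: "W \<in> carrier_mat (statedim S) r"
    and V: "V \<in> carrier_mat (statedim S) r" and z: "analytic_point S z"
    and rz: "analytic_point (reduced_system W V S) z"
    and P: "analytic_mat_at p (statedim S) P z"
    and im: "\<And>i. i \<le> j \<Longrightarrow> \<exists>Y \<in> carrier_mat p r. mat_deriv i (\<lambda>s. P s * Kinv S s) z = Y * mat_adjoint W"
  shows "mat_deriv j (\<lambda>s. P s * Kinv S s) z =
    mat_deriv j (\<lambda>s. P s * V * Kinv (reduced_system W V S) s) z * mat_adjoint W"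
proof -
  note E = mat_adjoint_carrier[OF W]
  have Kr: "analytic_mat_at r r (Kinv (reduced_system W V S)) z"
    using analytic_mat_at_system(2)[OF is_bilinear_system_reduced[OF S W V] rz] V by simp
  note K = analytic_mat_at_system(2)[OF S z]
  have one: "analytic_mat_at (statedim S) (statedim S) (\<lambda>_. 1\<^sub>m (statedim S)) z" by simp
  have ev: "\<forall>\<^sub>F s in nhds z. P s * Kinv S s \<in> carrier_mat p (statedim S)"
    using analytic_mat_at_mult[OF P K] by (simp add: analytic_mat_at_def)
  have "mat_deriv j (\<lambda>s. P s * Kinv S s) z = mat_deriv j (\<lambda>s. P s * Kinv S s * 1\<^sub>m (statedim S)) z"
    by (rule mat_deriv_cong) (use ev in \<open>auto elim!: eventually_mono simp: right_mult_one_mat\<close>)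
  also have "\<dots> = mat_deriv j (\<lambda>s. P s * V * Kinv (reduced_system W V S) s * (mat_adjoint W * 1\<^sub>m (statedim S))) z"
    by (rule left_projection[OF S W V z rz P one im])
  also have "mat_adjoint W * 1\<^sub>m (statedim S) = mat_adjoint W"
    by (rule right_mult_one_mat[OF E])
  also have "mat_deriv j (\<lambda>s. P s * V * Kinv (reduced_system W V S) s * mat_adjoint W) z =
    mat_deriv j (\<lambda>s. P s * V * Kinv (reduced_system W V S) s) z * mat_adjoint W"
    by (rule mat_deriv_mult_right[OF analytic_mat_at_mult[OF analytic_mat_at_mult[OF P analytic_mat_at_const[OF V]] Kr] E])
  finally show ?thesis .
qed

lemma left_state_reduced:
  assumes S: "is_bilinear_system S" and W: "W \<in> carrier_mat (statedim S) r"
    and V: "V \<in> carrier_mat (statedim S) r"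
    and \<tau>: "\<And>i. i < e \<Longrightarrow> analytic_point S (\<tau> i)"
    and r\<tau>: "\<And>i. i < e \<Longrightarrow> analytic_point (reduced_system W V S) (\<tau> i)"
    and y: "\<And>i. i \<in> {1..e} \<Longrightarrow> y i < indim S"
    and im: "\<And>i j. i < e \<Longrightarrow> j \<le> \<nu> i \<Longrightarrow> \<exists>Y \<in> carrier_mat (outdim S) r.
      mat_deriv j (\<lambda>s. left_state S y \<nu> \<tau> i s * Kinv S s) (\<tau> i) = Y * mat_adjoint W"
  shows "left_state (reduced_system W V S) y \<nu> \<tau> e s = left_state S y \<nu> \<tau> e s * V"
  using \<tau> r\<tau> y im
proof (induction e arbitrary: s)
  case 0
  then show ?case by simp
next
  case (Suc e)
  define R where "R = reduced_system W V S"
  have IH: "left_state R y \<nu> \<tau> e s = left_state S y \<nu> \<tau> e s * V" for s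
    unfolding R_def by (rule Suc.IH) (use Suc.prems in auto)
  note E = mat_adjoint_carrier[OF W]
  have z: "analytic_point S (\<tau> e)" "analytic_point R (\<tau> e)" using Suc.prems by (auto simp: R_def)
  have P: "analytic_mat_at (outdim S) (statedim S) (left_state S y \<nu> \<tau> e) (\<tau> e)"
    by (rule analytic_mat_at_left_state[OF S z(1)]) (use Suc.prems in auto)
  have Kr: "analytic_mat_at r r (Kinv R) (\<tau> e)"
    using analytic_mat_at_system(2)[OF is_bilinear_system_reduced[OF S W V]] z V by (simp add: R_def)
  define A where "A = mat_deriv (\<nu> e) (\<lambda>s. left_state S y \<nu> \<tau> e s * V * Kinv R s) (\<tau> e)"
  have A: "A \<in> carrier_mat (outdim S) r"
    unfolding A_def by (rule mat_deriv_carrier[OF analytic_mat_at_mult[OF analytic_mat_at_mult[OF P analytic_mat_at_const[OF V]] Kr]])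
  have AE: "mat_deriv (\<nu> e) (\<lambda>s. left_state S y \<nu> \<tau> e s * Kinv S s) (\<tau> e) = A * mat_adjoint W"
    unfolding A_def R_def
    by (rule mat_deriv_left_state_reduced[OF S W V z(1) z(2)[unfolded R_def] P]) (use Suc.prems in auto)
  have N: "Nmat S (Suc (y (Suc e))) s \<in> carrier_mat (statedim S) (statedim S)"
    using Suc.prems(3)[of "Suc e"] by (intro bilinear_carrier(4)[OF S]) auto
  have "left_state R y \<nu> \<tau> (Suc e) s = A * (mat_adjoint W * Nmat S (Suc (y (Suc e))) s * V)"
    by (simp add: IH A_def) (simp add: R_def)
  \<comment> \<open>The \<open>W\<^sup>H\<close> in the reduced \<open>N\<close> is joined to
    \<open>A\<close>, which yields the full derivative by \<open>AE\<close>; only the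
    \<open>V\<close> on the right remains.\<close>
  also have "\<dots> = A * (mat_adjoint W * Nmat S (Suc (y (Suc e))) s) * V"
    by (rule assoc_mult_mat[OF A mult_carrier_mat[OF E N] V, symmetric])
  also have "A * (mat_adjoint W * Nmat S (Suc (y (Suc e))) s) = A * mat_adjoint W * Nmat S (Suc (y (Suc e))) s"
    by (rule assoc_mult_mat[OF A E N, symmetric])
  finally show ?case by (simp add: AE R_def)
qed

text \<open>A column number determines a word and a position in the block of \<open>B\<close>. So it
  is enough to compare, for each word, products of functions of one variable.\<close>

lemma mat_mixed_deriv_transfer_eqI:
  assumes S: "is_bilinear_system S" and R: "is_bilinear_system R"
    and dims: "outdim R = outdim S" "indim R = indim S" and k: "k \<ge> 1"
    and z: "\<And>i. i \<in> {1..k} \<Longrightarrow> analytic_point S (z i)" "\<And>i. i \<in> {1..k} \<Longrightarrow> analytic_point R (z i)"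
    and eq: "\<And>x. (\<And>i. i \<in> {1..<k} \<Longrightarrow> x i < indim S) \<Longrightarrow>
      mat_deriv (j k) (\<lambda>s. Cmat S s * (Kinv S s * right_state S x j z (k - 1) s)) (z k) =
      mat_deriv (j k) (\<lambda>s. Cmat R s * (Kinv R s * right_state R x j z (k - 1) s)) (z k)"
  shows "mat_mixed_deriv k j (transfer S k) z = mat_mixed_deriv k j (transfer R k) z"
proof (rule eq_matI)
  let ?m = "indim S"
  fix a b assume "a < dim_row (mat_mixed_deriv k j (transfer R k) z)" "b < dim_col (mat_mixed_deriv k j (transfer R k) z)"
  then have a: "a < outdim S" and b: "b < ?m ^ (k - 1) * ?m"
    by (auto simp: mat_mixed_deriv_def transfer_dim[OF R] dims)
  \<comment> \<open>The existence of a column excludes \<open>indim S = 0\<close>, where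
    \<open>div\<close> and \<open>mod\<close> would be useless.\<close>
  then have "?m > 0" by (auto intro!: Nat.gr0I)
  then have w: "b div ?m < ?m ^ (k - 1)" and bm: "b mod ?m < ?m"
    using b by (auto simp: less_mult_imp_div_less)
  obtain u where u: "\<And>i. i \<in> {1..k - 1} \<Longrightarrow> u i < ?m" "word_index ?m u (k - 1) = b div ?m"
    using word_index_surj[OF w] by metis
  define x where "x = (\<lambda>i. u (k - i))"
  have x: "x i < ?m" if "i \<in> {1..<k}" for i
    unfolding x_def using that by (intro u) auto
  have "word_index ?m (\<lambda>i. x (k - i)) (k - 1) = b div ?m"
    unfolding u(2)[symmetric] by (rule word_index_cong) (auto simp: x_def)
  then have b_eq: "b = word_index ?m (\<lambda>i. x (k - i)) (k - 1) * ?m + b mod ?m" by simp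
  show "mat_mixed_deriv k j (transfer S k) z $$ (a, b) = mat_mixed_deriv k j (transfer R k) z $$ (a, b)"
    using mat_mixed_deriv_transfer[of S k z x a "b mod ?m" j, OF S k z(1) x a bm]
      mat_mixed_deriv_transfer[of R k z x a "b mod ?m" j, OF R k z(2)] x a bm eq[of x, OF x]
    unfolding dims b_eq[symmetric] by simp
qed (auto simp: mat_mixed_deriv_def transfer_dim[OF S] transfer_dim[OF R] dims)

theorem theorem9:
  fixes S :: bilinear_system
    and W V :: "complex mat"
    and r k \<theta> :: nat
    and \<sigma> \<tau> :: "nat \<Rightarrow> complex"
    and l \<nu> :: "nat \<Rightarrow> nat"
  defines "R \<equiv> reduced_system W V S"
  assumes sys: "is_bilinear_system S"
    and W: "W \<in> carrier_mat (statedim S) r"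
    and V: "V \<in> carrier_mat (statedim S) r"
    and sigma: "\<And>q. q \<in> {1..k} \<Longrightarrow>
          analytic_point S (\<sigma> q) \<and> vec_space.rank r (Kmat R (\<sigma> q)) = r"
    and tau: "\<And>\<eta>. \<eta> \<in> {1..\<theta>} \<Longrightarrow>
          analytic_point S (\<tau> \<eta>) \<and> vec_space.rank r (Kmat R (\<tau> \<eta>)) = r"
  shows
    "(vec_space.col_space (statedim S) (V_blocks S k \<sigma> l)
        \<subseteq> vec_space.col_space (statedim S) V \<longrightarrow>
      (\<forall>q \<in> {1..k}. \<forall>j \<in> {0..l q}.
         mat_mixed_deriv q (V_orders l q j) (transfer S q) \<sigma> =
         mat_mixed_deriv q (V_orders l q j) (transfer R q) \<sigma>))
     \<and>
     (vec_space.col_space (statedim S) (W_blocks S \<theta> \<tau> \<nu>)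
        \<subseteq> vec_space.col_space (statedim S) W \<longrightarrow>
      (\<forall>\<eta> \<in> {1..\<theta>}. \<forall>i \<in> {0..\<nu> (\<theta> - \<eta> + 1)}.
         mat_mixed_deriv \<eta> (W_orders \<nu> \<theta> \<eta> i) (transfer S \<eta>) (W_points \<tau> \<theta> \<eta>) =
         mat_mixed_deriv \<eta> (W_orders \<nu> \<theta> \<eta> i) (transfer R \<eta>) (W_points \<tau> \<theta> \<eta>)))
     \<and>
     (vec_space.col_space (statedim S) (V_blocks S k \<sigma> l)
        \<subseteq> vec_space.col_space (statedim S) V \<and>
      vec_space.col_space (statedim S) (W_blocks S \<theta> \<tau> \<nu>)
        \<subseteq> vec_space.col_space (statedim S) W \<longrightarrow>
      (\<forall>q \<in> {1..k}. \<forall>\<eta> \<in> {1..\<theta>}. \<forall>j \<in> {0..l q}. \<forall>i \<in> {0..\<nu> (\<theta> - \<eta> + 1)}.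
         mat_mixed_deriv (q + \<eta>) (append_args q (V_orders l q j) (W_orders \<nu> \<theta> \<eta> i))
           (transfer S (q + \<eta>)) (append_args q \<sigma> (W_points \<tau> \<theta> \<eta>)) =
         mat_mixed_deriv (q + \<eta>) (append_args q (V_orders l q j) (W_orders \<nu> \<theta> \<eta> i))
           (transfer R (q + \<eta>)) (append_args q \<sigma> (W_points \<tau> \<theta> \<eta>))))"
proof -
  note R = is_bilinear_system_reduced[OF sys W V, folded R_def]
  note E = mat_adjoint_carrier[OF W]
  have dims [simp]: "outdim R = outdim S" "indim R = indim S" "statedim R = r"
    using V by (simp_all add: R_def)
  have \<sigma>: "analytic_point S (\<sigma> q)" "analytic_point R (\<sigma> q)" if "q \<in> {1..k}" for q
    using sigma[OF that] analytic_point_reduced[OF sys W V] by (auto simp: R_def)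
  have \<tau>: "analytic_point S (\<tau> q)" "analytic_point R (\<tau> q)" if "q \<in> {1..\<theta>}" for q
    using tau[OF that] analytic_point_reduced[OF sys W V] by (auto simp: R_def)
  let ?Vsub = "vec_space.col_space (statedim S) (V_blocks S k \<sigma> l) \<subseteq> vec_space.col_space (statedim S) V"
  let ?Wsub = "vec_space.col_space (statedim S) (W_blocks S \<theta> \<tau> \<nu>) \<subseteq> vec_space.col_space (statedim S) W"
  let ?LS = "\<lambda>y. left_state S y (\<lambda>e. \<nu> (\<theta> - e)) (\<lambda>e. \<tau> (\<theta> - e))"
  let ?LR = "\<lambda>y. left_state R y (\<lambda>e. \<nu> (\<theta> - e)) (\<lambda>e. \<tau> (\<theta> - e))"

  have rS: "analytic_mat_at (statedim S) (indim S) (right_state S x l \<sigma> (q - 1)) (\<sigma> q)"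
    if "q \<in> {1..k}" "\<And>i. i \<in> {1..<q} \<Longrightarrow> x i < indim S" for q x
    by (rule analytic_mat_at_right_state[OF sys \<sigma>(1)[OF that(1)]]) (use \<sigma> that in auto)
  have lS: "analytic_mat_at (outdim S) (statedim S) (?LS y e) (\<tau> (\<theta> - e))"
    if "e < \<theta>" "\<And>i. i \<in> {1..e} \<Longrightarrow> y i < indim S" for e y
  proof (rule analytic_mat_at_left_state[OF sys])
    show "analytic_point S (\<tau> (\<theta> - e))" using that by (intro \<tau>) auto
    show "analytic_point S (\<tau> (\<theta> - i))" if "i < e" for i using that \<open>e < \<theta>\<close> by (intro \<tau>) auto
  qed (use that in auto)
  have imV: "\<exists>Y \<in> carrier_mat r (indim S). mat_deriv j (\<lambda>s. Kinv S s * right_state S x l \<sigma> (q - 1) s) (\<sigma> q) = V * Y"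
    if ?Vsub "q \<in> {1..k}" "j \<le> l q" "\<And>i. i \<in> {1..<q} \<Longrightarrow> x i < indim S" for q j x
    using V_block_image[OF sys V \<sigma>(1) that(1,2,3)] that(4) by blast
  have imW: "\<exists>Y \<in> carrier_mat (outdim S) r. mat_deriv i (\<lambda>s. ?LS y e s * Kinv S s) (\<tau> (\<theta> - e)) = Y * mat_adjoint W"
    if ?Wsub "e < \<theta>" "i \<le> \<nu> (\<theta> - e)" "\<And>i. i \<in> {1..e} \<Longrightarrow> y i < indim S" for e i y
    using W_block_image[OF sys W \<tau>(1) that(1,2,3)] that(4) by blast
  have rR: "right_state R x l \<sigma> (q - 1) s = mat_adjoint W * right_state S x l \<sigma> (q - 1) s"
    if ?Vsub "q \<in> {1..k}" "\<And>i. i \<in> {1..<q} \<Longrightarrow> x i < indim S" for q x s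
    unfolding R_def
  proof (rule right_state_reduced[OF sys W V])
    fix i j assume "i \<in> {1..q - 1}" "j \<le> l i"
    then show "\<exists>Y \<in> carrier_mat r (indim S). mat_deriv j (\<lambda>s. Kinv S s * right_state S x l \<sigma> (i - 1) s) (\<sigma> i) = V * Y"
      using that by (intro imV) auto
  qed (use \<sigma> that in \<open>auto simp: R_def\<close>)
  have lR: "?LR y e s = ?LS y e s * V"
    if ?Wsub "e < \<theta>" "\<And>i. i \<in> {1..e} \<Longrightarrow> y i < indim S" for e y s
    unfolding R_def
  proof (rule left_state_reduced[OF sys W V])
    fix i j assume "i < e" "j \<le> \<nu> (\<theta> - i)"
    then show "\<exists>Y \<in> carrier_mat (outdim S) r. mat_deriv j (\<lambda>s. ?LS y i s * Kinv S s) (\<tau> (\<theta> - i)) = Y * mat_adjoint W"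
      using that by (intro imW) auto
  next
    fix i assume "i < e"
    then have "\<theta> - i \<in> {1..\<theta>}" using that by auto
    from \<tau>[OF this] show "analytic_point S (\<tau> (\<theta> - i))" "analytic_point (reduced_system W V S) (\<tau> (\<theta> - i))"
      by (auto simp: R_def)
  qed (use that in auto)

  have a: "mat_mixed_deriv q (V_orders l q j) (transfer S q) \<sigma> = mat_mixed_deriv q (V_orders l q j) (transfer R q) \<sigma>"
    if V': ?Vsub and q: "q \<in> {1..k}" and j: "j \<in> {0..l q}" for q j
  proof (rule mat_mixed_deriv_transfer_eqI[OF sys R])
    fix x assume x: "\<And>i. i \<in> {1..<q} \<Longrightarrow> x i < indim S"
    \<comment> \<open>Only the order of the last variable is changed to \<open>j\<close>, and the
      state at \<open>q - 1\<close> does not use it.\<close>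
    have orders: "right_state T x (V_orders l q j) \<sigma> (q - 1) = right_state T x l \<sigma> (q - 1)" for T
      by (rule right_state_cong) (use q in \<open>auto simp: V_orders_def\<close>)
    \<comment> \<open>The projection with \<open>M = C\<close>, since \<open>C V\<close> is the
      reduced \<open>C\<close>; after this, \<open>rR\<close> replaces the projected state by the
      reduced one.\<close>
    have "mat_deriv j (\<lambda>s. Cmat S s * (Kinv S s * right_state S x l \<sigma> (q - 1) s)) (\<sigma> q) =
       mat_deriv j (\<lambda>s. Cmat S s * V * (Kinv R s * (mat_adjoint W * right_state S x l \<sigma> (q - 1) s))) (\<sigma> q)"
      unfolding R_def
      by (rule right_projection[OF sys W V \<sigma>(1)[OF q] \<sigma>(2)[OF q, unfolded R_def] analytic_mat_at_system(1)[OF sys \<sigma>(1)[OF q]] rS[where x = x, OF q x]])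
        (use imV[OF V' q] x j in auto)
    also have "\<dots> = mat_deriv j (\<lambda>s. Cmat R s * (Kinv R s * right_state R x l \<sigma> (q - 1) s)) (\<sigma> q)"
      using rR[where x = x, OF V' q x] by (simp add: R_def)
    finally show "mat_deriv (V_orders l q j q) (\<lambda>s. Cmat S s * (Kinv S s * right_state S x (V_orders l q j) \<sigma> (q - 1) s)) (\<sigma> q) =
      mat_deriv (V_orders l q j q) (\<lambda>s. Cmat R s * (Kinv R s * right_state R x (V_orders l q j) \<sigma> (q - 1) s)) (\<sigma> q)"
      unfolding orders by (simp add: V_orders_def)
  qed (use q \<sigma> in auto)

  have b: "mat_mixed_deriv \<eta> (W_orders \<nu> \<theta> \<eta> i) (transfer S \<eta>) (W_points \<tau> \<theta> \<eta>) =
      mat_mixed_deriv \<eta> (W_orders \<nu> \<theta> \<eta> i) (transfer R \<eta>) (W_points \<tau> \<theta> \<eta>)"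
    if W': ?Wsub and \<eta>: "\<eta> \<in> {1..\<theta>}" and i: "i \<in> {0..\<nu> (\<theta> - \<eta> + 1)}" for \<eta> i
  proof -
    define z where "z = W_points \<tau> \<theta> \<eta>"
    define ord where "ord = W_orders \<nu> \<theta> \<eta> i"
    define e where "e = \<eta> - 1"
    have e: "\<eta> = Suc e" "e < \<theta>" "\<theta> - \<eta> + 1 = \<theta> - e" using \<eta> by (auto simp: e_def)
    have z: "analytic_point S (z a)" "analytic_point R (z a)" if "a \<in> {1..\<eta>}" for a
    proof -
      have "\<theta> - \<eta> + a \<in> {1..\<theta>}" using that \<eta> by auto
      from \<tau>[OF this] show "analytic_point S (z a)" "analytic_point R (z a)" by (auto simp: z_def W_points_def)
    qed
    have z1: "z 1 = \<tau> (\<theta> - e)" and o1: "ord 1 = i" using e by (auto simp: z_def W_points_def ord_def W_orders_def)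
    have ze: "analytic_point S (\<tau> (\<theta> - e))" "analytic_point R (\<tau> (\<theta> - e))" using z[of 1] \<eta> unfolding z1 by auto
    show ?thesis
      unfolding z_def[symmetric] ord_def[symmetric]
    proof (rule mat_mixed_deriv_transfer_eqI[OF sys R])
      fix x assume x: "\<And>i. i \<in> {1..<\<eta>} \<Longrightarrow> x i < indim S"
      define y where "y = (\<lambda>e. x (\<eta> - e))"
      have y: "y a < indim S" if "a \<in> {1..e}" for a
        unfolding y_def using that by (intro x) (auto simp: e)
      have lRy: "?LR y e s = ?LS y e s * V" for s
        by (rule lR[OF W' e(2)]) (rule y)
      have lSy: "analytic_mat_at (outdim S) (statedim S) (?LS y e) (\<tau> (\<theta> - e))"
        by (rule lS[OF e(2)]) (rule y)
      \<comment> \<open>Distances below \<open>e = \<eta> - 1\<close> belong to positions from 2 on,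
        so the free order at position 1 does not enter.\<close>
      have lf: "left_state T y (\<lambda>i. ord (\<eta> - i)) (\<lambda>i. z (\<eta> - i)) e = left_state T y (\<lambda>e. \<nu> (\<theta> - e)) (\<lambda>e. \<tau> (\<theta> - e)) e" for T
        by (rule left_state_cong) (use \<eta> in \<open>auto simp: ord_def z_def W_orders_def W_points_def e\<close>)
      \<comment> \<open>The cut is moved all the way to the first variable, where the right state is
        \<open>B\<close> and the order \<open>i\<close> is free.\<close>
      have shift: "mat_deriv (ord \<eta>) (\<lambda>s. Cmat T s * (Kinv T s * right_state T x ord z (\<eta> - 1) s)) (z \<eta>) =
          mat_deriv i (\<lambda>s. left_state T y (\<lambda>e. \<nu> (\<theta> - e)) (\<lambda>e. \<tau> (\<theta> - e)) e s * (Kinv T s * Bmat T s)) (\<tau> (\<theta> - e))"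
        if T: "is_bilinear_system T" "\<And>a. a \<in> {1..\<eta>} \<Longrightarrow> analytic_point T (z a)" "indim T = indim S" for T
        using left_state_right_state_shift[of T e 0 e z x ord, OF T(1)] T(2,3) x lf[of T] z1 o1
        by (simp add: e y_def)
      note B = analytic_mat_at_system(3)[OF sys ze(1)]
      have "mat_deriv i (\<lambda>s. ?LS y e s * (Kinv S s * Bmat S s)) (\<tau> (\<theta> - e)) =
          mat_deriv i (\<lambda>s. ?LS y e s * Kinv S s * Bmat S s) (\<tau> (\<theta> - e))"
        by (rule mat_deriv_cong[OF analytic_mat_at_eventually_assoc[OF lSy analytic_mat_at_system(2)[OF sys ze(1)] B]])
      \<comment> \<open>The projection with \<open>M = B\<close>, dual to the use of
        \<open>M = C\<close> for part (a).\<close>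
      also have "\<dots> = mat_deriv i (\<lambda>s. ?LS y e s * V * Kinv R s * (mat_adjoint W * Bmat S s)) (\<tau> (\<theta> - e))"
        unfolding R_def
        by (rule left_projection[OF sys W V ze(1) ze(2)[unfolded R_def] lSy B])
          (use imW[OF W' e(2)] y i e in auto)
      also have "\<dots> = mat_deriv i (\<lambda>s. ?LR y e s * Kinv R s * Bmat R s) (\<tau> (\<theta> - e))"
        unfolding lRy by (simp add: R_def)
      also have "\<dots> = mat_deriv i (\<lambda>s. ?LR y e s * (Kinv R s * Bmat R s)) (\<tau> (\<theta> - e))"
      proof (rule mat_deriv_cong)
        have "analytic_mat_at (outdim S) r (?LR y e) (\<tau> (\<theta> - e))"
          unfolding ext[of "?LR y e" "\<lambda>s. ?LS y e s * V", OF lRy]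
          by (rule analytic_mat_at_mult[OF lSy analytic_mat_at_const[OF V]])
        then show "\<forall>\<^sub>F s in nhds (\<tau> (\<theta> - e)). ?LR y e s * Kinv R s * Bmat R s = ?LR y e s * (Kinv R s * Bmat R s)"
          using analytic_mat_at_eventually_assoc[of "outdim S" r "?LR y e" _ r "Kinv R" "indim S" "Bmat R"]
            analytic_mat_at_system(2,3)[OF R ze(2)]
          by (simp add: eq_commute del: assoc_mult_mat)
      qed
      finally show "mat_deriv (ord \<eta>) (\<lambda>s. Cmat S s * (Kinv S s * right_state S x ord z (\<eta> - 1) s)) (z \<eta>) =
          mat_deriv (ord \<eta>) (\<lambda>s. Cmat R s * (Kinv R s * right_state R x ord z (\<eta> - 1) s)) (z \<eta>)"
        using shift[OF sys z(1)] shift[OF R z(2)] by simp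
    qed (use \<eta> z in auto)
  qed

  have c: "mat_mixed_deriv (q + \<eta>) (append_args q (V_orders l q j) (W_orders \<nu> \<theta> \<eta> i))
           (transfer S (q + \<eta>)) (append_args q \<sigma> (W_points \<tau> \<theta> \<eta>)) =
         mat_mixed_deriv (q + \<eta>) (append_args q (V_orders l q j) (W_orders \<nu> \<theta> \<eta> i))
           (transfer R (q + \<eta>)) (append_args q \<sigma> (W_points \<tau> \<theta> \<eta>))"
    if V': ?Vsub and W': ?Wsub and q: "q \<in> {1..k}" and \<eta>: "\<eta> \<in> {1..\<theta>}" and j: "j \<in> {0..l q}"
      and i: "i \<in> {0..\<nu> (\<theta> - \<eta> + 1)}" for q \<eta> j i
  proof -
    define z where "z = append_args q \<sigma> (W_points \<tau> \<theta> \<eta>)"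
    define ord where "ord = append_args q (V_orders l q j) (W_orders \<nu> \<theta> \<eta> i)"
    define e where "e = \<eta> - 1"
    have e: "\<eta> = Suc e" "e < \<theta>" "\<theta> - \<eta> + 1 = \<theta> - e" using \<eta> by (auto simp: e_def)
    define q' where "q' = q - 1"
    have q': "q = Suc q'" using q by (auto simp: q'_def)
    have z: "analytic_point S (z a)" "analytic_point R (z a)" if a: "a \<in> {1..q + \<eta>}" for a
    proof -
      have "analytic_point S (z a) \<and> analytic_point R (z a)"
      proof (cases "a \<le> q")
        case True
        then show ?thesis using a q \<sigma>[of a] by (auto simp: z_def append_args_def)
      next
        case False
        then have "\<theta> - \<eta> + (a - q) \<in> {1..\<theta>}" using a \<eta> by auto
        from \<tau>[OF this] False show ?thesis by (auto simp: z_def append_args_def W_points_def)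
      qed
      then show "analytic_point S (z a)" "analytic_point R (z a)" by auto
    qed
    have zq: "z q = \<sigma> q" and oq: "ord q = j"
      by (auto simp: z_def ord_def append_args_def V_orders_def)
    have zq1: "z (Suc q) = \<tau> (\<theta> - e)" and oq1: "ord (Suc q) = i"
      using e by (auto simp: z_def ord_def append_args_def W_points_def W_orders_def)
    have ze: "analytic_point S (\<tau> (\<theta> - e))" "analytic_point R (\<tau> (\<theta> - e))" using z[of "Suc q"] \<eta> unfolding zq1 by auto
    note sq = \<sigma>[OF q]
    show ?thesis
      unfolding z_def[symmetric] ord_def[symmetric]
    proof (rule mat_mixed_deriv_transfer_eqI[OF sys R])
      fix x assume x: "\<And>i. i \<in> {1..<q + \<eta>} \<Longrightarrow> x i < indim S"
      define y where "y = (\<lambda>e. x (q + \<eta> - e))"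
      have y: "y a < indim S" if "a \<in> {1..e}" for a
        unfolding y_def using that by (intro x) (auto simp: e)
      have lRy: "?LR y e s = ?LS y e s * V" for s
        by (rule lR[OF W' e(2)]) (rule y)
      have lSy: "analytic_mat_at (outdim S) (statedim S) (?LS y e) (\<tau> (\<theta> - e))"
        by (rule lS[OF e(2)]) (rule y)
      have xq: "x q < indim S" and xl: "\<And>i. i \<in> {1..<q} \<Longrightarrow> x i < indim S" using x q \<eta> by auto
      \<comment> \<open>The first \<open>e\<close> letters and points counted from the end all lie
        in the left group of the data, beyond the point with the free order
        \<open>i\<close>.\<close>
      have lf: "left_state T y (\<lambda>i. ord (q + \<eta> - i)) (\<lambda>i. z (q + \<eta> - i)) e = left_state T y (\<lambda>e. \<nu> (\<theta> - e)) (\<lambda>e. \<tau> (\<theta> - e)) e" for T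
        by (rule left_state_cong) (use \<eta> in \<open>auto simp: ord_def z_def append_args_def W_orders_def W_points_def e\<close>)
      have rf: "right_state T x ord z (q - 1) = right_state T x l \<sigma> (q - 1)" for T
        by (rule right_state_cong) (use q in \<open>auto simp: ord_def z_def append_args_def V_orders_def\<close>)
      define A where "A = (\<lambda>T. mat_deriv i (\<lambda>s. left_state T y (\<lambda>e. \<nu> (\<theta> - e)) (\<lambda>e. \<tau> (\<theta> - e)) e s * Kinv T s) (\<tau> (\<theta> - e)))"
      \<comment> \<open>Cut between the two groups of points: \<open>A T\<close> collects the
        variables after \<open>s\<^sub>q\<close>, and the other factor contains
        \<open>s\<^sub>1, ..., s\<^sub>q\<close> together with the \<open>N\<close> that links the
        groups.\<close>
      have shift: "mat_deriv (ord (q + \<eta>)) (\<lambda>s. Cmat T s * (Kinv T s * right_state T x ord z (q + \<eta> - 1) s)) (z (q + \<eta>)) =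
          A T * mat_deriv j (\<lambda>s. Nmat T (Suc (x q)) s * (Kinv T s * right_state T x l \<sigma> (q - 1) s)) (\<sigma> q)"
        if T: "is_bilinear_system T" "\<And>a. a \<in> {1..q + \<eta>} \<Longrightarrow> analytic_point T (z a)" "indim T = indim S"
          and L: "analytic_mat_at (outdim T) (statedim T) (left_state T y (\<lambda>e. \<nu> (\<theta> - e)) (\<lambda>e. \<tau> (\<theta> - e)) e) (\<tau> (\<theta> - e))" for T
      proof -
        have tq: "analytic_point T (\<sigma> q)" and te: "analytic_point T (\<tau> (\<theta> - e))"
          using T(2)[of q] T(2)[of "Suc q"] q \<eta> by (auto simp: zq zq1)
        have A: "A T \<in> carrier_mat (outdim T) (statedim T)"
          unfolding A_def by (rule mat_deriv_carrier[OF analytic_mat_at_mult[OF L analytic_mat_at_system(2)[OF T(1) te]]])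
        have rT: "analytic_mat_at (statedim T) (indim T) (right_state T x l \<sigma> (q - 1)) (\<sigma> q)"
        proof (rule analytic_mat_at_right_state[OF T(1) tq])
          fix a assume "a \<in> {1..q - 1}"
          then have "z a = \<sigma> a" "a \<in> {1..q + \<eta>}" "a \<in> {1..<q}" by (auto simp: z_def append_args_def)
          then show "analytic_point T (\<sigma> a)" "x a < indim T"
            using T(2)[of a] T(3) xl[of a] by auto
        qed
        \<comment> \<open>One step more than \<open>e = \<eta> - 1\<close>: the \<open>N\<close> of
          the left state at \<open>Suc e\<close> is evaluated at \<open>s\<^sub>q\<close> and has
          the letter \<open>x q\<close>.\<close>
        have lS: "left_state T y (\<lambda>i. ord (q + \<eta> - i)) (\<lambda>i. z (q + \<eta> - i)) (Suc e) = (\<lambda>s. A T * Nmat T (Suc (x q)) s)"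
        proof -
          have "q + \<eta> - e = Suc q" "y (Suc e) = x q" using e by (auto simp: y_def)
          then show ?thesis unfolding left_state.simps lf by (simp add: A_def zq1 oq1)
        qed
        have "mat_deriv (ord (q + \<eta>)) (\<lambda>s. Cmat T s * (Kinv T s * right_state T x ord z (q + \<eta> - 1) s)) (z (q + \<eta>)) =
           mat_deriv j (\<lambda>s. A T * Nmat T (Suc (x q)) s * (Kinv T s * right_state T x l \<sigma> (q - 1) s)) (\<sigma> q)"
        proof -
          have idx: "Suc (q' + \<eta>) = q + \<eta>" "q' + \<eta> = q + \<eta> - 1" "Suc q' = q" "q' = q - 1"
            by (auto simp: q')
          have "mat_deriv (ord (Suc (q' + \<eta>))) (\<lambda>s. Cmat T s * (Kinv T s * right_state T x ord z (q' + \<eta>) s)) (z (Suc (q' + \<eta>))) =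
            mat_deriv (ord (Suc q')) (\<lambda>s. left_state T (\<lambda>i. x (Suc (q' + \<eta>) - i)) (\<lambda>i. ord (Suc (q' + \<eta>) - i))
              (\<lambda>i. z (Suc (q' + \<eta>) - i)) (Suc e) s * (Kinv T s * right_state T x ord z q' s)) (z (Suc q'))"
          proof (rule left_state_right_state_shift[OF T(1)])
            show "x i < indim T" if "i \<in> {1..q' + \<eta>}" for i
              unfolding T(3) using that by (intro x) (auto simp: q')
          qed (use T(2) in \<open>auto simp: q' e\<close>)
          then show ?thesis
            unfolding idx(1,3) unfolding idx(2) unfolding idx(4) y_def[symmetric] lS rf zq oq .
        qed
        also have "\<dots> = A T * mat_deriv j (\<lambda>s. Nmat T (Suc (x q)) s * (Kinv T s * right_state T x l \<sigma> (q - 1) s)) (\<sigma> q)"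
          by (rule mat_deriv_const_assoc[OF A analytic_mat_at_Nmat[OF T(1) tq] analytic_mat_at_mult[OF analytic_mat_at_system(2)[OF T(1) tq] rT]])
            (use xq T in auto)
        finally show ?thesis .
      qed
      have rRx: "right_state R x l \<sigma> (q - 1) s = mat_adjoint W * right_state S x l \<sigma> (q - 1) s" for s
        by (rule rR[OF V' q]) (rule xl)
      let ?D = "mat_deriv j (\<lambda>s. Nmat S (Suc (x q)) s * (Kinv S s * right_state S x l \<sigma> (q - 1) s)) (\<sigma> q)"
      have lR': "analytic_mat_at (outdim S) r (?LR y e) (\<tau> (\<theta> - e))"
        unfolding ext[of "?LR y e" "\<lambda>s. ?LS y e s * V", OF lRy]
        by (rule analytic_mat_at_mult[OF lSy analytic_mat_at_const[OF V]])
      have AR: "A R \<in> carrier_mat (outdim S) r"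
        unfolding A_def using analytic_mat_at_mult[OF lR', of r "Kinv R"] analytic_mat_at_system(2)[OF R ze(2)] by (simp add: mat_deriv_carrier)
      have D: "?D \<in> carrier_mat (statedim S) (indim S)"
        by (rule mat_deriv_carrier[OF analytic_mat_at_mult[OF analytic_mat_at_Nmat[OF sys sq(1) xq] analytic_mat_at_mult[OF analytic_mat_at_system(2)[OF sys sq(1)] rS[where x = x, OF q xl]]]])
      \<comment> \<open>\<open>W\<close> gives \<open>A S = A R * W\<^sup>H\<close>, and
        \<open>V\<close> gives that \<open>W\<^sup>H\<close> times the right part is the reduced
        right part. The two halves meet in this one \<open>W\<^sup>H\<close>.\<close>
      have "A S = A R * mat_adjoint W"
        unfolding A_def lRy unfolding R_def
        by (rule mat_deriv_left_state_reduced[OF sys W V ze(1) ze(2)[unfolded R_def] lSy])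
          (use imW[OF W' e(2)] y i e in auto)
      then have "A S * ?D = A R * (mat_adjoint W * ?D)"
        using assoc_mult_mat[OF AR E D] by simp
      also have "mat_adjoint W * ?D = mat_deriv j (\<lambda>s. Nmat R (Suc (x q)) s * (Kinv R s * right_state R x l \<sigma> (q - 1) s)) (\<sigma> q)"
        unfolding rRx unfolding R_def
        by (rule mat_deriv_reduced_N[OF sys W V sq(1) sq(2)[unfolded R_def] xq rS[where x = x, OF q xl], symmetric])
          (use imV[OF V' q] xl j in auto)
      finally show "mat_deriv (ord (q + \<eta>)) (\<lambda>s. Cmat S s * (Kinv S s * right_state S x ord z (q + \<eta> - 1) s)) (z (q + \<eta>)) =
          mat_deriv (ord (q + \<eta>)) (\<lambda>s. Cmat R s * (Kinv R s * right_state R x ord z (q + \<eta> - 1) s)) (z (q + \<eta>))"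
        using shift[OF sys z(1) _ lSy] shift[OF R z(2)] lR' by simp
    qed (use \<eta> z in auto)
  qed
  show ?thesis using a b c by blast
qed

end
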